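(* The functor $\mathcal{G}$ restricts to an equivalence of categories $\mathbf{OA_i}\simeq\mathbf{OH_i}$, where $\mathbf{OA_i}$ is the category of proper orthoalgebras and injective orthoalgebra morphisms, and $\mathbf{OH_i}$ is the category of orthohypergraphs in which every point lies on a line and injective orthohypergraph morphisms.
   Context: **Orthoalgebras.** An orthoalgebra is a set $A$ with a partial binary operation $\oplus$ (write $a\perp b$ when $a\oplus b$ is defined), a unary operation $'$ and constants $0,1$ such that: (1) $\oplus$ is commutative and associative in the usual sense for partial operations (if one side is defined so is the other and they are equal); (2) $a'$ is the unique element with $a\oplus a'$ defined and equal to $1$; (3) $a\oplus a$ is defined iff $a=0$. It is Boolean if it arises from a Boolean algebra by restricting the join to pairs of orthogonal elements. A morphism $f\colon A\to C$ is a function that preserves $'$ and satisfies: if $a\oplus b$ is defined then so is $f(a)\oplus f(b)$, and $f(a\oplus b)=f(a)\oplus f(b)$. A subalgebra is a subset containing $0,1$, closed under $'$ and under $\oplus$ (when defined); a Boolean subalgebra is a subalgebra that is a Boolean orthoalgebra. $\mathrm{BSub}(A)$ is the poset of Boolean subalgebras under inclusion. A block is a maximal Boolean subalgebra; it is small if it has at most $4$ elements. $A$ is proper if it has no small blocks. For $a\in A$ put $x_a=\{0,a,a',1\}$; the atoms of $\mathrm{BSub}(A)$ are the $x_a$ with $a\ne 0,1$. **Hypergraphs.** A hypergraph is a triple $(P,L,T)$ of a set $P$ of points, a set $L$ of lines and a set $T$ of planes; each line is a set of $3$ points, and each plane is a set of $7$ points that can be labelled $c_1,c_2,c_3,c_4,e_1,e_2,e_3$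 so that the lines contained in it are exactly $\{c_1,c_2,e_1\},\{c_3,c_4,e_1\},\{c_1,c_3,e_2\},\{c_2,c_4,e_2\},\{c_1,c_4,e_3\},\{c_2,c_3,e_3\}$. The $c_i$ are the corner points of the plane and the $e_j$ its edge points. $\mathcal{G}(A)$ is the hypergraph whose points are the atoms of $\mathrm{BSub}(A)$, whose lines are the sets of three atoms lying below an element of height $2$ of $\mathrm{BSub}(A)$, and whose planes are the sets of seven atoms lying below an element of height $3$. An orthohypergraph is a hypergraph isomorphic to $\mathcal{G}(A)$ for some orthoalgebra $A$. **Orthohypergraph morphisms.** For orthohypergraphs $\mathcal{G},\mathcal{H}$ with point sets $P,Q$, a morphism $\alpha\colon\mathcal{G}\to\mathcal{H}$ is a partial function $\alpha\colon P\to Q$ such that: (A1) for each line $l$ of $\mathcal{G}$ one of: (i) $\alpha$ is undefined at all points of $l$; (ii) $\alpha$ is undefined at exactly one point of $l$ and maps the other two to the same point; (iii) $\alpha$ is defined on $l$ and maps it bijectively onto a line of $\mathcal{H}$. (A2) for each plane $t$ of $\mathcal{G}$ one of: (i) $\alpha$ is undefined at all points of $t$; (ii) for some labelling of the points of $t$ by $c_1,c_2,c_3,c_4,e_1,e_2,e_3$ such that the lines contained in $t$ are exactly $\{c_1,c_2,e_1\},\{c_3,c_4,e_1\},\{c_1,c_3,e_2\},\{c_2,c_4,e_2\},\{c_1,c_4,e_3\},\{c_2,c_3,e_3\}$, $\alpha$ is undefined exactly at $c_1,c_2,e_1$ and maps the other four points to one point; (iii) for some such labelling, $\alpha$ is undefined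 exactly at $c_1$, and $\alpha(c_2)=\alpha(e_1)$, $\alpha(c_3)=\alpha(e_2)$, $\alpha(c_4)=\alpha(e_3)$ are the three distinct points of a line of $\mathcal{H}$; (iv) $\alpha$ is defined on $t$ and maps it isomorphically (bijectively, and carrying lines to lines in both directions) onto a plane of $\mathcal{H}$. (A3) if $l,m$ are lines of $\mathcal{G}$ that intersect in the point $p$, and $\alpha(l),\alpha(m)$ are distinct lines of a plane $t'$ of $\mathcal{H}$ whose intersection is an edge point $\alpha(p)$ of $t'$, then $l,m$ lie in a plane $t$ of $\mathcal{G}$ that is mapped isomorphically to $t'$. Composition is that of partial functions. **The functor $\mathcal{G}$.** It goes from the category of orthoalgebras and orthoalgebra morphisms to the category of orthohypergraphs and orthohypergraph morphisms. On objects it is $A\mapsto\mathcal{G}(A)$. For an orthoalgebra morphism $f\colon A\to C$, $\mathcal{G}(f)$ is the partial map on points with $\mathcal{G}(f)(x_a)=x_{f(a)}$ if $f(a)\neq0,1$, and undefined otherwise.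
   Formalization: Orthohypergraphs in OH_i are required to have at least one point: the empty hypergraph is G({0,1}) and vacuously qualifies, but no proper orthoalgebra is mapped to it. Injective orthohypergraph morphisms are taken to be defined at every point. *)

theory Defs
  imports Main "HOL-Library.FuncSet"
begin

section \<open>Categories\<close>

text \<open>Hom-sets need not be disjoint, so composition takes the objects involved as arguments:
  \<open>Comp C X Y Z g f\<close> composes \<open>f : X \<rightarrow> Y\<close> with \<open>g : Y \<rightarrow> Z\<close>.\<close>

record ('o, 'm) category =
  Obj :: "'o set"
  Hom :: "'o \<Rightarrow> 'o \<Rightarrow> 'm set"
  Id :: "'o \<Rightarrow> 'm"
  Comp :: "'o \<Rightarrow> 'o \<Rightarrow> 'o \<Rightarrow> 'm \<Rightarrow> 'm \<Rightarrow> 'm"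

locale is_category =
  fixes C :: "('o, 'm) category"
  assumes Id_in_Hom: "X \<in> Obj C \<Longrightarrow> Id C X \<in> Hom C X X"
    and Comp_in_Hom: "\<lbrakk>X \<in> Obj C; Y \<in> Obj C; Z \<in> Obj C; f \<in> Hom C X Y; g \<in> Hom C Y Z\<rbrakk>
      \<Longrightarrow> Comp C X Y Z g f \<in> Hom C X Z"
    and Comp_Id_right: "\<lbrakk>X \<in> Obj C; Y \<in> Obj C; f \<in> Hom C X Y\<rbrakk> \<Longrightarrow> Comp C X X Y f (Id C X) = f"
    and Comp_Id_left: "\<lbrakk>X \<in> Obj C; Y \<in> Obj C; f \<in> Hom C X Y\<rbrakk> \<Longrightarrow> Comp C X Y Y (Id C Y) f = f"
    and Comp_assoc: "\<lbrakk>W \<in> Obj C; X \<in> Obj C; Y \<in> Obj C; Z \<in> Obj C;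
        f \<in> Hom C W X; g \<in> Hom C X Y; h \<in> Hom C Y Z\<rbrakk>
      \<Longrightarrow> Comp C W Y Z h (Comp C W X Y g f) = Comp C W X Z (Comp C X Y Z h g) f"

locale is_functor = source: is_category C + target: is_category D
  for C :: "('o, 'm) category" and D :: "('p, 'n) category" +
  fixes Fo :: "'o \<Rightarrow> 'p" and Fm :: "'o \<Rightarrow> 'o \<Rightarrow> 'm \<Rightarrow> 'n"
  assumes Fo_in_Obj: "X \<in> Obj C \<Longrightarrow> Fo X \<in> Obj D"
    and Fm_in_Hom: "\<lbrakk>X \<in> Obj C; Y \<in> Obj C; f \<in> Hom C X Y\<rbrakk> \<Longrightarrow> Fm X Y f \<in> Hom D (Fo X) (Fo Y)"
    and Fm_Id: "X \<in> Obj C \<Longrightarrow> Fm X X (Id C X) = Id D (Fo X)"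
    and Fm_Comp: "\<lbrakk>X \<in> Obj C; Y \<in> Obj C; Z \<in> Obj C; f \<in> Hom C X Y; g \<in> Hom C Y Z\<rbrakk>
      \<Longrightarrow> Fm X Z (Comp C X Y Z g f) = Comp D (Fo X) (Fo Y) (Fo Z) (Fm Y Z g) (Fm X Y f)"

definition is_iso :: "('o, 'm) category \<Rightarrow> 'o \<Rightarrow> 'o \<Rightarrow> 'm \<Rightarrow> bool" where
  "is_iso C X Y f \<longleftrightarrow> f \<in> Hom C X Y \<and>
     (\<exists>g\<in>Hom C Y X. Comp C X Y X g f = Id C X \<and> Comp C Y X Y f g = Id C Y)"

definition is_natural_iso :: "('o, 'm) category \<Rightarrow> ('p, 'n) category \<Rightarrow>
    ('o \<Rightarrow> 'p) \<Rightarrow> ('o \<Rightarrow> 'o \<Rightarrow> 'm \<Rightarrow> 'n) \<Rightarrow> ('o \<Rightarrow> 'p) \<Rightarrow> ('o \<Rightarrow> 'o \<Rightarrow> 'm \<Rightarrow> 'n) \<Rightarrow> ('o \<Rightarrow> 'n) \<Rightarrow> bool" where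
  "is_natural_iso C D Fo Fm Ko Km \<eta> \<longleftrightarrow>
     (\<forall>X\<in>Obj C. is_iso D (Fo X) (Ko X) (\<eta> X)) \<and>
     (\<forall>X\<in>Obj C. \<forall>Y\<in>Obj C. \<forall>f\<in>Hom C X Y.
        Comp D (Fo X) (Ko X) (Ko Y) (Km X Y f) (\<eta> X) = Comp D (Fo X) (Fo Y) (Ko Y) (\<eta> Y) (Fm X Y f))"

definition is_equivalence :: "('o, 'm) category \<Rightarrow> ('p, 'n) category \<Rightarrow>
    ('o \<Rightarrow> 'p) \<Rightarrow> ('o \<Rightarrow> 'o \<Rightarrow> 'm \<Rightarrow> 'n) \<Rightarrow> bool" where
  "is_equivalence C D Fo Fm \<longleftrightarrow> is_functor C D Fo Fm \<and>
     (\<exists>Ko Km \<eta> \<epsilon>. is_functor D C Ko Km \<and>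
        is_natural_iso C C (\<lambda>X. X) (\<lambda>X Y f. f)
          (\<lambda>X. Ko (Fo X)) (\<lambda>X Y f. Km (Fo X) (Fo Y) (Fm X Y f)) \<eta> \<and>
        is_natural_iso D D (\<lambda>X. Fo (Ko X)) (\<lambda>X Y g. Fm (Ko X) (Ko Y) (Km X Y g))
          (\<lambda>X. X) (\<lambda>X Y g. g) \<epsilon>)"


section \<open>Orthoalgebras\<close>

text \<open>\<open>oplus A a b = None\<close> means that the sum of \<open>a\<close> and \<open>b\<close> is undefined.\<close>

record 'a oalg =
  carrier :: "'a set"
  oplus :: "'a \<Rightarrow> 'a \<Rightarrow> 'a option"
  compl :: "'a \<Rightarrow> 'a"
  zero :: 'a
  one :: 'a

text \<open>The operations are undefined (respectively \<^const>\<open>undefined\<close>) off the carrier, so that two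
  records that represent the same orthoalgebra are equal.\<close>

locale orthoalgebra =
  fixes A :: "'a oalg"
  assumes zero_closed: "zero A \<in> carrier A"
    and one_closed: "one A \<in> carrier A"
    and compl_closed: "compl A \<in> carrier A \<rightarrow>\<^sub>E carrier A"
    and oplus_closed: "oplus A a b = Some c \<Longrightarrow> a \<in> carrier A \<and> b \<in> carrier A \<and> c \<in> carrier A"
    and oplus_commute: "\<lbrakk>a \<in> carrier A; b \<in> carrier A\<rbrakk> \<Longrightarrow> oplus A a b = oplus A b a"
    and oplus_assoc: "\<lbrakk>a \<in> carrier A; b \<in> carrier A; c \<in> carrier A\<rbrakk> \<Longrightarrow>
      Option.bind (oplus A a b) (\<lambda>d. oplus A d c) = Option.bind (oplus A b c) (\<lambda>d. oplus A a d)"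
    and compl_unique: "\<lbrakk>a \<in> carrier A; b \<in> carrier A\<rbrakk> \<Longrightarrow> oplus A a b = Some (one A) \<longleftrightarrow> b = compl A a"
    and oplus_self: "a \<in> carrier A \<Longrightarrow> oplus A a a \<noteq> None \<longleftrightarrow> a = zero A"

locale boolean_algebra_on =
  fixes B :: "'a set" and meet join :: "'a \<Rightarrow> 'a \<Rightarrow> 'a" and neg :: "'a \<Rightarrow> 'a" and bt tp :: 'a
  assumes bt_closed: "bt \<in> B" and tp_closed: "tp \<in> B"
    and neg_closed: "x \<in> B \<Longrightarrow> neg x \<in> B"
    and meet_closed: "\<lbrakk>x \<in> B; y \<in> B\<rbrakk> \<Longrightarrow> meet x y \<in> B"
    and join_closed: "\<lbrakk>x \<in> B; y \<in> B\<rbrakk> \<Longrightarrow> join x y \<in> B"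
    and meet_assoc: "\<lbrakk>x \<in> B; y \<in> B; z \<in> B\<rbrakk> \<Longrightarrow> meet (meet x y) z = meet x (meet y z)"
    and join_assoc: "\<lbrakk>x \<in> B; y \<in> B; z \<in> B\<rbrakk> \<Longrightarrow> join (join x y) z = join x (join y z)"
    and meet_commute: "\<lbrakk>x \<in> B; y \<in> B\<rbrakk> \<Longrightarrow> meet x y = meet y x"
    and join_commute: "\<lbrakk>x \<in> B; y \<in> B\<rbrakk> \<Longrightarrow> join x y = join y x"
    and meet_join_absorb: "\<lbrakk>x \<in> B; y \<in> B\<rbrakk> \<Longrightarrow> meet x (join x y) = x"
    and join_meet_absorb: "\<lbrakk>x \<in> B; y \<in> B\<rbrakk> \<Longrightarrow> join x (meet x y) = x"
    and meet_join_distrib: "\<lbrakk>x \<in> B; y \<in> B; z \<in> B\<rbrakk> \<Longrightarrow> meet x (join y z) = join (meet x y) (meet x z)"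
    and join_meet_distrib: "\<lbrakk>x \<in> B; y \<in> B; z \<in> B\<rbrakk> \<Longrightarrow> join x (meet y z) = meet (join x y) (join x z)"
    and meet_neg: "x \<in> B \<Longrightarrow> meet x (neg x) = bt"
    and join_neg: "x \<in> B \<Longrightarrow> join x (neg x) = tp"
    and join_bt: "x \<in> B \<Longrightarrow> join x bt = x"
    and meet_tp: "x \<in> B \<Longrightarrow> meet x tp = x"

definition boolean_oalg :: "'a oalg \<Rightarrow> bool" where
  "boolean_oalg A \<longleftrightarrow> orthoalgebra A \<and>
     (\<exists>meet join. boolean_algebra_on (carrier A) meet join (compl A) (zero A) (one A) \<and>
        (\<forall>a\<in>carrier A. \<forall>b\<in>carrier A.
           oplus A a b = (if meet a b = zero A then Some (join a b) else None)))"

definition oalg_hom :: "'a oalg \<Rightarrow> 'b oalg \<Rightarrow> ('a \<Rightarrow> 'b) set" where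
  "oalg_hom A C = {f \<in> carrier A \<rightarrow>\<^sub>E carrier C.
     (\<forall>a\<in>carrier A. f (compl A a) = compl C (f a)) \<and>
     (\<forall>a\<in>carrier A. \<forall>b\<in>carrier A. \<forall>c. oplus A a b = Some c \<longrightarrow> oplus C (f a) (f b) = Some (f c))}"

definition subalgebra :: "'a oalg \<Rightarrow> 'a set \<Rightarrow> bool" where
  "subalgebra A S \<longleftrightarrow> S \<subseteq> carrier A \<and> zero A \<in> S \<and> one A \<in> S \<and> (\<forall>a\<in>S. compl A a \<in> S) \<and>
     (\<forall>a\<in>S. \<forall>b\<in>S. \<forall>c. oplus A a b = Some c \<longrightarrow> c \<in> S)"

definition restrict_oalg :: "'a oalg \<Rightarrow> 'a set \<Rightarrow> 'a oalg" where
  "restrict_oalg A S =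
     \<lparr>carrier = S, oplus = (\<lambda>a b. if a \<in> S \<and> b \<in> S then oplus A a b else None),
      compl = restrict (compl A) S, zero = zero A, one = one A\<rparr>"

definition BSub :: "'a oalg \<Rightarrow> 'a set set" where
  "BSub A = {S. subalgebra A S \<and> boolean_oalg (restrict_oalg A S)}"

definition block :: "'a oalg \<Rightarrow> 'a set \<Rightarrow> bool" where
  "block A S \<longleftrightarrow> S \<in> BSub A \<and> (\<forall>T\<in>BSub A. S \<subseteq> T \<longrightarrow> T = S)"

definition proper :: "'a oalg \<Rightarrow> bool" where
  "proper A \<longleftrightarrow> \<not> (\<exists>S. block A S \<and> finite S \<and> card S \<le> 4)"

definition OA :: "('a oalg, 'a \<Rightarrow> 'a) category" where
  "OA = \<lparr>Obj = {A. orthoalgebra A}, Hom = oalg_hom,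
         Id = (\<lambda>A. restrict id (carrier A)),
         Comp = (\<lambda>A B C g f. compose (carrier A) g f)\<rparr>"

definition OAi :: "('a oalg, 'a \<Rightarrow> 'a) category" where
  "OAi = OA\<lparr>Obj := {A \<in> Obj OA. proper A},
            Hom := (\<lambda>A C. {f \<in> Hom OA A C. inj_on f (carrier A)})\<rparr>"


section \<open>Hypergraphs\<close>

record 'p hgraph =
  points :: "'p set"
  lines :: "'p set set"
  planes :: "'p set set"

definition labelling :: "'p hgraph \<Rightarrow> 'p set \<Rightarrow> 'p \<Rightarrow> 'p \<Rightarrow> 'p \<Rightarrow> 'p \<Rightarrow> 'p \<Rightarrow> 'p \<Rightarrow> 'p \<Rightarrow> bool" where
  "labelling H t c1 c2 c3 c4 e1 e2 e3 \<longleftrightarrow>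
     distinct [c1, c2, c3, c4, e1, e2, e3] \<and> t = {c1, c2, c3, c4, e1, e2, e3} \<and>
     {l \<in> lines H. l \<subseteq> t} =
       {{c1, c2, e1}, {c3, c4, e1}, {c1, c3, e2}, {c2, c4, e2}, {c1, c4, e3}, {c2, c3, e3}}"

definition edge_point :: "'p hgraph \<Rightarrow> 'p set \<Rightarrow> 'p \<Rightarrow> bool" where
  "edge_point H t p \<longleftrightarrow>
     (\<exists>c1 c2 c3 c4 e1 e2 e3. labelling H t c1 c2 c3 c4 e1 e2 e3 \<and> p \<in> {e1, e2, e3})"

definition hypergraph :: "'p hgraph \<Rightarrow> bool" where
  "hypergraph H \<longleftrightarrow>
     (\<forall>l\<in>lines H. l \<subseteq> points H \<and> card l = 3) \<and>
     (\<forall>t\<in>planes H. t \<subseteq> points H \<and> (\<exists>c1 c2 c3 c4 e1 e2 e3. labelling H t c1 c2 c3 c4 e1 e2 e3))"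

definition hypergraph_isomorphic :: "'p hgraph \<Rightarrow> 'q hgraph \<Rightarrow> bool" where
  "hypergraph_isomorphic H K \<longleftrightarrow> (\<exists>\<phi>. bij_betw \<phi> (points H) (points K) \<and>
     (\<lambda>l. \<phi> ` l) ` lines H = lines K \<and> (\<lambda>t. \<phi> ` t) ` planes H = planes K)"

text \<open>Atoms and heights in a family of sets ordered by inclusion. The height of \<open>X\<close> is \<open>n\<close> if the
  longest chain below \<open>X\<close> (including \<open>X\<close>) has \<open>n + 1\<close> members.\<close>

definition atoms :: "'a set set \<Rightarrow> 'a set set" where
  "atoms P = {X \<in> P. \<exists>B\<in>P. (\<forall>Y\<in>P. B \<subseteq> Y) \<and> B \<subset> X \<and> \<not> (\<exists>Y\<in>P. B \<subset> Y \<and> Y \<subset> X)}"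

definition has_height :: "'a set set \<Rightarrow> 'a set \<Rightarrow> nat \<Rightarrow> bool" where
  "has_height P X n \<longleftrightarrow> X \<in> P \<and>
     (\<exists>K. subset.chain {Y \<in> P. Y \<subseteq> X} K \<and> finite K \<and> card K = n + 1) \<and>
     (\<forall>K. subset.chain {Y \<in> P. Y \<subseteq> X} K \<longrightarrow> finite K \<and> card K \<le> n + 1)"

definition G_obj :: "'a oalg \<Rightarrow> 'a set hgraph" where
  "G_obj A =
     \<lparr>points = atoms (BSub A),
      lines = {l. l \<subseteq> atoms (BSub A) \<and> card l = 3 \<and> (\<exists>X. has_height (BSub A) X 2 \<and> (\<forall>p\<in>l. p \<subseteq> X))},
      planes = {t. t \<subseteq> atoms (BSub A) \<and> card t = 7 \<and> (\<exists>X. has_height (BSub A) X 3 \<and> (\<forall>p\<in>t. p \<subseteq> X))}\<rparr>"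

text \<open>The type \<open>'a\<close> plays the role of a universe. The points of \<^term>\<open>G_obj A\<close> are subsets of the carrier,
  so orthohypergraphs live on \<open>'a set\<close>; since they are isomorphic to some \<^term>\<open>G_obj A\<close> with \<open>A\<close> on
  \<open>'a\<close>, both sides range over structures of the same size.\<close>

definition orthohypergraph :: "'a set hgraph \<Rightarrow> bool" where
  "orthohypergraph H \<longleftrightarrow> hypergraph H \<and>
     (\<exists>A :: 'a oalg. orthoalgebra A \<and> hypergraph_isomorphic H (G_obj A))"


section \<open>Morphisms of orthohypergraphs\<close>

definition maps_plane_iso :: "'p hgraph \<Rightarrow> 'q hgraph \<Rightarrow> ('p \<rightharpoonup> 'q) \<Rightarrow> 'p set \<Rightarrow> 'q set \<Rightarrow> bool" where
  "maps_plane_iso H K \<alpha> t t' \<longleftrightarrow> t \<subseteq> dom \<alpha> \<and> bij_betw (the \<circ> \<alpha>) t t' \<and>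
     (\<forall>l. l \<subseteq> t \<longrightarrow> (l \<in> lines H \<longleftrightarrow> (the \<circ> \<alpha>) ` l \<in> lines K))"

definition A1 :: "'p hgraph \<Rightarrow> 'q hgraph \<Rightarrow> ('p \<rightharpoonup> 'q) \<Rightarrow> bool" where
  "A1 H K \<alpha> \<longleftrightarrow> (\<forall>l\<in>lines H.
     (\<forall>p\<in>l. \<alpha> p = None) \<or>
     (\<exists>p\<in>l. \<alpha> p = None \<and> (\<exists>q. \<forall>r\<in>l - {p}. \<alpha> r = Some q)) \<or>
     (l \<subseteq> dom \<alpha> \<and> (\<exists>l'\<in>lines K. bij_betw (the \<circ> \<alpha>) l l')))"

definition A2 :: "'p hgraph \<Rightarrow> 'q hgraph \<Rightarrow> ('p \<rightharpoonup> 'q) \<Rightarrow> bool" where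
  "A2 H K \<alpha> \<longleftrightarrow> (\<forall>t\<in>planes H.
     (\<forall>p\<in>t. \<alpha> p = None) \<or>
     (\<exists>c1 c2 c3 c4 e1 e2 e3. labelling H t c1 c2 c3 c4 e1 e2 e3 \<and>
        \<alpha> c1 = None \<and> \<alpha> c2 = None \<and> \<alpha> e1 = None \<and>
        (\<exists>q. \<alpha> c3 = Some q \<and> \<alpha> c4 = Some q \<and> \<alpha> e2 = Some q \<and> \<alpha> e3 = Some q)) \<or>
     (\<exists>c1 c2 c3 c4 e1 e2 e3. labelling H t c1 c2 c3 c4 e1 e2 e3 \<and>
        \<alpha> c1 = None \<and>
        (\<exists>u v w. \<alpha> c2 = Some u \<and> \<alpha> e1 = Some u \<and> \<alpha> c3 = Some v \<and> \<alpha> e2 = Some v \<and>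
           \<alpha> c4 = Some w \<and> \<alpha> e3 = Some w \<and> distinct [u, v, w] \<and> {u, v, w} \<in> lines K)) \<or>
     (\<exists>t'\<in>planes K. maps_plane_iso H K \<alpha> t t'))"

text \<open>A set of three points whose image is a line automatically lies in the domain of \<open>\<alpha>\<close>; this is
  spelled out since \<^term>\<open>the \<circ> \<alpha>\<close> is unspecified off \<^term>\<open>dom \<alpha>\<close>.\<close>

definition A3 :: "'p hgraph \<Rightarrow> 'q hgraph \<Rightarrow> ('p \<rightharpoonup> 'q) \<Rightarrow> bool" where
  "A3 H K \<alpha> \<longleftrightarrow> (\<forall>l\<in>lines H. \<forall>m\<in>lines H. \<forall>p. \<forall>t'\<in>planes K. \<forall>l'\<in>lines K. \<forall>m'\<in>lines K. \<forall>q.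
     l \<inter> m = {p} \<and> l \<subseteq> dom \<alpha> \<and> m \<subseteq> dom \<alpha> \<and>
     (the \<circ> \<alpha>) ` l = l' \<and> (the \<circ> \<alpha>) ` m = m' \<and> l' \<noteq> m' \<and> l' \<subseteq> t' \<and> m' \<subseteq> t' \<and>
     l' \<inter> m' = {q} \<and> \<alpha> p = Some q \<and> edge_point K t' q \<longrightarrow>
     (\<exists>t\<in>planes H. l \<subseteq> t \<and> m \<subseteq> t \<and> maps_plane_iso H K \<alpha> t t'))"

definition ohgraph_hom :: "'p hgraph \<Rightarrow> 'q hgraph \<Rightarrow> ('p \<rightharpoonup> 'q) set" where
  "ohgraph_hom H K = {\<alpha>. dom \<alpha> \<subseteq> points H \<and> ran \<alpha> \<subseteq> points K \<and> A1 H K \<alpha> \<and> A2 H K \<alpha> \<and> A3 H K \<alpha>}"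

definition OH :: "('a set hgraph, 'a set \<rightharpoonup> 'a set) category" where
  "OH = \<lparr>Obj = {H. orthohypergraph H}, Hom = ohgraph_hom,
         Id = (\<lambda>H. Some |` points H),
         Comp = (\<lambda>H K M \<beta> \<alpha>. \<beta> \<circ>\<^sub>m \<alpha>)\<rparr>"

text \<open>An injective morphism is an injective function in the usual sense, in particular it is defined
  at every point: the partial maps undefined on a whole connected component do not come from
  injective maps of orthoalgebras.

  The empty hypergraph has to be excluded. It is \<open>G_obj {0, 1}\<close> and vacuously each of its points lies
  on a line, but no proper orthoalgebra is mapped to it, as \<open>{0}\<close> and \<open>{0, 1}\<close> are small blocks of
  themselves.\<close>

definition OHi :: "('a set hgraph, 'a set \<rightharpoonup> 'a set) category" where
  "OHi = OH\<lparr>Obj := {H \<in> Obj OH. points H \<noteq> {} \<and> (\<forall>p\<in>points H. \<exists>l\<in>lines H. p \<in> l)},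
            Hom := (\<lambda>H K. {\<alpha> \<in> Hom OH H K. dom \<alpha> = points H \<and> inj_on \<alpha> (points H)})\<rparr>"


section \<open>The functor on morphisms\<close>

definition x_sub :: "'a oalg \<Rightarrow> 'a \<Rightarrow> 'a set" where
  "x_sub A a = {zero A, a, compl A a, one A}"

text \<open>A point determines \<open>a\<close> only up to complement; as \<open>f\<close> preserves complements, the value does not
  depend on the choice.\<close>

definition G_map :: "'a oalg \<Rightarrow> 'a oalg \<Rightarrow> ('a \<Rightarrow> 'a) \<Rightarrow> ('a set \<rightharpoonup> 'a set)" where
  "G_map A C f = (\<lambda>p. if p \<in> points (G_obj A)
     then let a = (SOME a. a \<in> carrier A - {zero A, one A} \<and> p = x_sub A a)
          in if f a \<in> {zero C, one C} then None else Some (x_sub C (f a))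
     else None)"

end

theory Submission imports Defs begin

text \<open>
  A functor that is full, faithful and essentially surjective is an equivalence. Essential
  surjectivity is nearly the definition of an orthohypergraph; what has to be seen is that an
  orthoalgebra is proper if every point of its nonempty hypergraph lies on a line
  (\<open>proper_if_points_on_lines\<close>).

  The remaining work is a description of the hypergraph in terms of sums. A Boolean subalgebra of
  height \<open>n \<ge> 1\<close> is the same as a partition of the unit into \<open>n + 1\<close> nonzero summands
  (\<open>frame_has_height\<close>, \<open>has_height_frame\<close>). So lines are the sets \<open>{x\<^sub>a, x\<^sub>b, x\<^sub>c}\<close> for nonzero \<open>a\<close>, \<open>b\<close>, \<open>c\<close> with
  \<open>a \<oplus> b \<oplus> c = 1\<close>, and planes come from partitions of the unit into four summands, which are their
  corners. A point \<open>x\<^sub>a\<close> forgets the difference between \<open>a\<close> and \<open>a'\<close>, but a line through the point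
  remembers it: exactly one of \<open>a\<close>, \<open>a'\<close> is a summand on the line (\<open>triple_rigid\<close>). This gives each line a
  direction at each of its points. In a proper orthoalgebra every point lies on a line, so an
  embedding \<open>f\<close> can be recovered from its action on points; thus the functor is faithful.

  For fullness, a morphism \<open>\<alpha>\<close> of hypergraphs maps lines to lines, and each line proposes a value for
  \<open>f a\<close>: the element that is a summand on the image line. Proposals have to agree, that is, \<open>\<alpha>\<close> must
  preserve the relation of having the same direction at a common point. The directions are visible
  in the hypergraph: two distinct lines through \<open>x\<^sub>a\<close> have opposite directions there if and only if
  they lie in a plane in which \<open>x\<^sub>a\<close> is an edge point (\<open>opposite_lines_plane\<close>,
  \<open>same_direction_lines_eq\<close>). For if \<open>a\<close> is a summand on one line and \<open>a'\<close> on the other, then splitting both as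
  the lines prescribe gives four summands of the unit. Now (A2) says that \<open>\<alpha>\<close> preserves opposite
  directions, and (A3) that it reflects them.
\<close>

section \<open>Fully faithful and essentially surjective functors\<close>

text \<open>The quasi-inverse chooses an isomorphism \<open>e Y\<close> from some \<open>Fo X\<close> to every object \<open>Y\<close>, and sends a
  morphism to the unique preimage of its conjugate under these isomorphisms. Every equation between
  morphisms of the source is checked after applying the faithful functor.\<close>

lemma equivalence_if_full_faithful_ess_surj:
  assumes F: "is_functor C D Fo Fm"
    and full: "\<And>X Y g. \<lbrakk>X \<in> Obj C; Y \<in> Obj C; g \<in> Hom D (Fo X) (Fo Y)\<rbrakk> \<Longrightarrow> \<exists>f\<in>Hom C X Y. Fm X Y f = g"
    and faithful: "\<And>X Y f g. \<lbrakk>X \<in> Obj C; Y \<in> Obj C; f \<in> Hom C X Y; g \<in> Hom C X Y; Fm X Y f = Fm X Y g\<rbrakk> \<Longrightarrow> f = g"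
    and es: "\<And>Y. Y \<in> Obj D \<Longrightarrow> \<exists>X\<in>Obj C. \<exists>e. is_iso D (Fo X) Y e"
  shows "is_equivalence C D Fo Fm"
proof -
  interpret F: is_functor C D Fo Fm by (rule F)
  note cl [simp] = F.Fo_in_Obj F.Fm_in_Hom F.source.Id_in_Hom F.target.Id_in_Hom
    F.source.Comp_in_Hom F.target.Comp_in_Hom
  have "\<forall>Y\<in>Obj D. \<exists>X e e'. X \<in> Obj C \<and> e \<in> Hom D (Fo X) Y \<and> e' \<in> Hom D Y (Fo X)
      \<and> Comp D (Fo X) Y (Fo X) e' e = Id D (Fo X) \<and> Comp D Y (Fo X) Y e e' = Id D Y"
    using es unfolding is_iso_def by fast
  then obtain K e e' where ch: "\<forall>Y\<in>Obj D. K Y \<in> Obj C \<and> e Y \<in> Hom D (Fo (K Y)) Y \<and> e' Y \<in> Hom D Y (Fo (K Y))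
      \<and> Comp D (Fo (K Y)) Y (Fo (K Y)) (e' Y) (e Y) = Id D (Fo (K Y)) \<and> Comp D Y (Fo (K Y)) Y (e Y) (e' Y) = Id D Y"
    by metis
  then have K [simp]: "\<And>Y. Y \<in> Obj D \<Longrightarrow> K Y \<in> Obj C"
    and e [simp]: "\<And>Y. Y \<in> Obj D \<Longrightarrow> e Y \<in> Hom D (Fo (K Y)) Y"
    and e' [simp]: "\<And>Y. Y \<in> Obj D \<Longrightarrow> e' Y \<in> Hom D Y (Fo (K Y))"
    and e'e: "\<And>Y. Y \<in> Obj D \<Longrightarrow> Comp D (Fo (K Y)) Y (Fo (K Y)) (e' Y) (e Y) = Id D (Fo (K Y))"
    and ee': "\<And>Y. Y \<in> Obj D \<Longrightarrow> Comp D Y (Fo (K Y)) Y (e Y) (e' Y) = Id D Y"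
    by blast+
  define L where "L X Y g = (SOME f. f \<in> Hom C X Y \<and> Fm X Y f = g)" for X Y g
  have L: "L X Y g \<in> Hom C X Y \<and> Fm X Y (L X Y g) = g"
    if "X \<in> Obj C" "Y \<in> Obj C" "g \<in> Hom D (Fo X) (Fo Y)" for X Y g
    unfolding L_def by (rule someI_ex) (use full[OF that] in blast)
  have L_Hom [simp]: "L X Y g \<in> Hom C X Y" and Fm_L [simp]: "Fm X Y (L X Y g) = g"
    if "X \<in> Obj C" "Y \<in> Obj C" "g \<in> Hom D (Fo X) (Fo Y)" for X Y g
    using L[OF that] by auto
  define J where "J Y Z g = Comp D (Fo (K Y)) Z (Fo (K Z)) (e' Z) (Comp D (Fo (K Y)) Y Z g (e Y))" for Y Z g
  have J [simp]: "J Y Z g \<in> Hom D (Fo (K Y)) (Fo (K Z))"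
    if "Y \<in> Obj D" "Z \<in> Obj D" "g \<in> Hom D Y Z" for Y Z g
    unfolding J_def using that by (intro cl) auto
  have eJ: "Comp D (Fo (K Y)) (Fo (K Z)) Z (e Z) (J Y Z g) = Comp D (Fo (K Y)) Y Z g (e Y)"
    if "Y \<in> Obj D" "Z \<in> Obj D" "g \<in> Hom D Y Z" for Y Z g
    using that by (simp add: J_def F.target.Comp_assoc ee' F.target.Comp_Id_left)
  define Km where "Km Y Z g = L (K Y) (K Z) (J Y Z g)" for Y Z g
  have Km [simp]: "Km Y Z g \<in> Hom C (K Y) (K Z)" and Fm_Km [simp]: "Fm (K Y) (K Z) (Km Y Z g) = J Y Z g"
    if "Y \<in> Obj D" "Z \<in> Obj D" "g \<in> Hom D Y Z" for Y Z g
    using that by (simp_all add: Km_def)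
  have J_Comp: "J W Z (Comp D W Y Z h g) = Comp D (Fo (K W)) (Fo (K Y)) (Fo (K Z)) (J Y Z h) (J W Y g)"
    if o: "W \<in> Obj D" "Y \<in> Obj D" "Z \<in> Obj D" and m: "g \<in> Hom D W Y" "h \<in> Hom D Y Z" for W Y Z g h
  proof -
    have "Comp D (Fo (K W)) (Fo (K Y)) (Fo (K Z)) (J Y Z h) (J W Y g)
      = Comp D (Fo (K W)) Z (Fo (K Z)) (e' Z) (Comp D (Fo (K W)) (Fo (K Y)) Z (Comp D (Fo (K Y)) Y Z h (e Y)) (J W Y g))"
      unfolding J_def[of Y Z h] using o m by (simp add: F.target.Comp_assoc)
    also have "Comp D (Fo (K W)) (Fo (K Y)) Z (Comp D (Fo (K Y)) Y Z h (e Y)) (J W Y g)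
      = Comp D (Fo (K W)) Y Z h (Comp D (Fo (K W)) (Fo (K Y)) Y (e Y) (J W Y g))"
      using o m by (simp add: F.target.Comp_assoc)
    also have "\<dots> = Comp D (Fo (K W)) W Z (Comp D W Y Z h g) (e W)"
      using o m by (simp add: eJ F.target.Comp_assoc)
    finally show ?thesis by (simp add: J_def)
  qed
  have Kfun: "is_functor D C K Km"
  proof
    show "Km X X (Id D X) = Id C (K X)" if "X \<in> Obj D" for X
      by (rule faithful[of "K X" "K X"])
        (use that in \<open>simp_all add: F.Fm_Id\<close>, simp add: J_def F.target.Comp_Id_left e'e)
    show "Km X Z (Comp D X Y Z g f) = Comp C (K X) (K Y) (K Z) (Km Y Z g) (Km X Y f)"
      if "X \<in> Obj D" "Y \<in> Obj D" "Z \<in> Obj D" "f \<in> Hom D X Y" "g \<in> Hom D Y Z" for X Y Z f g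
      by (rule faithful[of "K X" "K Z"])
        (use that J_Comp[OF that] in \<open>simp_all add: F.Fm_Comp[of "K X" "K Y" "K Z"]\<close>)
  qed auto
  define \<eta> where "\<eta> X = L X (K (Fo X)) (e' (Fo X))" for X
  have \<eta> [simp]: "\<eta> X \<in> Hom C X (K (Fo X))" and Fm_\<eta> [simp]: "Fm X (K (Fo X)) (\<eta> X) = e' (Fo X)"
    if "X \<in> Obj C" for X using that by (simp_all add: \<eta>_def)
  have \<eta>_nat: "is_natural_iso C C (\<lambda>X. X) (\<lambda>X Y f. f)
          (\<lambda>X. K (Fo X)) (\<lambda>X Y f. Km (Fo X) (Fo Y) (Fm X Y f)) \<eta>"
    unfolding is_natural_iso_def
  proof (intro conjI ballI)
    fix X assume X: "X \<in> Obj C"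
    let ?r = "L (K (Fo X)) X (e (Fo X))"
    have "Comp C X (K (Fo X)) X ?r (\<eta> X) = Id C X"
      by (rule faithful[of X X]) (use X in \<open>simp_all add: F.Fm_Comp[of X "K (Fo X)" X] F.Fm_Id ee'\<close>)
    moreover have "Comp C (K (Fo X)) X (K (Fo X)) (\<eta> X) ?r = Id C (K (Fo X))"
      by (rule faithful[of "K (Fo X)" "K (Fo X)"])
        (use X in \<open>simp_all add: F.Fm_Comp[of "K (Fo X)" X "K (Fo X)"] F.Fm_Id e'e\<close>)
    moreover have "?r \<in> Hom C (K (Fo X)) X" using X by simp
    ultimately show "is_iso C X (K (Fo X)) (\<eta> X)"
      unfolding is_iso_def using X by auto
  next
    fix X Y f assume X: "X \<in> Obj C" "Y \<in> Obj C" "f \<in> Hom C X Y"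
    have "Comp D (Fo X) (Fo (K (Fo X))) (Fo (K (Fo Y))) (J (Fo X) (Fo Y) (Fm X Y f)) (e' (Fo X))
      = Comp D (Fo X) (Fo Y) (Fo (K (Fo Y))) (e' (Fo Y)) (Fm X Y f)"
      unfolding J_def using X
      by (simp add: F.target.Comp_assoc[symmetric] ee' F.target.Comp_Id_right)
    then show "Comp C X (K (Fo X)) (K (Fo Y)) (Km (Fo X) (Fo Y) (Fm X Y f)) (\<eta> X) =
        Comp C X Y (K (Fo Y)) (\<eta> Y) f"
      by (intro faithful[of X "K (Fo Y)"])
        (use X in \<open>simp_all add: F.Fm_Comp[of X "K (Fo X)" "K (Fo Y)"] F.Fm_Comp[of X Y "K (Fo Y)"]\<close>)
  qed
  have "is_natural_iso D D (\<lambda>X. Fo (K X)) (\<lambda>X Y g. Fm (K X) (K Y) (Km X Y g)) (\<lambda>X. X) (\<lambda>X Y g. g) e"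
    unfolding is_natural_iso_def is_iso_def
    using e e' e'e ee' by (auto simp: eJ intro: bexI[OF _ e'])
  then show ?thesis
    unfolding is_equivalence_def using F Kfun \<eta>_nat by blast
qed

section \<open>Boolean algebras on a carrier\<close>

context boolean_algebra_on
begin

lemma neg_unique:
  assumes "x \<in> B" "y \<in> B" "meet x y = bt" "join x y = tp" shows "y = neg x"
proof -
  have "y = join (meet y x) (meet y (neg x))"
    using assms meet_join_distrib[of y x "neg x"] by (simp add: neg_closed join_neg meet_tp)
  also have "\<dots> = join (meet (neg x) x) (meet (neg x) y)"
    using assms by (simp add: meet_commute meet_neg neg_closed)
  also have "\<dots> = neg x"
    using assms meet_join_distrib[of "neg x" x y] by (simp add: neg_closed meet_tp)
  finally show ?thesis .
qed

lemma neg_neg: "x \<in> B \<Longrightarrow> neg (neg x) = x"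
  using neg_unique[of "neg x" x] by (simp add: neg_closed meet_commute join_commute meet_neg join_neg)

lemma join_idem: "x \<in> B \<Longrightarrow> join x x = x"
  by (metis bt_closed join_bt join_meet_absorb meet_join_absorb)

lemma meet_idem: "x \<in> B \<Longrightarrow> meet x x = x"
  by (metis join_idem meet_join_absorb)

lemma meet_bt: "x \<in> B \<Longrightarrow> meet x bt = bt"
  by (metis bt_closed join_bt join_commute meet_commute meet_join_absorb)

lemma join_tp: "x \<in> B \<Longrightarrow> join x tp = tp"
  by (metis tp_closed meet_tp meet_commute join_commute join_meet_absorb)

lemma meet_left_commute: "x \<in> B \<Longrightarrow> y \<in> B \<Longrightarrow> z \<in> B \<Longrightarrow> meet x (meet y z) = meet y (meet x z)"
  by (metis meet_assoc meet_commute)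

lemma join_left_commute: "x \<in> B \<Longrightarrow> y \<in> B \<Longrightarrow> z \<in> B \<Longrightarrow> join x (join y z) = join y (join x z)"
  by (metis join_assoc join_commute)

lemma meet_left_idem: "x \<in> B \<Longrightarrow> y \<in> B \<Longrightarrow> meet x (meet x y) = meet x y"
  by (metis meet_assoc meet_idem)

lemma bt_meet: "x \<in> B \<Longrightarrow> meet bt x = bt"
  using meet_bt meet_commute bt_closed by metis

lemma tp_meet: "x \<in> B \<Longrightarrow> meet tp x = x"
  using meet_tp meet_commute tp_closed by metis

lemma meet_join_distrib_right:
  "\<lbrakk>x \<in> B; y \<in> B; z \<in> B\<rbrakk> \<Longrightarrow> meet (join y z) x = join (meet y x) (meet z x)"
  by (simp add: meet_join_distrib meet_commute join_closed)

lemmas closed = bt_closed tp_closed neg_closed meet_closed join_closed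
lemmas meet_ac = meet_assoc meet_commute meet_left_commute
lemmas join_ac = join_assoc join_commute join_left_commute

lemma neg_join: "x \<in> B \<Longrightarrow> y \<in> B \<Longrightarrow> neg (join x y) = meet (neg x) (neg y)"
proof (rule neg_unique[symmetric])
  assume xy: "x \<in> B" "y \<in> B"
  have "meet x (meet (neg x) (neg y)) = bt"
    using xy by (simp add: closed meet_assoc[symmetric] meet_neg bt_meet meet_bt)
  moreover have "meet y (meet (neg x) (neg y)) = bt"
    using xy by (simp add: closed meet_left_commute[of y] meet_neg meet_bt)
  ultimately show "meet (join x y) (meet (neg x) (neg y)) = bt"
    using xy by (simp add: closed meet_join_distrib_right join_bt)
  have "join y (join x (neg x)) = tp" "join x (join y (neg y)) = tp"
    using xy by (simp_all add: join_neg join_tp)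
  then have "join (join x y) (neg x) = tp" "join (join x y) (neg y) = tp"
    using xy by (simp_all add: join_ac closed)
  then show "join (join x y) (meet (neg x) (neg y)) = tp"
    using xy by (simp add: closed join_meet_distrib meet_tp)
qed (auto intro: closed)

lemma meet_eq_neg_join: "x \<in> B \<Longrightarrow> y \<in> B \<Longrightarrow> meet x y = neg (join (neg x) (neg y))"
  by (simp add: neg_join closed neg_neg)

lemma boolean_algebra_on_subset:
  assumes Y: "Y \<subseteq> B" "bt \<in> Y" and neg: "\<And>x. x \<in> Y \<Longrightarrow> neg x \<in> Y"
    and join: "\<And>x y. x \<in> Y \<Longrightarrow> y \<in> Y \<Longrightarrow> join x y \<in> Y"
  shows "boolean_algebra_on Y meet join neg bt tp"
proof -
  have tp: "tp \<in> Y" using neg[of bt] join[of bt "neg bt"] Y join_neg[of bt] by (auto simp: closed)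
  have meet: "meet x y \<in> Y" if "x \<in> Y" "y \<in> Y" for x y
    using that Y by (simp add: meet_eq_neg_join subset_iff neg join)
  have B: "\<And>x. x \<in> Y \<Longrightarrow> x \<in> B" using Y by blast
  show ?thesis
    by (standard; (rule tp meet neg join Y meet_assoc join_assoc meet_commute join_commute
          meet_join_absorb join_meet_absorb meet_join_distrib join_meet_distrib meet_neg join_neg
          join_bt meet_tp; (assumption | erule B)?)+)
qed

text \<open>If \<open>Y\<close> is a subalgebra, these are the elements of the subalgebra generated by \<open>Y\<close> and \<open>b\<close>, in a
  normal form that shows that it is finite whenever \<open>Y\<close> is.\<close>

definition adjoin :: "'a set \<Rightarrow> 'a \<Rightarrow> 'a set" where
  "adjoin Y b = (\<lambda>(y, z). join (meet y b) (meet z (neg b))) ` (Y \<times> Y)"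

lemma mix_neg:
  assumes "y \<in> B" "z \<in> B" "b \<in> B"
  shows "neg (join (meet y b) (meet z (neg b))) = join (meet (neg y) b) (meet (neg z) (neg b))"
proof (rule neg_unique[symmetric])
  have disj: "meet (meet p q) (meet r s) = bt"
    if "p \<in> B" "q \<in> B" "r \<in> B" "s \<in> B" "meet p r = bt \<or> meet q s = bt" for p q r s
  proof -
    have "meet (meet p q) (meet r s) = meet (meet p r) (meet q s)"
      using that by (simp add: meet_ac closed)
    then show ?thesis using that meet_bt[of "meet p r"] bt_meet[of "meet q s"] by (auto simp: closed)
  qed
  have nb: "meet (neg b) b = bt" using assms by (simp add: meet_commute closed meet_neg)
  show "meet (join (meet y b) (meet z (neg b))) (join (meet (neg y) b) (meet (neg z) (neg b))) = bt"
    using assms by (simp add: closed meet_join_distrib meet_join_distrib_right disj meet_neg nb join_bt)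
  have "join (join (meet y b) (meet z (neg b))) (join (meet (neg y) b) (meet (neg z) (neg b)))
    = join (join (meet y b) (meet (neg y) b)) (join (meet z (neg b)) (meet (neg z) (neg b)))"
    using assms by (simp add: join_ac closed)
  also have "\<dots> = tp"
    using assms by (simp add: closed meet_join_distrib_right[symmetric] join_neg tp_meet)
  finally show "join (join (meet y b) (meet z (neg b))) (join (meet (neg y) b) (meet (neg z) (neg b))) = tp" .
qed (use assms in \<open>auto intro: closed\<close>)

lemma mix_join:
  assumes "y \<in> B" "z \<in> B" "y' \<in> B" "z' \<in> B" "b \<in> B"
  shows "join (join (meet y b) (meet z (neg b))) (join (meet y' b) (meet z' (neg b)))
    = join (meet (join y y') b) (meet (join z z') (neg b))"
  using assms by (simp add: meet_join_distrib_right closed join_ac)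

lemma adjoin:
  assumes Y: "Y \<subseteq> B" "bt \<in> Y" and neg: "\<And>x. x \<in> Y \<Longrightarrow> neg x \<in> Y"
    and join: "\<And>x y. x \<in> Y \<Longrightarrow> y \<in> Y \<Longrightarrow> join x y \<in> Y" and b: "b \<in> B"
  shows "Y \<subseteq> adjoin Y b" "b \<in> adjoin Y b" "adjoin Y b \<subseteq> B"
    "\<And>x. x \<in> adjoin Y b \<Longrightarrow> neg x \<in> adjoin Y b"
    "\<And>x y. x \<in> adjoin Y b \<Longrightarrow> y \<in> adjoin Y b \<Longrightarrow> join x y \<in> adjoin Y b"
proof -
  have tp: "tp \<in> Y" using neg[of bt] join[of bt "neg bt"] Y join_neg[of bt] by (auto simp: closed)
  have B: "\<And>x. x \<in> Y \<Longrightarrow> x \<in> B" using Y by blast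
  have mem: "join (meet y b) (meet z (neg b)) \<in> adjoin Y b" if "y \<in> Y" "z \<in> Y" for y z
    unfolding adjoin_def using that by force
  show "Y \<subseteq> adjoin Y b"
  proof
    fix y assume y: "y \<in> Y"
    have "join (meet y b) (meet y (neg b)) = y"
      using y B b by (simp add: meet_join_distrib[symmetric] closed join_neg meet_tp)
    then show "y \<in> adjoin Y b" using mem[OF y y] by simp
  qed
  have "join (meet tp b) (meet bt (neg b)) = b"
    using b by (simp add: closed tp_meet bt_meet join_bt)
  then show "b \<in> adjoin Y b" using mem[of tp bt] tp Y by simp
  show "adjoin Y b \<subseteq> B" unfolding adjoin_def using b by (auto simp: closed B)
  show "neg x \<in> adjoin Y b" if x: "x \<in> adjoin Y b" for x
  proof -
    obtain y z where "y \<in> Y" "z \<in> Y" "x = join (meet y b) (meet z (neg b))"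
      using x unfolding adjoin_def by auto
    then show ?thesis using mem[of "neg y" "neg z"] by (simp add: mix_neg B b neg)
  qed
  show "join x x' \<in> adjoin Y b" if x: "x \<in> adjoin Y b" "x' \<in> adjoin Y b" for x x'
  proof -
    obtain y z where "y \<in> Y" "z \<in> Y" "x = join (meet y b) (meet z (neg b))"
      using x unfolding adjoin_def by auto
    moreover obtain y' z' where "y' \<in> Y" "z' \<in> Y" "x' = join (meet y' b) (meet z' (neg b))"
      using x unfolding adjoin_def by auto
    ultimately show ?thesis using mem[of "join y y'" "join z z'"] by (simp add: mix_join B b join)
  qed
qed

definition atom_set :: "'a set" where
  "atom_set = {a \<in> B. a \<noteq> bt \<and> (\<forall>y\<in>B. meet y a = bt \<or> meet y a = a)}"

definition atoms_below :: "'a \<Rightarrow> 'a set" where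
  "atoms_below x = {a \<in> atom_set. meet x a = a}"

lemma atom_below:
  assumes "finite B" "x \<in> B" "x \<noteq> bt" shows "\<exists>a. a \<in> atoms_below x"
  using assms(2,3)
proof (induction "card {y \<in> B. meet x y = y}" arbitrary: x rule: less_induct)
  case (less x)
  show ?case
  proof (cases "x \<in> atom_set")
    case True then show ?thesis using less by (auto simp: atoms_below_def meet_idem)
  next
    case False
    then obtain y where y: "y \<in> B" "meet y x \<noteq> bt" "meet y x \<noteq> x"
      using less.prems by (auto simp: atom_set_def)
    let ?z = "meet y x"
    have z: "?z \<in> B" using y less.prems by (simp add: closed)
    have "meet x w = w" if "w \<in> B" "meet ?z w = w" for w
    proof -
      have "meet x (meet ?z w) = meet ?z w"
        using that(1) y less.prems by (simp add: meet_assoc meet_left_commute[of x] meet_left_idem closed)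
      then show ?thesis using that by simp
    qed
    moreover have "meet ?z x \<noteq> x" using y less.prems by (simp add: meet_assoc meet_idem)
    ultimately have "{w \<in> B. meet ?z w = w} \<subset> {w \<in> B. meet x w = w}"
      using less.prems by (auto simp: meet_idem)
    then have "card {w \<in> B. meet ?z w = w} < card {w \<in> B. meet x w = w}"
      using assms(1) by (intro psubset_card_mono) auto
    from less.hyps[OF this z y(2)] obtain a where a: "a \<in> atoms_below ?z" by blast
    then have aB: "a \<in> B" and az: "meet ?z a = a" by (auto simp: atoms_below_def atom_set_def)
    have "meet x a = a" using \<open>\<And>w. w \<in> B \<Longrightarrow> meet ?z w = w \<Longrightarrow> meet x w = w\<close> aB az by blast
    then show ?thesis using a by (auto simp: atoms_below_def)
  qed
qed

lemma atoms_below_tp: "atoms_below tp = atom_set"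
  by (auto simp: atoms_below_def atom_set_def closed tp_meet)

lemma atoms_below_bt: "atoms_below bt = {}"
  by (auto simp: atoms_below_def atom_set_def closed bt_meet)

lemma atoms_below_join:
  assumes "x \<in> B" "y \<in> B" shows "atoms_below (join x y) = atoms_below x \<union> atoms_below y"
proof (intro set_eqI iffI)
  fix a assume a: "a \<in> atoms_below (join x y)"
  then have aB: "a \<in> B" and at: "a \<in> atom_set" by (auto simp: atoms_below_def atom_set_def)
  have "join (meet x a) (meet y a) = a"
    using a aB assms by (simp add: atoms_below_def meet_join_distrib_right)
  moreover have "\<not> (meet x a = bt \<and> meet y a = bt)"
    using at calculation join_bt[OF bt_closed] by (auto simp: atom_set_def)
  ultimately show "a \<in> atoms_below x \<union> atoms_below y"
    using at assms by (auto simp: atom_set_def atoms_below_def)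
next
  fix a assume a: "a \<in> atoms_below x \<union> atoms_below y"
  then have aB: "a \<in> B" and at: "a \<in> atom_set" by (auto simp: atoms_below_def atom_set_def)
  have "meet (join x y) a = join (meet x a) (meet y a)"
    using assms aB by (simp add: meet_join_distrib_right)
  also have "\<dots> = a"
  proof (cases "meet x a = a")
    case True
    then show ?thesis using assms aB join_meet_absorb[of a y] meet_commute[of y a] by simp
  next
    case False
    then have "meet y a = a" using a by (auto simp: atoms_below_def)
    then show ?thesis
      using assms aB join_meet_absorb[of a x] meet_commute[of x a] join_commute[of "meet x a" a]
      by (simp add: closed)
  qed
  finally show "a \<in> atoms_below (join x y)" using at by (simp add: atoms_below_def)
qed

text \<open>Every nonzero element lies above an atom, so that an element is determined by the atoms below it,
  and joins of atoms realize every set of atoms.\<close>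

lemma atoms_below_bij:
  assumes "finite B" shows "bij_betw atoms_below B (Pow atom_set)"
proof (rule bij_betw_imageI)
  have le: "meet x (neg y) = bt" if "x \<in> B" "y \<in> B" "atoms_below x \<subseteq> atoms_below y" for x y
  proof (rule ccontr)
    assume "meet x (neg y) \<noteq> bt"
    moreover have "meet x (neg y) \<in> B" using that by (simp add: closed)
    ultimately obtain a where a: "a \<in> atoms_below (meet x (neg y))"
      using atom_below[OF assms] by blast
    then have aB: "a \<in> B" "a \<noteq> bt" and az: "meet (meet x (neg y)) a = a" and at: "a \<in> atom_set"
      by (auto simp: atoms_below_def atom_set_def)
    have "meet x (meet (meet x (neg y)) a) = meet (meet x (neg y)) a"
      using that aB by (simp add: meet_assoc meet_left_idem closed)
    then have "a \<in> atoms_below x" using az at by (simp add: atoms_below_def)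
    then have "meet y a = a" using that(3) by (auto simp: atoms_below_def)
    moreover have "meet y (meet (meet x (neg y)) a) = meet (meet y (neg y)) (meet x a)"
      using that(1,2) aB by (simp add: meet_ac closed)
    ultimately have "a = meet bt (meet x a)" using az that(2) by (simp add: meet_neg)
    also have "\<dots> = bt" using that aB by (simp add: closed bt_meet)
    finally show False using aB by simp
  qed
  have eq: "meet x y = x" if "x \<in> B" "y \<in> B" "meet x (neg y) = bt" for x y
  proof -
    have "x = meet x (join y (neg y))" using that by (simp add: join_neg meet_tp)
    also have "\<dots> = join (meet x y) bt" using that by (simp add: meet_join_distrib closed)
    finally show ?thesis using that by (simp add: join_bt closed)
  qed
  show "inj_on atoms_below B"
  proof (rule inj_onI)
    fix x y assume "x \<in> B" "y \<in> B" "atoms_below x = atoms_below y"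
    then have "meet x y = x" "meet y x = y" using eq le by blast+
    then show "x = y" using meet_commute \<open>x \<in> B\<close> \<open>y \<in> B\<close> by metis
  qed
  have "\<exists>x\<in>B. atoms_below x = U" if "finite U" "U \<subseteq> atom_set" for U
    using that
  proof (induction U)
    case empty then show ?case using atoms_below_bt bt_closed by blast
  next
    case (insert a U)
    then obtain x where x: "x \<in> B" "atoms_below x = U" by auto
    have a: "a \<in> B" "a \<in> atom_set" using insert by (auto simp: atom_set_def)
    have "atoms_below a = {a}"
    proof -
      have "c = a" if "c \<in> atom_set" "meet a c = c" for c
      proof -
        have c: "c \<in> B" "c \<noteq> bt" using that by (auto simp: atom_set_def)
        then have "meet c a = c" using that meet_commute[of c a] a by simp
        then show ?thesis using a c by (auto simp: atom_set_def)
      qed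
      then show ?thesis using a by (auto simp: atoms_below_def meet_idem)
    qed
    then have "atoms_below (join x a) = insert a U" using x a by (simp add: atoms_below_join)
    then show ?case using join_closed[OF x(1) a(1)] by blast
  qed
  moreover have "finite atom_set" using assms by (simp add: atom_set_def)
  ultimately have "Pow atom_set \<subseteq> atoms_below ` B" using finite_subset by blast
  moreover have "atoms_below ` B \<subseteq> Pow atom_set" unfolding atoms_below_def by blast
  ultimately show "atoms_below ` B = Pow atom_set" by blast
qed

end

section \<open>Arithmetic in an orthoalgebra\<close>

context orthoalgebra
begin

lemma compl_in: "a \<in> carrier A \<Longrightarrow> compl A a \<in> carrier A"
  using compl_closed by blast

lemma oplus_comm: "oplus A a b = oplus A b a"
  using oplus_commute oplus_closed by (metis not_Some_eq)

lemma oplus_compl: "a \<in> carrier A \<Longrightarrow> oplus A a (compl A a) = Some (one A)"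
  using compl_unique compl_in by blast

lemma compl_eqI: "oplus A a b = Some (one A) \<Longrightarrow> b = compl A a"
  using compl_unique oplus_closed by blast

lemma compl_compl: "a \<in> carrier A \<Longrightarrow> compl A (compl A a) = a"
  using compl_eqI[of "compl A a" a] oplus_compl oplus_comm by simp

lemma oplus_assocD:
  assumes "oplus A a b = Some d" "oplus A d c = Some e"
  obtains f where "oplus A b c = Some f" "oplus A a f = Some e"
proof -
  have "Option.bind (oplus A b c) (\<lambda>d. oplus A a d) = Some e"
    using oplus_assoc[of a b c] assms oplus_closed by fastforce
  then show ?thesis using that by (cases "oplus A b c") auto
qed

lemma oplus_assocD':
  assumes "oplus A b c = Some f" "oplus A a f = Some e"
  obtains d where "oplus A a b = Some d" "oplus A d c = Some e"
  using assms oplus_assocD[of c b f a e] oplus_comm by metis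

lemma oplus_swap:
  assumes "oplus A a b = Some d" "oplus A d c = Some e"
  obtains f where "oplus A a c = Some f" "oplus A f b = Some e"
  using assms oplus_assocD[of b a d c e] oplus_comm by metis

lemma oplus_self_zero: "oplus A a a = Some b \<Longrightarrow> a = zero A"
  using oplus_self[of a] oplus_closed[of a a b] by simp

text \<open>As \<open>1 \<oplus> 1' = 1\<close>, the element \<open>1'\<close> can be added to \<open>1 \<oplus> 1'\<close> once more, so \<open>1' \<oplus> 1'\<close> is defined.\<close>

lemma compl_one: "compl A (one A) = zero A"
proof -
  have 1: "oplus A (one A) (compl A (one A)) = Some (one A)" using oplus_compl one_closed by blast
  obtain f where "oplus A (compl A (one A)) (compl A (one A)) = Some f"
    using oplus_assocD[OF 1 1] by blast
  then show ?thesis by (rule oplus_self_zero)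
qed

lemma compl_zero: "compl A (zero A) = one A"
  using compl_one compl_compl[OF one_closed] by simp

lemma oplus_zero: assumes "a \<in> carrier A" shows "oplus A a (zero A) = Some a"
proof -
  have 1: "oplus A (compl A a) a = Some (one A)" using assms oplus_compl oplus_comm by metis
  have "oplus A (one A) (zero A) = Some (one A)" using oplus_compl[OF one_closed] compl_one by simp
  from oplus_assocD[OF 1 this] obtain f where
    f: "oplus A a (zero A) = Some f" "oplus A (compl A a) f = Some (one A)" by blast
  then have "f = a" using compl_eqI[OF f(2)] compl_compl assms by simp
  then show ?thesis using f by simp
qed

text \<open>Both \<open>b\<close> and \<open>c\<close> are the complement of \<open>a \<oplus> d'\<close>.\<close>

lemma oplus_cancel:
  assumes b: "oplus A a b = Some d" and c: "oplus A a c = Some d" shows "b = c"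
proof -
  have "d \<in> carrier A" using b oplus_closed by blast
  then have 1: "oplus A d (compl A d) = Some (one A)" by (rule oplus_compl)
  obtain e where e: "oplus A a (compl A d) = Some e" "oplus A e b = Some (one A)"
    using oplus_swap[OF b 1] by blast
  moreover obtain e' where "oplus A a (compl A d) = Some e'" "oplus A e' c = Some (one A)"
    using oplus_swap[OF c 1] by blast
  ultimately show ?thesis using compl_eqI by (metis option.inject)
qed

text \<open>Each summand can be added to \<open>0 = a \<oplus> b\<close>, hence also to itself.\<close>

lemma oplus_eq_zero: assumes "oplus A a b = Some (zero A)" shows "a = zero A" "b = zero A"
proof -
  have *: "x = zero A" if "oplus A x y = Some (zero A)" for x y
  proof -
    have 0: "oplus A (zero A) x = Some x" using that oplus_zero oplus_closed oplus_comm by metis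
    have yx: "oplus A y x = Some (zero A)" using that oplus_comm by metis
    from oplus_assocD[OF yx 0] obtain k where "oplus A x x = Some k" by blast
    then show ?thesis by (rule oplus_self_zero)
  qed
  show "a = zero A" "b = zero A" using *[OF assms] *[of b a] assms oplus_comm by metis+
qed

lemma compl_neq: "a \<in> carrier A \<Longrightarrow> a \<noteq> zero A \<Longrightarrow> compl A a \<noteq> a"
  using oplus_compl oplus_self_zero by metis

lemma compl_eq_zero: "a \<in> carrier A \<Longrightarrow> compl A a = zero A \<longleftrightarrow> a = one A"
  using compl_compl compl_one compl_zero by metis

lemma compl_eq_one: "a \<in> carrier A \<Longrightarrow> compl A a = one A \<longleftrightarrow> a = zero A"
  using compl_compl compl_one compl_zero by metis

lemma x_sub_eq_iff:
  assumes "a \<in> carrier A" "a \<noteq> zero A" "a \<noteq> one A" "b \<in> carrier A"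
  shows "x_sub A a = x_sub A b \<longleftrightarrow> b = a \<or> b = compl A a"
proof
  assume "x_sub A a = x_sub A b"
  then have "a \<in> x_sub A b" unfolding x_sub_def by blast
  then show "b = a \<or> b = compl A a" using assms compl_compl by (auto simp: x_sub_def)
qed (use assms compl_compl in \<open>auto simp: x_sub_def\<close>)

lemma x_sub_compl: "a \<in> carrier A \<Longrightarrow> x_sub A (compl A a) = x_sub A a"
  using compl_compl by (auto simp: x_sub_def)

lemma orthoalgebra_restrict:
  assumes S: "subalgebra A S" shows "orthoalgebra (restrict_oalg A S)"
proof -
  have comp: "zero A \<in> S" "one A \<in> S" "\<And>a. a \<in> S \<Longrightarrow> compl A a \<in> S"
    and sub: "\<And>a. a \<in> S \<Longrightarrow> a \<in> carrier A"
    and cl: "\<And>a b c. a \<in> S \<Longrightarrow> b \<in> S \<Longrightarrow> oplus A a b = Some c \<Longrightarrow> c \<in> S"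
    using S unfolding subalgebra_def by blast+
  show ?thesis
  proof
    fix a b c
    assume abc: "a \<in> carrier (restrict_oalg A S)" "b \<in> carrier (restrict_oalg A S)" "c \<in> carrier (restrict_oalg A S)"
    then have S: "a \<in> S" "b \<in> S" "c \<in> S" by (auto simp: restrict_oalg_def)
    have "Option.bind (oplus (restrict_oalg A S) a b) (\<lambda>d. oplus (restrict_oalg A S) d c)
        = Option.bind (oplus A a b) (\<lambda>d. oplus A d c)"
      using S cl[of a b] by (cases "oplus A a b") (simp_all add: restrict_oalg_def)
    moreover have "Option.bind (oplus (restrict_oalg A S) b c) (oplus (restrict_oalg A S) a)
        = Option.bind (oplus A b c) (oplus A a)"
      using S cl[of b c] by (cases "oplus A b c") (simp_all add: restrict_oalg_def)
    ultimately show "Option.bind (oplus (restrict_oalg A S) a b) (\<lambda>d. oplus (restrict_oalg A S) d c) =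
       Option.bind (oplus (restrict_oalg A S) b c) (oplus (restrict_oalg A S) a)"
      using oplus_assoc[of a b c] S sub by simp
  next
    fix a b assume "a \<in> carrier (restrict_oalg A S)" "b \<in> carrier (restrict_oalg A S)"
    then have "a \<in> S" "b \<in> S" by (auto simp: restrict_oalg_def)
    then show "(oplus (restrict_oalg A S) a b = Some (one (restrict_oalg A S))) = (b = compl (restrict_oalg A S) a)"
      using compl_unique[of a b] sub by (simp add: restrict_oalg_def)
  next
    fix a assume "a \<in> carrier (restrict_oalg A S)"
    then show "(oplus (restrict_oalg A S) a a \<noteq> None) = (a = zero (restrict_oalg A S))"
      using oplus_self[of a] sub by (simp add: restrict_oalg_def)
  next
    fix a b c assume "oplus (restrict_oalg A S) a b = Some c"
    then show "a \<in> carrier (restrict_oalg A S) \<and> b \<in> carrier (restrict_oalg A S)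
        \<and> c \<in> carrier (restrict_oalg A S)"
      using cl[of a b c] by (simp add: restrict_oalg_def split: if_splits)
  next
    show "compl (restrict_oalg A S) \<in> carrier (restrict_oalg A S) \<rightarrow>\<^sub>E carrier (restrict_oalg A S)"
      using comp by (simp add: restrict_oalg_def)
  qed (use comp oplus_comm in \<open>simp_all add: restrict_oalg_def\<close>)
qed

text \<open>Sums can be formed in the image only where the Boolean algebra has them: a common part of two
  summands would be orthogonal to itself. So the partial sum restricted to the image is the one
  that comes from the Boolean algebra.\<close>

lemma image_in_BSub:
  assumes BA: "boolean_algebra_on B meet join neg bt tp"
    and \<phi>: "\<And>x. x \<in> B \<Longrightarrow> \<phi> x \<in> carrier A" "inj_on \<phi> B"
    and tp: "\<phi> tp = one A"
    and add: "\<And>x y. \<lbrakk>x \<in> B; y \<in> B; meet x y = bt\<rbrakk> \<Longrightarrow> oplus A (\<phi> x) (\<phi> y) = Some (\<phi> (join x y))"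
  shows "\<phi> ` B \<in> BSub A"
proof -
  interpret BA: boolean_algebra_on B meet join neg bt tp by (rule BA)
  have bt: "\<phi> bt = zero A"
    using add[OF BA.bt_closed BA.bt_closed BA.meet_bt[OF BA.bt_closed]] by (rule oplus_self_zero)
  have neg: "\<phi> (neg x) = compl A (\<phi> x)" if "x \<in> B" for x
    using add[of x "neg x"] that by (intro compl_eqI) (simp add: BA.closed BA.meet_neg BA.join_neg tp)
  have disj: "meet x y = bt" if xy: "x \<in> B" "y \<in> B" "oplus A (\<phi> x) (\<phi> y) = Some c" for x y c
  proof -
    have split: "oplus A (\<phi> (meet u v)) (\<phi> (meet u (neg v))) = Some (\<phi> u)" if "u \<in> B" "v \<in> B" for u v
    proof -
      have "meet (meet u v) (meet u (neg v)) = meet (meet u u) (meet v (neg v))"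
        using that by (simp add: BA.meet_ac BA.closed)
      also have "\<dots> = bt" using that by (simp add: BA.meet_neg BA.meet_bt BA.closed)
      finally show ?thesis
        using that add[of "meet u v" "meet u (neg v)"]
        by (simp add: BA.closed BA.meet_join_distrib[symmetric] BA.join_neg BA.meet_tp)
    qed
    have sx: "oplus A (\<phi> (meet x (neg y))) (\<phi> (meet x y)) = Some (\<phi> x)"
      using split[of x y] xy oplus_comm by metis
    obtain d where d: "oplus A (\<phi> (meet x y)) (\<phi> y) = Some d"
      using oplus_assocD[OF sx xy(3)] by blast
    have sy: "oplus A (\<phi> (meet x y)) (\<phi> (meet y (neg x))) = Some (\<phi> y)"
      using split[of y x] xy BA.meet_commute by metis
    obtain e where "oplus A (\<phi> (meet x y)) (\<phi> (meet x y)) = Some e"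
      using oplus_assocD'[OF sy d] by blast
    then have "\<phi> (meet x y) = \<phi> bt" using oplus_self_zero bt by simp
    then show ?thesis using \<phi>(2) xy BA.closed by (simp add: inj_on_eq_iff)
  qed
  have sub: "subalgebra A (\<phi> ` B)"
    unfolding subalgebra_def
  proof (intro conjI ballI allI impI)
    fix a b c assume "a \<in> \<phi> ` B" "b \<in> \<phi> ` B" and c: "oplus A a b = Some c"
    then obtain x y where xy: "x \<in> B" "a = \<phi> x" "y \<in> B" "b = \<phi> y" by blast
    then have "c = \<phi> (join x y)" using add[of x y] disj c by simp
    then show "c \<in> \<phi> ` B" using xy BA.closed by blast
  next
    fix a assume "a \<in> \<phi> ` B"
    then show "compl A a \<in> \<phi> ` B" using neg BA.closed by force
  qed (use \<phi>(1) imageI[OF BA.bt_closed, of \<phi>] imageI[OF BA.tp_closed, of \<phi>] bt tp in auto)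
  define \<psi> where "\<psi> = inv_into B \<phi>"
  have \<psi>: "\<psi> (\<phi> x) = x" if "x \<in> B" for x using that \<phi>(2) by (simp add: \<psi>_def)
  define M where "M = (\<lambda>p q. \<phi> (meet (\<psi> p) (\<psi> q)))"
  define J where "J = (\<lambda>p q. \<phi> (join (\<psi> p) (\<psi> q)))"
  have MJ: "M (\<phi> x) (\<phi> y) = \<phi> (meet x y)" "J (\<phi> x) (\<phi> y) = \<phi> (join x y)" if "x \<in> B" "y \<in> B" for x y
    using that by (simp_all add: M_def J_def \<psi>)
  let ?R = "restrict_oalg A (\<phi> ` B)"
  have R: "carrier ?R = \<phi> ` B" "zero ?R = \<phi> bt" "one ?R = \<phi> tp" by (simp_all add: restrict_oalg_def bt tp)
  have Rc: "compl ?R (\<phi> x) = \<phi> (neg x)" if "x \<in> B" for x using that by (simp add: restrict_oalg_def neg)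
  have "boolean_algebra_on (\<phi> ` B) M J (compl ?R) (\<phi> bt) (\<phi> tp)"
  proof
    fix p q assume "p \<in> \<phi> ` B" "q \<in> \<phi> ` B"
    then obtain x y where xy: "x \<in> B" "y \<in> B" "p = \<phi> x" "q = \<phi> y" by blast
    then show "M p (J p q) = p" "J p (M p q) = p" "M p q \<in> \<phi> ` B" "J p q \<in> \<phi> ` B"
      by (simp_all add: MJ BA.closed BA.meet_join_absorb BA.join_meet_absorb)
    show "M p q = M q p" "J p q = J q p"
      using xy BA.meet_commute[of x y] BA.join_commute[of x y] by (simp_all only: MJ)
  next
    fix p q r assume "p \<in> \<phi> ` B" "q \<in> \<phi> ` B" "r \<in> \<phi> ` B"
    then obtain x y z where xyz: "x \<in> B" "y \<in> B" "z \<in> B" "p = \<phi> x" "q = \<phi> y" "r = \<phi> z" by blast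
    then show "M (M p q) r = M p (M q r)" "J (J p q) r = J p (J q r)" "M p (J q r) = J (M p q) (M p r)"
      by (simp_all add: MJ BA.closed BA.meet_assoc BA.join_assoc BA.meet_join_distrib)
    show "J p (M q r) = M (J p q) (J p r)"
      using xyz by (simp add: MJ BA.closed BA.join_meet_distrib)
  next
    fix p assume "p \<in> \<phi> ` B"
    then obtain x where "x \<in> B" "p = \<phi> x" by blast
    then show "compl ?R p \<in> \<phi> ` B" "M p (compl ?R p) = \<phi> bt" "J p (compl ?R p) = \<phi> tp"
      "J p (\<phi> bt) = p" "M p (\<phi> tp) = p"
      by (simp_all add: MJ Rc BA.closed BA.meet_neg BA.join_neg BA.join_bt BA.meet_tp)
  qed (use BA.closed in auto)
  moreover have "oplus ?R p q = (if M p q = zero ?R then Some (J p q) else None)"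
    if pq: "p \<in> \<phi> ` B" "q \<in> \<phi> ` B" for p q
  proof -
    obtain x y where xy: "x \<in> B" "y \<in> B" "p = \<phi> x" "q = \<phi> y" using pq by blast
    have "oplus ?R p q = oplus A p q" using pq by (simp add: restrict_oalg_def)
    moreover have "M p q = zero ?R \<longleftrightarrow> meet x y = bt"
      using xy \<phi>(2) by (simp add: MJ R inj_on_eq_iff BA.closed)
    ultimately show ?thesis
      using xy add[of x y] disj[of x y] MJ by (cases "oplus A p q") auto
  qed
  ultimately have "boolean_oalg ?R"
    unfolding boolean_oalg_def using orthoalgebra_restrict[OF sub] R by metis
  then show ?thesis using sub by (simp add: BSub_def)
qed

end

lemma (in orthoalgebra) BSub_boolean:
  assumes X: "X \<in> BSub A"
  obtains meet join where "boolean_algebra_on X meet join (restrict (compl A) X) (zero A) (one A)"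
    "\<And>a b. \<lbrakk>a \<in> X; b \<in> X\<rbrakk> \<Longrightarrow> oplus A a b = (if meet a b = zero A then Some (join a b) else None)"
proof -
  from X obtain meet join where
    "boolean_algebra_on X meet join (restrict (compl A) X) (zero A) (one A)"
    "\<forall>a\<in>X. \<forall>b\<in>X. oplus (restrict_oalg A X) a b = (if meet a b = zero A then Some (join a b) else None)"
    by (auto simp: BSub_def boolean_oalg_def restrict_oalg_def)
  then show ?thesis by (intro that) (auto simp: restrict_oalg_def)
qed

lemma BSub_subalgebra: "X \<in> BSub A \<Longrightarrow> subalgebra A X"
  by (simp add: BSub_def)

section \<open>Frames and heights\<close>

text \<open>A frame is an embedding of the power set of \<open>I\<close>, regarded as an orthoalgebra. For finite
  \<open>I\<close> it amounts to a family of nonzero elements indexed by \<open>I\<close> whose sum is the unit, together with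
  all partial sums. Indexing by sets keeps track of which summands enter a sum.\<close>

definition frame :: "'a oalg \<Rightarrow> 'i set \<Rightarrow> ('i set \<Rightarrow> 'a) \<Rightarrow> bool" where
  "frame A I \<phi> \<longleftrightarrow> \<phi> ` Pow I \<subseteq> carrier A \<and> inj_on \<phi> (Pow I) \<and> \<phi> I = one A \<and>
     (\<forall>U V. U \<subseteq> I \<and> V \<subseteq> I \<and> U \<inter> V = {} \<longrightarrow> oplus A (\<phi> U) (\<phi> V) = Some (\<phi> (U \<union> V)))"

lemma boolean_algebra_on_Pow: "boolean_algebra_on (Pow I) (\<inter>) (\<union>) ((-) I) {} I"
  by standard auto

context orthoalgebra
begin

context
  fixes I :: "'i set" and \<phi> assumes \<phi>: "frame A I \<phi>"
begin

lemma frame_carrier: "U \<subseteq> I \<Longrightarrow> \<phi> U \<in> carrier A"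
  using \<phi> by (auto simp: frame_def)

lemma frame_eq_iff: "U \<subseteq> I \<Longrightarrow> V \<subseteq> I \<Longrightarrow> \<phi> U = \<phi> V \<longleftrightarrow> U = V"
  using \<phi> by (auto simp: frame_def inj_on_eq_iff)

lemma frame_top: "\<phi> I = one A"
  using \<phi> by (simp add: frame_def)

lemma frame_oplus: "U \<subseteq> I \<Longrightarrow> V \<subseteq> I \<Longrightarrow> U \<inter> V = {} \<Longrightarrow> oplus A (\<phi> U) (\<phi> V) = Some (\<phi> (U \<union> V))"
  using \<phi> by (simp add: frame_def)

lemma frame_empty: "\<phi> {} = zero A"
  using frame_oplus[of "{}" "{}"] oplus_self_zero by simp

lemma frame_eq_zero_iff: "U \<subseteq> I \<Longrightarrow> \<phi> U = zero A \<longleftrightarrow> U = {}"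
  using frame_eq_iff[of U "{}"] frame_empty by simp

lemma frame_eq_one_iff: "U \<subseteq> I \<Longrightarrow> \<phi> U = one A \<longleftrightarrow> U = I"
  using frame_eq_iff[of U I] frame_top by simp

lemma frame_compl: "U \<subseteq> I \<Longrightarrow> \<phi> (I - U) = compl A (\<phi> U)"
  using frame_oplus[of U "I - U"] frame_top by (intro compl_eqI) (auto simp: Un_absorb1)

text \<open>Applied to the whole power set this yields the Boolean subalgebra spanned by the frame; smaller
  fields of sets yield its subalgebras.\<close>

lemma frame_field_in_BSub:
  assumes "F \<subseteq> Pow I" "{} \<in> F" "\<And>U. U \<in> F \<Longrightarrow> I - U \<in> F" "\<And>U V. U \<in> F \<Longrightarrow> V \<in> F \<Longrightarrow> U \<union> V \<in> F"
  shows "\<phi> ` F \<in> BSub A"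
proof (rule image_in_BSub)
  show "boolean_algebra_on F (\<inter>) (\<union>) ((-) I) {} I"
    using boolean_algebra_on.boolean_algebra_on_subset[OF boolean_algebra_on_Pow[of I]] assms by blast
  show "inj_on \<phi> F" using \<phi> assms(1) by (meson frame_def inj_on_subset)
  show "oplus A (\<phi> U) (\<phi> V) = Some (\<phi> (U \<union> V))" if "U \<in> F" "V \<in> F" "U \<inter> V = {}" for U V
    using that assms(1) by (intro frame_oplus) auto
qed (use assms(1) frame_carrier frame_top in auto)

lemma frame_image_in_BSub: "\<phi> ` Pow I \<in> BSub A"
  by (rule frame_field_in_BSub) auto

lemma card_frame_image: "finite I \<Longrightarrow> card (\<phi> ` Pow I) = 2 ^ card I"
  using \<phi> by (simp add: frame_def card_image card_Pow)

lemma frame_oplus_iff: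
  assumes "U \<subseteq> I" "V \<subseteq> I"
  shows "oplus A (\<phi> U) (\<phi> V) = Some c \<longleftrightarrow> U \<inter> V = {} \<and> c = \<phi> (U \<union> V)"
proof
  assume c: "oplus A (\<phi> U) (\<phi> V) = Some c"
  have "(U - V) \<union> (U \<inter> V) = U" by blast
  then have "oplus A (\<phi> (U - V)) (\<phi> (U \<inter> V)) = Some (\<phi> U)"
    using frame_oplus[of "U - V" "U \<inter> V"] assms by auto
  from oplus_assocD[OF this c] obtain d where "oplus A (\<phi> (U \<inter> V)) (\<phi> V) = Some d" by blast
  moreover have "oplus A (\<phi> (U \<inter> V)) (\<phi> (V - U)) = Some (\<phi> V)"
  proof -
    have "(U \<inter> V) \<union> (V - U) = V" by blast
    then show ?thesis using frame_oplus[of "U \<inter> V" "V - U"] assms by auto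
  qed
  ultimately obtain e where "oplus A (\<phi> (U \<inter> V)) (\<phi> (U \<inter> V)) = Some e" using oplus_assocD' by blast
  then have "\<phi> (U \<inter> V) = zero A" by (rule oplus_self_zero)
  then have "U \<inter> V = {}" using frame_eq_zero_iff[of "U \<inter> V"] assms by blast
  then show "U \<inter> V = {} \<and> c = \<phi> (U \<union> V)" using frame_oplus assms c by simp
qed (use assms frame_oplus in auto)

end

text \<open>Two sets with the same value have differences with the same value. These differences are
  disjoint, so their common value is orthogonal to itself and therefore \<open>0\<close>, which is possible only
  for the empty set.\<close>

lemma frameI:
  assumes cl: "\<And>U. U \<subseteq> I \<Longrightarrow> \<phi> U \<in> carrier A" and top: "\<phi> I = one A"
    and add: "\<And>U V. U \<subseteq> I \<Longrightarrow> V \<subseteq> I \<Longrightarrow> U \<inter> V = {} \<Longrightarrow> oplus A (\<phi> U) (\<phi> V) = Some (\<phi> (U \<union> V))"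
    and nz: "\<And>i. i \<in> I \<Longrightarrow> \<phi> {i} \<noteq> zero A"
  shows "frame A I \<phi>"
proof -
  have zero: "W = {}" if "W \<subseteq> I" "\<phi> W = zero A" for W
  proof (rule ccontr)
    assume "W \<noteq> {}"
    then obtain i where i: "i \<in> W" by blast
    then have "insert i (W - {i}) = W" by blast
    then have "oplus A (\<phi> {i}) (\<phi> (W - {i})) = Some (zero A)" using add[of "{i}" "W - {i}"] i that by auto
    then show False using nz oplus_eq_zero i that by blast
  qed
  have "U = V" if UV: "U \<subseteq> I" "V \<subseteq> I" "\<phi> U = \<phi> V" for U V
  proof -
    have "U \<union> V = V \<union> U" by blast
    then have "oplus A (\<phi> U) (\<phi> (V - U)) = Some (\<phi> (U \<union> V))" "oplus A (\<phi> U) (\<phi> (U - V)) = Some (\<phi> (U \<union> V))"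
      using add[of U "V - U"] add[of V "U - V"] UV by auto
    then have eq: "\<phi> (V - U) = \<phi> (U - V)" by (rule oplus_cancel)
    have "oplus A (\<phi> (V - U)) (\<phi> (U - V)) \<noteq> None" using add[of "V - U" "U - V"] UV by auto
    then have "\<phi> (U - V) = zero A" using eq oplus_self_zero by (metis option.exhaust)
    then have "U - V = {}" "V - U = {}" using zero[of "U - V"] zero[of "V - U"] eq UV by auto
    then show ?thesis by blast
  qed
  then show ?thesis using cl top add by (auto simp: frame_def inj_on_def)
qed

text \<open>The frame consists of the atoms of the subalgebra, and is inverse to the representation of its
  elements by sets of atoms. Numbering the atoms makes frames on initial segments of the natural
  numbers sufficient.\<close>

lemma finite_BSub_frame:
  assumes X: "X \<in> BSub A" "finite X"
  obtains n :: nat and \<phi> where "frame A {..<n} \<phi>" "X = \<phi> ` Pow {..<n}"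
proof -
  obtain meet join where BA: "boolean_algebra_on X meet join (restrict (compl A) X) (zero A) (one A)"
    and op: "\<And>a b. \<lbrakk>a \<in> X; b \<in> X\<rbrakk> \<Longrightarrow> oplus A a b = (if meet a b = zero A then Some (join a b) else None)"
    using BSub_boolean[OF X(1)] by metis
  interpret BA: boolean_algebra_on X meet join "restrict (compl A) X" "zero A" "one A" by (rule BA)
  have XA: "X \<subseteq> carrier A" using BSub_subalgebra[OF X(1)] by (simp add: subalgebra_def)
  have bij: "bij_betw BA.atoms_below X (Pow BA.atom_set)" using BA.atoms_below_bij[OF X(2)] .
  define \<psi> where "\<psi> = inv_into X BA.atoms_below"
  have \<psi>: "\<psi> U \<in> X" "BA.atoms_below (\<psi> U) = U" if "U \<subseteq> BA.atom_set" for U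
    using that bij unfolding \<psi>_def by (simp_all add: bij_betw_def inv_into_into f_inv_into_f)
  have \<psi>_eq: "\<psi> U = x" if "x \<in> X" "BA.atoms_below x = U" for x U
    using that bij unfolding \<psi>_def by (auto simp: bij_betw_def inv_into_f_f)
  have img: "\<psi> ` Pow BA.atom_set = X"
    using bij_betw_inv_into[OF bij] by (simp add: bij_betw_def \<psi>_def)
  have fin: "finite BA.atom_set" using X(2) by (simp add: BA.atom_set_def)
  have frame: "frame A BA.atom_set \<psi>"
    unfolding frame_def
  proof (intro conjI allI impI)
    show "\<psi> ` Pow BA.atom_set \<subseteq> carrier A" using \<psi> XA by blast
    show "inj_on \<psi> (Pow BA.atom_set)" using \<psi> by (metis PowD inj_onI)
    show "\<psi> BA.atom_set = one A" using \<psi>_eq BA.atoms_below_tp BA.tp_closed by blast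
    fix U V assume UV: "U \<subseteq> BA.atom_set \<and> V \<subseteq> BA.atom_set \<and> U \<inter> V = {}"
    have "meet (\<psi> U) (\<psi> V) = zero A"
    proof (rule ccontr)
      assume "meet (\<psi> U) (\<psi> V) \<noteq> zero A"
      then obtain a where a: "a \<in> BA.atoms_below (meet (\<psi> U) (\<psi> V))"
        using BA.atom_below[OF X(2)] BA.meet_closed \<psi> UV by meson
      have eq: "BA.atoms_below x = BA.atoms_below x \<union> BA.atoms_below (meet x y)"
        if "x \<in> X" "y \<in> X" for x y
        using BA.atoms_below_join[of x "meet x y"] BA.join_meet_absorb[of x y] BA.meet_closed that by simp
      have "a \<in> BA.atoms_below (\<psi> U)" using eq[of "\<psi> U" "\<psi> V"] a UV \<psi> by blast
      moreover have "a \<in> BA.atoms_below (\<psi> V)"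
        using eq[of "\<psi> V" "\<psi> U"] BA.meet_commute[of "\<psi> U" "\<psi> V"] a UV \<psi> by auto
      ultimately show False using UV \<psi> by auto
    qed
    moreover have "join (\<psi> U) (\<psi> V) = \<psi> (U \<union> V)"
      using \<psi>_eq[of "join (\<psi> U) (\<psi> V)" "U \<union> V"] UV \<psi> BA.join_closed BA.atoms_below_join by simp
    ultimately show "oplus A (\<psi> U) (\<psi> V) = Some (\<psi> (U \<union> V))" using op \<psi> UV by simp
  qed
  obtain h where h: "bij_betw h {..<card BA.atom_set} BA.atom_set"
    using ex_bij_betw_nat_finite[OF fin] lessThan_atLeast0 by auto
  let ?I = "{..<card BA.atom_set}"
  have hI: "h ` ?I = BA.atom_set" and hinj: "inj_on h ?I" using h by (auto simp: bij_betw_def)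
  have hU: "h ` U \<subseteq> BA.atom_set" if "U \<subseteq> ?I" for U using that hI by blast
  have "frame A ?I (\<lambda>U. \<psi> (h ` U))"
  proof (rule frameI)
    fix U V assume UV: "U \<subseteq> ?I" "V \<subseteq> ?I" "U \<inter> V = {}"
    then have "h ` U \<inter> h ` V = {}" using inj_on_image_Int[OF hinj UV(1,2)] by simp
    then show "oplus A (\<psi> (h ` U)) (\<psi> (h ` V)) = Some (\<psi> (h ` (U \<union> V)))"
      using frame_oplus[OF frame] hU UV by (simp add: image_Un)
  next
    fix i assume "i \<in> ?I"
    then show "\<psi> (h ` {i}) \<noteq> zero A" using frame_eq_zero_iff[OF frame, of "h ` {i}"] hU[of "{i}"] by simp
  qed (use frame_carrier[OF frame] hU frame_top[OF frame] hI in auto)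
  moreover have "X = (\<lambda>U. \<psi> (h ` U)) ` Pow ?I"
    using img image_Pow_surj[OF hI] by (metis image_image)
  ultimately show ?thesis using that by blast
qed

lemma zero_in_BSub: "X \<in> BSub A \<Longrightarrow> zero A \<in> X" "X \<in> BSub A \<Longrightarrow> one A \<in> X"
  by (auto dest!: BSub_subalgebra simp: subalgebra_def)

lemma card_BSub:
  assumes "X \<in> BSub A" "finite X" "zero A \<noteq> one A"
  obtains n where "card X = 2 ^ n" "n \<ge> 1"
proof -
  obtain n :: nat and \<phi> where \<phi>: "frame A {..<n} \<phi>" "X = \<phi> ` Pow {..<n}"
    using finite_BSub_frame[OF assms(1,2)] by blast
  moreover have "n \<noteq> 0" using frame_top[OF \<phi>(1)] frame_empty[OF \<phi>(1)] assms(3) by (cases n) auto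
  ultimately show ?thesis using that[of n] card_frame_image[OF \<phi>(1)] by simp
qed

text \<open>The members of a chain of finite Boolean subalgebras have distinct cardinalities, which are among
  \<open>2, 4, \<dots>, 2\<^sup>n\<close> because the bounds are distinct.\<close>

lemma card_chain_le:
  assumes K: "subset.chain {Y \<in> BSub A. Y \<subseteq> X} K" and X: "finite X" "card X = 2 ^ n"
    and 01: "zero A \<noteq> one A"
  shows "finite K \<and> card K \<le> n"
proof -
  have KX: "Y \<in> BSub A" "Y \<subseteq> X" if "Y \<in> K" for Y using K that by (auto simp: subset.chain_def)
  have fin: "finite K" using KX(2) X(1) by (meson Pow_iff finite_Pow_iff finite_subset subsetI)
  have inj: "inj_on card K"
  proof (rule inj_onI, rule ccontr)
    fix Y Z assume YZ: "Y \<in> K" "Z \<in> K" "card Y = card Z" "Y \<noteq> Z"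
    then have "Y \<subset> Z \<or> Z \<subset> Y" using K unfolding subset.chain_def by blast
    then show False using YZ KX(2) X(1) by (metis finite_subset nat_less_le psubset_card_mono)
  qed
  have "card ` K \<subseteq> (\<lambda>j. 2 ^ j) ` {1..n}"
  proof
    fix c assume "c \<in> card ` K"
    then obtain Y where Y: "Y \<in> K" "c = card Y" by blast
    obtain j where j: "card Y = 2 ^ j" "j \<ge> 1"
      using card_BSub[OF KX(1)[OF Y(1)] finite_subset[OF KX(2)[OF Y(1)] X(1)] 01] by blast
    have "card Y \<le> card X" using KX(2)[OF Y(1)] X(1) card_mono by blast
    then have "j \<le> n" using j X(2) by simp
    then show "c \<in> (\<lambda>j. 2 ^ j) ` {1..n}" using Y j by auto
  qed
  then have "card (card ` K) \<le> card {1..n}" by (metis surj_card_le finite_atLeastAtMost)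
  then show ?thesis using fin inj by (simp add: card_image)
qed

text \<open>Collapsing the atoms \<open>j, \<dots>, n - 1\<close> to a single one, for \<open>j < n\<close>, gives a chain of \<open>n\<close>
  subalgebras, which is as long as the cardinalities allow.\<close>

lemma frame_has_height:
  fixes n :: nat
  assumes \<phi>: "frame A {..<n} \<phi>" and n: "n \<ge> 1"
  shows "has_height (BSub A) (\<phi> ` Pow {..<n}) (n - 1)"
proof -
  let ?I = "{..<n}" and ?X = "\<phi> ` Pow {..<n}"
  define F where "F j = {U. U \<subseteq> ?I \<and> ({j..<n} \<subseteq> U \<or> {j..<n} \<inter> U = {})}" for j
  have FB: "\<phi> ` F j \<in> BSub A" for j
    by (rule frame_field_in_BSub[OF \<phi>]) (auto simp: F_def)
  have mono: "F i \<subseteq> F j" if "i \<le> j" for i j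
    using that unfolding F_def by (auto simp: subset_iff disjoint_iff)
  have strict: "\<phi> ` F i \<noteq> \<phi> ` F j" if "i < j" "j < n" for i j
  proof
    assume "\<phi> ` F i = \<phi> ` F j"
    then have "F i = F j"
      using inj_on_image_eq_iff[of \<phi> "Pow ?I" "F i" "F j"] \<phi> by (auto simp: F_def frame_def)
    moreover have "{i} \<in> F j" using that by (auto simp: F_def)
    ultimately have "{i} \<in> F i" by simp
    then have "{i..<n} \<subseteq> {i}" using that by (auto simp: F_def)
    moreover have "j \<in> {i..<n}" using that by simp
    ultimately have "j \<in> {i}" by (rule subsetD)
    then show False using that by simp
  qed
  let ?K = "(\<lambda>j. \<phi> ` F j) ` {..<n}"
  have "inj_on (\<lambda>j. \<phi> ` F j) {..<n}"
    using strict by (intro inj_onI) (metis lessThan_iff linorder_neqE_nat)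
  then have "card ?K = n" by (simp add: card_image)
  moreover have "subset.chain {Y \<in> BSub A. Y \<subseteq> ?X} ?K"
  proof (unfold subset.chain_def, intro conjI ballI)
    show "?K \<subseteq> {Y \<in> BSub A. Y \<subseteq> ?X}" using FB by (auto simp: F_def)
    fix Y Z assume "Y \<in> ?K" "Z \<in> ?K"
    then obtain i j where "Y = \<phi> ` F i" "Z = \<phi> ` F j" by blast
    then show "(\<subset>)\<^sup>=\<^sup>= Y Z \<or> (\<subset>)\<^sup>=\<^sup>= Z Y" using mono[of i j] mono[of j i] by (cases "i \<le> j") auto
  qed
  moreover have "zero A \<noteq> one A"
    using frame_eq_zero_iff[OF \<phi>, of ?I] frame_top[OF \<phi>] n by (auto simp: lessThan_empty_iff)
  then have "finite K \<and> card K \<le> n" if "subset.chain {Y \<in> BSub A. Y \<subseteq> ?X} K" for K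
    using card_chain_le[OF that] card_frame_image[OF \<phi>] by simp
  ultimately show ?thesis
    unfolding has_height_def using frame_image_in_BSub[OF \<phi>] n by auto
qed

text \<open>No finite subalgebra exhausts an infinite one, and adjoining a further element keeps a finite
  subalgebra finite. So a chain of finite subalgebras can always be continued upwards.\<close>

lemma infinite_BSub_chain:
  assumes X: "X \<in> BSub A" "infinite X"
  shows "\<exists>K. subset.chain {Y \<in> BSub A. Y \<subseteq> X} K \<and> finite K \<and> card K = Suc n"
proof -
  obtain meet join where BA: "boolean_algebra_on X meet join (restrict (compl A) X) (zero A) (one A)"
    and op: "\<And>a b. \<lbrakk>a \<in> X; b \<in> X\<rbrakk> \<Longrightarrow> oplus A a b = (if meet a b = zero A then Some (join a b) else None)"
    using BSub_boolean[OF X(1)] by metis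
  let ?neg = "restrict (compl A) X"
  interpret BA: boolean_algebra_on X meet join ?neg "zero A" "one A" by (rule BA)
  have XA: "X \<subseteq> carrier A" using BSub_subalgebra[OF X(1)] by (simp add: subalgebra_def)
  define S where "S Y \<longleftrightarrow> Y \<subseteq> X \<and> finite Y \<and> zero A \<in> Y \<and> (\<forall>x\<in>Y. ?neg x \<in> Y) \<and>
      (\<forall>x\<in>Y. \<forall>y\<in>Y. join x y \<in> Y)" for Y
  have SB: "Y \<in> BSub A" if "S Y" for Y
  proof -
    have "boolean_algebra_on Y meet join ?neg (zero A) (one A)"
      by (rule BA.boolean_algebra_on_subset) (use that in \<open>auto simp: S_def\<close>)
    moreover have "Y \<subseteq> X" using that by (simp add: S_def)
    ultimately have "id ` Y \<in> BSub A"
      by (rule_tac image_in_BSub[where \<phi> = id]) (use XA op in \<open>auto simp: subset_iff\<close>)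
    then show ?thesis by simp
  qed
  have ext: "\<exists>Z. S Z \<and> Y \<subset> Z" if Y: "S Y" for Y
  proof -
    obtain b where b: "b \<in> X" "b \<notin> Y" using X(2) Y unfolding S_def by (meson finite_subset subsetI)
    have Y': "Y \<subseteq> X" "zero A \<in> Y" "\<And>x. x \<in> Y \<Longrightarrow> ?neg x \<in> Y" "\<And>x y. x \<in> Y \<Longrightarrow> y \<in> Y \<Longrightarrow> join x y \<in> Y"
      using Y unfolding S_def by blast+
    note ad = BA.adjoin[OF Y' b(1)]
    have "finite (BA.adjoin Y b)" using Y by (simp add: BA.adjoin_def S_def)
    then have "S (BA.adjoin Y b)" using ad Y'(2) unfolding S_def by blast
    then show ?thesis using ad(1,2) b(2) by blast
  qed
  have "\<exists>K Y. subset.chain {Y \<in> BSub A. Y \<subseteq> X} K \<and> finite K \<and> card K = Suc n \<and> S Y \<and> (\<forall>Z\<in>K. Z \<subseteq> Y)"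
  proof (induction n)
    case 0
    have "?neg (zero A) = one A" using compl_zero BA.bt_closed by simp
    moreover have "?neg (one A) = zero A" using compl_one BA.tp_closed by simp
    moreover have "join (zero A) (zero A) = zero A" "join (one A) (one A) = one A"
        "join (one A) (zero A) = one A" "join (zero A) (one A) = one A"
      by (simp_all add: BA.closed BA.join_idem BA.join_bt BA.join_tp)
    ultimately have "S {zero A, one A}"
      unfolding S_def using BA.bt_closed BA.tp_closed
      by (intro conjI ballI) (auto simp del: restrict_apply)
    moreover from this have "{zero A, one A} \<in> BSub A" by (rule SB)
    ultimately show ?case
      using BA.bt_closed BA.tp_closed
      by (intro exI[of _ "{{zero A, one A}}"] exI[of _ "{zero A, one A}"]) (simp add: subset.chain_def)
  next
    case (Suc n)
    then obtain K Y where K: "subset.chain {Y \<in> BSub A. Y \<subseteq> X} K" "finite K" "card K = Suc n" "S Y" "\<forall>Z\<in>K. Z \<subseteq> Y"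
      by blast
    obtain W where W: "S W" "Y \<subset> W" using ext[OF K(4)] by blast
    then have "W \<notin> K" "\<forall>Z\<in>K. Z \<subset> W" using K(5) by auto
    moreover have "W \<subseteq> X" using W by (simp add: S_def)
    ultimately have "subset.chain {Y \<in> BSub A. Y \<subseteq> X} (insert W K)" "card (insert W K) = Suc (Suc n)"
      using K(1-3) SB[OF W(1)] by (auto simp: subset.chain_def)
    then show ?case using K W by (intro exI[of _ "insert W K"] exI[of _ W]) auto
  qed
  then show ?thesis by blast
qed

text \<open>A Boolean subalgebra of finite height is finite, and the number of its atoms is determined by its
  height.\<close>

lemma has_height_frame:
  assumes X: "has_height (BSub A) X n" and n: "n \<ge> 1"
  obtains \<phi> where "frame A {..n} \<phi>" "X = \<phi> ` Pow {..n}"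
proof -
  have XB: "X \<in> BSub A" using X by (simp add: has_height_def)
  have fin: "finite X"
  proof (rule ccontr)
    assume "infinite X"
    from infinite_BSub_chain[OF XB this, of "n + 1"] X show False by (auto simp: has_height_def)
  qed
  obtain m :: nat and \<phi> where \<phi>: "frame A {..<m} \<phi>" "X = \<phi> ` Pow {..<m}"
    using finite_BSub_frame[OF XB fin] by blast
  obtain K where K: "subset.chain {Y \<in> BSub A. Y \<subseteq> X} K" "card K = n + 1"
    using X by (auto simp: has_height_def)
  have m: "m \<ge> 1"
  proof (rule ccontr)
    assume "\<not> m \<ge> 1"
    then have "m = 0" by simp
    then have "X = {zero A}" using \<phi>(2) frame_empty[OF \<phi>(1)] by simp
    then have "K \<subseteq> {{zero A}}" using K(1) zero_in_BSub by (fastforce simp: subset.chain_def)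
    then have "card K \<le> card {{zero A}}" by (intro card_mono) auto
    then show False using K(2) n by simp
  qed
  from frame_has_height[OF \<phi>(1) this] have h: "has_height (BSub A) X (m - 1)" using \<phi>(2) by simp
  then obtain L where "subset.chain {Y \<in> BSub A. Y \<subseteq> X} L" "card L = m - 1 + 1" by (auto simp: has_height_def)
  then have "m - 1 + 1 \<le> n + 1" "n + 1 \<le> m - 1 + 1" using X K h by (auto simp: has_height_def)
  then have "m = Suc n" using m by simp
  then show ?thesis using that \<phi> by (simp add: lessThan_Suc_atMost)
qed

end

section \<open>Partitions of the unit\<close>

primrec psum :: "'a oalg \<Rightarrow> 'a list \<Rightarrow> 'a option" where
  "psum A [] = Some (zero A)"
| "psum A (x # xs) = Option.bind (psum A xs) (oplus A x)"

lemma nths_singleton_index: "i < length xs \<Longrightarrow> nths xs {i} = [xs ! i]"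
proof (induction xs arbitrary: i)
  case (Cons x xs)
  have "{j. Suc j \<in> {i}} = (case i of 0 \<Rightarrow> {} | Suc k \<Rightarrow> {k})" by (auto split: nat.split)
  then show ?case using Cons by (cases i) (auto simp: nths_Cons)
qed simp

context orthoalgebra
begin

text \<open>Induction along the list; the summand \<open>r\<close> records that the subsum is a part of the whole sum,
  which is why the next entry of the list can be added to it.\<close>

lemma psum_nths:
  assumes "psum A xs = Some s" "U \<inter> V = {}"
  shows "\<exists>u v w r. psum A (nths xs U) = Some u \<and> psum A (nths xs V) = Some v \<and>
    psum A (nths xs (U \<union> V)) = Some w \<and> oplus A u v = Some w \<and> oplus A w r = Some s"
  using assms
proof (induction xs arbitrary: s U V)
  case Nil
  then show ?case using oplus_zero[OF zero_closed] by auto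
next
  case (Cons x xs)
  let ?s = "\<lambda>U. {j. Suc j \<in> U}"
  obtain s0 where s0: "psum A xs = Some s0" "oplus A x s0 = Some s"
    using Cons.prems(1) by (auto simp: bind_eq_Some_conv)
  have un: "?s (U \<union> V) = ?s U \<union> ?s V" by blast
  have "?s U \<inter> ?s V = {}" using Cons.prems(2) by blast
  from Cons.IH[OF s0(1) this] obtain u v w r where
    IH: "psum A (nths xs (?s U)) = Some u" "psum A (nths xs (?s V)) = Some v"
      "psum A (nths xs (?s (U \<union> V))) = Some w" "oplus A u v = Some w" "oplus A w r = Some s0"
    unfolding un by blast
  obtain x' where x': "oplus A x w = Some x'" "oplus A x' r = Some s"
    using oplus_assocD'[OF IH(5) s0(2)] by blast
  consider "0 \<in> U" "0 \<notin> V" | "0 \<notin> U" "0 \<in> V" | "0 \<notin> U" "0 \<notin> V" using Cons.prems(2) by blast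
  then show ?case
  proof cases
    case 1
    obtain d where "oplus A x u = Some d" "oplus A d v = Some x'" using oplus_assocD'[OF IH(4) x'(1)] by blast
    then show ?thesis using 1 IH x' by (auto simp: nths_Cons)
  next
    case 2
    have "oplus A v u = Some w" using IH(4) oplus_comm by simp
    then obtain d where "oplus A x v = Some d" "oplus A d u = Some x'"
      using oplus_assocD'[OF _ x'(1)] by blast
    then have "oplus A x v = Some d" "oplus A u d = Some x'" using oplus_comm by metis+
    then show ?thesis using 2 IH x' by (auto simp: nths_Cons)
  next
    case 3
    have "oplus A s0 x = Some s" using s0 oplus_comm by simp
    then obtain f where "oplus A w f = Some s" using oplus_assocD[OF IH(5)] by blast
    then show ?thesis using 3 IH by (auto simp: nths_Cons)
  qed
qed

lemma psum_single: "a \<in> carrier A \<Longrightarrow> psum A [a] = Some a"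
  using oplus_zero by simp

lemma psum_list_closed: "psum A xs = Some s \<Longrightarrow> set xs \<subseteq> carrier A"
  using oplus_closed by (induction xs arbitrary: s) (fastforce simp: bind_eq_Some_conv)+

lemma list_frame:
  assumes xs: "psum A xs = Some (one A)" "zero A \<notin> set xs"
  obtains \<phi> where "frame A {..<length xs} \<phi>" "\<And>i. i < length xs \<Longrightarrow> \<phi> {i} = xs ! i"
proof -
  define \<phi> where "\<phi> U = the (psum A (nths xs U))" for U
  have add: "oplus A (\<phi> U) (\<phi> V) = Some (\<phi> (U \<union> V))" if "U \<inter> V = {}" for U V
    using psum_nths[OF xs(1) that] by (auto simp: \<phi>_def)
  have sing: "\<phi> {i} = xs ! i" if "i < length xs" for i
  proof -
    have "xs ! i \<in> carrier A" using psum_list_closed[OF xs(1)] nth_mem[OF that] by blast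
    then show ?thesis using psum_single by (simp add: \<phi>_def nths_singleton_index[OF that] del: psum.simps)
  qed
  have "frame A {..<length xs} \<phi>"
  proof (rule frameI)
    show "\<phi> U \<in> carrier A" for U using add[of U "{}"] oplus_closed by auto
    show "\<phi> {..<length xs} = one A" using xs(1) by (simp add: \<phi>_def nths_upt_eq_take)
    show "\<phi> {i} \<noteq> zero A" if "i \<in> {..<length xs}" for i using sing[of i] that xs(2) nth_mem by fastforce
  qed (rule add)
  then show ?thesis using that sing by blast
qed

text \<open>Three nonzero elements whose sum is the unit, expressed without nested partial sums.\<close>

definition triple :: "'a \<Rightarrow> 'a \<Rightarrow> 'a \<Rightarrow> bool" where
  "triple a b c \<longleftrightarrow> a \<noteq> zero A \<and> b \<noteq> zero A \<and> c \<noteq> zero A \<and> c \<in> carrier A \<and> oplus A a b = Some (compl A c)"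

lemma triple_swap: "triple a b c \<Longrightarrow> triple b a c"
  using oplus_comm by (auto simp: triple_def)

lemma triple_rotate: assumes "triple a b c" shows "triple b c a"
proof -
  have c: "oplus A a b = Some (compl A c)" "c \<in> carrier A" using assms by (auto simp: triple_def)
  then have "oplus A (compl A c) c = Some (one A)" using oplus_compl oplus_comm by metis
  from oplus_assocD[OF c(1) this] obtain f where "oplus A b c = Some f" "oplus A a f = Some (one A)" by blast
  then show ?thesis using assms compl_eqI oplus_closed by (auto simp: triple_def)
qed

lemma triple_carrier: "triple a b c \<Longrightarrow> a \<in> carrier A \<and> b \<in> carrier A \<and> c \<in> carrier A"
  using oplus_closed by (auto simp: triple_def)

lemma triple_nontrivial_third: "triple a b c \<Longrightarrow> c \<noteq> zero A \<and> c \<noteq> one A"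
  using compl_one oplus_eq_zero by (auto simp: triple_def)

lemma triple_nontrivial:
  assumes "triple a b c"
  shows "a \<noteq> zero A" "a \<noteq> one A" "b \<noteq> zero A" "b \<noteq> one A" "c \<noteq> zero A" "c \<noteq> one A"
  using triple_nontrivial_third assms triple_rotate by blast+

lemma triple_frame:
  assumes "triple a b c"
  obtains \<phi> where "frame A {..<3::nat} \<phi>" "\<phi> {0} = a" "\<phi> {1} = b" "\<phi> {2} = c"
proof -
  have "oplus A b c = Some (compl A a)" using triple_rotate[OF assms] by (simp add: triple_def)
  then have "psum A [a, b, c] = Some (one A)"
    using triple_carrier[OF assms] oplus_zero oplus_compl by simp
  moreover have "zero A \<notin> set [a, b, c]" using assms by (auto simp: triple_def)
  ultimately obtain \<phi> where \<phi>: "frame A {..<length [a, b, c]} \<phi>"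
    and s: "\<And>i. i < length [a, b, c] \<Longrightarrow> \<phi> {i} = [a, b, c] ! i"
    using list_frame by blast
  have "length [a, b, c] = 3" by simp
  moreover have "\<phi> {0} = a" "\<phi> {1} = b" "\<phi> {2} = c" using s[of 0] s[of 1] s[of 2] by simp_all
  ultimately show ?thesis using \<phi> that by metis
qed

lemma triple_x_sub_neq: assumes "triple a b c" shows "x_sub A a \<noteq> x_sub A b"
proof -
  have "b \<noteq> a" using assms oplus_self_zero by (auto simp: triple_def)
  moreover have "b \<noteq> compl A a"
  proof
    assume "b = compl A a"
    then have "compl A c = one A"
      using assms oplus_compl[of a] triple_carrier[OF assms] by (simp add: triple_def)
    then show False using compl_eq_one assms by (simp add: triple_def)
  qed
  ultimately show ?thesis using x_sub_eq_iff triple_nontrivial[OF assms] triple_carrier[OF assms] by blast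
qed

lemma triple_x_sub_distinct:
  assumes "triple a b c" shows "distinct [x_sub A a, x_sub A b, x_sub A c]"
  using triple_x_sub_neq[OF assms] triple_x_sub_neq[OF triple_rotate[OF assms]]
    triple_x_sub_neq[OF triple_rotate[OF triple_rotate[OF assms]]] by auto

text \<open>Otherwise the complement of \<open>a\<close>, which is \<open>b \<oplus> c\<close>, would be orthogonal to \<open>b\<close> or to the complement
  of \<open>b\<close>, which is \<open>a \<oplus> c\<close>. Then \<open>b\<close> or \<open>c\<close> would be orthogonal to itself. So a point \<open>x\<^sub>a\<close> of a line
  knows which of \<open>a\<close> and its complement is a summand of the unit there; this is the direction of the
  line at the point.\<close>

lemma triple_rigid:
  assumes t: "triple a b c" "triple a' b' c'" and x: "x_sub A a = x_sub A a'" "x_sub A b = x_sub A b'"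
  shows "a = a'"
proof (rule ccontr)
  note nt = triple_nontrivial[OF t(1)] and cr = triple_carrier[OF t(1)] triple_carrier[OF t(2)]
  assume "a \<noteq> a'"
  then have a': "a' = compl A a" using x_sub_eq_iff[of a a'] x nt cr by auto
  have b': "b' = b \<or> b' = compl A b" using x_sub_eq_iff[of b b'] x nt cr by auto
  obtain s where s: "oplus A a' b' = Some s" using t(2) by (auto simp: triple_def)
  have cb: "oplus A c b = Some a'" using triple_rotate[OF t(1)] a' oplus_comm by (auto simp: triple_def)
  have bc: "oplus A b c = Some a'" using cb oplus_comm by metis
  have ac: "oplus A a c = Some (compl A b)"
    using triple_rotate[OF triple_rotate[OF t(1)]] oplus_comm by (auto simp: triple_def)
  show False
  proof (cases "b' = b")
    case True
    from oplus_assocD[OF cb, of b s] s True obtain f where "oplus A b b = Some f" by blast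
    then show False using oplus_self_zero nt by blast
  next
    case False
    then have s': "oplus A a' (compl A b) = Some s" using s b' by simp
    from oplus_assocD[OF bc s'] obtain f where "oplus A c (compl A b) = Some f" by blast
    then have "oplus A (compl A b) c = Some f" using oplus_comm by metis
    from oplus_assocD[OF ac this] obtain g where "oplus A c c = Some g" by blast
    then show False using oplus_self_zero nt by blast
  qed
qed

section \<open>Points, lines and planes of the hypergraph of an orthoalgebra\<close>

lemma frame_x_sub_eq_iff:
  assumes "frame A I \<phi>" "U \<subseteq> I" "V \<subseteq> I" "U \<noteq> {}" "U \<noteq> I"
  shows "x_sub A (\<phi> U) = x_sub A (\<phi> V) \<longleftrightarrow> V = U \<or> V = I - U"
proof -
  have "x_sub A (\<phi> U) = x_sub A (\<phi> V) \<longleftrightarrow> \<phi> V = \<phi> U \<or> \<phi> V = \<phi> (I - U)"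
    using x_sub_eq_iff[of "\<phi> U" "\<phi> V"] assms frame_carrier frame_eq_zero_iff frame_eq_one_iff frame_compl
    by metis
  then show ?thesis using frame_eq_iff[OF assms(1)] assms(2,3) by (metis Diff_subset)
qed

lemma frame_x_sub_compl:
  assumes "frame A I \<phi>" "U \<subseteq> I" shows "x_sub A (\<phi> (I - U)) = x_sub A (\<phi> U)"
  using frame_compl[OF assms] x_sub_compl frame_carrier[OF assms] by simp

lemma triple_frame_iff:
  assumes \<phi>: "frame A I \<phi>" and "U \<subseteq> I" "V \<subseteq> I" "W \<subseteq> I"
  shows "triple (\<phi> U) (\<phi> V) (\<phi> W) \<longleftrightarrow> U \<noteq> {} \<and> V \<noteq> {} \<and> W \<noteq> {} \<and> U \<inter> V = {} \<and> W = I - (U \<union> V)"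
proof -
  have "oplus A (\<phi> U) (\<phi> V) = Some (compl A (\<phi> W)) \<longleftrightarrow> U \<inter> V = {} \<and> \<phi> (I - W) = \<phi> (U \<union> V)"
    using frame_oplus_iff[OF \<phi> assms(2,3)] frame_compl[OF \<phi> assms(4)] by simp
  also have "\<dots> \<longleftrightarrow> U \<inter> V = {} \<and> W = I - (U \<union> V)"
    using frame_eq_iff[OF \<phi>, of "I - W" "U \<union> V"] assms by auto
  finally show ?thesis
    using frame_eq_zero_iff[OF \<phi>] frame_carrier[OF \<phi>] assms by (auto simp: triple_def)
qed

lemma nontrivial_carrier:
  assumes "zero A = one A" "a \<in> carrier A" shows "a = zero A"
  using oplus_compl[OF assms(2)] oplus_eq_zero(1) assms(1) by metis

lemma bounds_in_BSub: assumes "zero A \<noteq> one A" shows "{zero A, one A} \<in> BSub A"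
proof -
  obtain \<phi> where \<phi>: "frame A {..<length [one A]} \<phi>"
    using list_frame[of "[one A]"] assms psum_single[OF one_closed] by auto
  have "Pow {..<length [one A]} = {{}, {..<length [one A]}}" by auto
  then have "\<phi> ` Pow {..<length [one A]} = {zero A, one A}"
    using frame_top[OF \<phi>] frame_empty[OF \<phi>] by simp
  then show ?thesis using frame_image_in_BSub[OF \<phi>] by simp
qed

lemma x_sub_in_BSub:
  assumes a: "a \<in> carrier A" "a \<noteq> zero A" "a \<noteq> one A" shows "x_sub A a \<in> BSub A"
proof -
  have "psum A [a, compl A a] = Some (one A)" using a compl_in oplus_zero oplus_compl by simp
  moreover have "zero A \<notin> set [a, compl A a]" using a compl_eq_zero[of a] by (metis empty_iff list.set(1) set_ConsD)
  ultimately obtain \<phi> where \<phi>: "frame A {..<length [a, compl A a]} \<phi>"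
    and s: "\<And>i. i < length [a, compl A a] \<Longrightarrow> \<phi> {i} = [a, compl A a] ! i"
    using list_frame by blast
  have I: "{..<length [a, compl A a]} = {0, 1}" by auto
  have "\<phi> ` Pow {0, 1} = {\<phi> {}, \<phi> {0}, \<phi> {1}, \<phi> {0, 1}}" by (auto simp: Pow_insert)
  moreover have "\<phi> {0} = a" "\<phi> {1} = compl A a" using s[of 0] s[of 1] by simp_all
  ultimately have "\<phi> ` Pow {0, 1} = x_sub A a"
    using frame_top[OF \<phi>] frame_empty[OF \<phi>] unfolding I x_sub_def by simp
  then show ?thesis using frame_image_in_BSub[OF \<phi>] I by simp
qed

lemma x_sub_subset: "subalgebra A X \<Longrightarrow> a \<in> X \<Longrightarrow> x_sub A a \<subseteq> X"
  unfolding subalgebra_def x_sub_def by blast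

lemma points_G_obj: "points (G_obj A) = x_sub A ` (carrier A - {zero A, one A})"
proof (intro set_eqI iffI)
  fix X assume "X \<in> points (G_obj A)"
  then obtain B where X: "X \<in> BSub A" and B: "B \<in> BSub A" "\<forall>Y\<in>BSub A. B \<subseteq> Y" "B \<subset> X"
    and no: "\<not> (\<exists>Y\<in>BSub A. B \<subset> Y \<and> Y \<subset> X)"
    by (auto simp: G_obj_def atoms_def)
  have XA: "X \<subseteq> carrier A" using BSub_subalgebra[OF X] by (simp add: subalgebra_def)
  have 01: "zero A \<noteq> one A"
  proof
    assume "zero A = one A"
    then have "X \<subseteq> {zero A}" using XA nontrivial_carrier by blast
    then show False using B(3) zero_in_BSub(1)[OF B(1)] by blast
  qed
  have B01: "B \<subseteq> {zero A, one A}" using bspec[OF B(2) bounds_in_BSub[OF 01]] .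
  moreover have "{zero A, one A} \<subseteq> B" using zero_in_BSub B(1) by blast
  ultimately obtain a where a: "a \<in> X" "a \<noteq> zero A" "a \<noteq> one A" using B(3) by blast
  have sub: "x_sub A a \<subseteq> X" using x_sub_subset BSub_subalgebra X a by blast
  have "x_sub A a \<in> BSub A" using x_sub_in_BSub a XA by blast
  moreover have "B \<subset> x_sub A a" using B01 a by (auto simp: x_sub_def)
  ultimately have "X = x_sub A a" using no sub by blast
  then show "X \<in> x_sub A ` (carrier A - {zero A, one A})" using a XA by blast
next
  fix X assume "X \<in> x_sub A ` (carrier A - {zero A, one A})"
  then obtain a where a: "a \<in> carrier A" "a \<noteq> zero A" "a \<noteq> one A" and X: "X = x_sub A a" by blast
  have 01: "zero A \<noteq> one A" using nontrivial_carrier a by blast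
  have "\<not> ({zero A, one A} \<subset> Y \<and> Y \<subset> X)" if "Y \<in> BSub A" for Y
  proof
    assume Y: "{zero A, one A} \<subset> Y \<and> Y \<subset> X"
    then obtain b where b: "b \<in> Y" "b = a \<or> b = compl A a" using X by (auto simp: x_sub_def)
    then have "x_sub A b = X" using X x_sub_compl[OF a(1)] by auto
    then show False using x_sub_subset[OF BSub_subalgebra[OF that] b(1)] Y by blast
  qed
  moreover have "{zero A, one A} \<subset> X" using a by (auto simp: X x_sub_def)
  moreover have "\<forall>Y\<in>BSub A. {zero A, one A} \<subseteq> Y" using zero_in_BSub by blast
  moreover have "X \<in> BSub A" using x_sub_in_BSub[OF a] X by simp
  ultimately have "X \<in> atoms (BSub A)"
    unfolding atoms_def using bounds_in_BSub[OF 01] by (intro CollectI conjI bexI[of _ "{zero A, one A}"]) auto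
  then show "X \<in> points (G_obj A)" by (simp add: G_obj_def)
qed

lemma x_sub_in_points: "a \<in> carrier A \<Longrightarrow> a \<noteq> zero A \<Longrightarrow> a \<noteq> one A \<Longrightarrow> x_sub A a \<in> points (G_obj A)"
  by (simp add: points_G_obj)

lemma triple_points:
  assumes "triple a b c"
  shows "x_sub A a \<in> points (G_obj A)" "x_sub A b \<in> points (G_obj A)" "x_sub A c \<in> points (G_obj A)"
  using x_sub_in_points triple_nontrivial[OF assms] triple_carrier[OF assms] by blast+

lemma mem_of_x_sub: "x_sub A a \<subseteq> X \<Longrightarrow> a \<in> X"
  by (simp add: x_sub_def)

definition pts :: "'a set \<Rightarrow> 'a set set" where
  "pts X = x_sub A ` (X - {zero A, one A})"

lemma pts_frame:
  assumes "frame A I \<phi>" shows "pts (\<phi> ` Pow I) = (\<lambda>U. x_sub A (\<phi> U)) ` (Pow I - {{}, I})"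
proof -
  have "\<phi> ` Pow I - {zero A, one A} = \<phi> ` (Pow I - {{}, I})"
  proof (intro set_eqI iffI)
    fix a assume "a \<in> \<phi> ` Pow I - {zero A, one A}"
    then show "a \<in> \<phi> ` (Pow I - {{}, I})" using frame_empty[OF assms] frame_top[OF assms] by auto
  next
    fix a assume "a \<in> \<phi> ` (Pow I - {{}, I})"
    then obtain U where "U \<subseteq> I" "U \<noteq> {}" "U \<noteq> I" "a = \<phi> U" by blast
    then show "a \<in> \<phi> ` Pow I - {zero A, one A}"
      using frame_eq_zero_iff[OF assms, of U] frame_eq_one_iff[OF assms, of U] by simp
  qed
  then show ?thesis by (simp add: pts_def image_image)
qed

lemma points_below_iff:
  assumes "X \<in> BSub A" shows "p \<in> points (G_obj A) \<and> p \<subseteq> X \<longleftrightarrow> p \<in> pts X"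
proof -
  have s: "subalgebra A X" by (rule BSub_subalgebra[OF assms])
  then have "X \<subseteq> carrier A" by (simp add: subalgebra_def)
  then show ?thesis
    unfolding points_G_obj pts_def using x_sub_subset[OF s] mem_of_x_sub by blast
qed

lemma mem_frame_of_x_sub:
  assumes \<phi>: "frame A I \<phi>" and "x_sub A a \<in> pts (\<phi> ` Pow I)" "a \<in> carrier A"
  obtains U where "U \<subseteq> I" "a = \<phi> U"
proof -
  obtain U where U: "U \<subseteq> I" "U \<noteq> {}" "U \<noteq> I" "x_sub A (\<phi> U) = x_sub A a"
    using assms(2) unfolding pts_frame[OF \<phi>] by auto
  then have "a = \<phi> U \<or> a = \<phi> (I - U)"
    using x_sub_eq_iff[of "\<phi> U" a] frame_carrier[OF \<phi>] frame_eq_zero_iff[OF \<phi>] frame_eq_one_iff[OF \<phi>]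
      frame_compl[OF \<phi>] assms(3) by metis
  then show ?thesis using that U(1) by blast
qed

text \<open>A Boolean subalgebra of height \<open>2\<close> has three atoms, and its elements come in three complementary
  pairs besides the bounds.\<close>

lemma lines_G_obj: "l \<in> lines (G_obj A) \<longleftrightarrow> (\<exists>a b c. triple a b c \<and> l = {x_sub A a, x_sub A b, x_sub A c})"
proof
  assume "l \<in> lines (G_obj A)"
  then obtain X where l: "l \<subseteq> points (G_obj A)" "card l = 3" "\<forall>p\<in>l. p \<subseteq> X" and X: "has_height (BSub A) X 2"
    by (auto simp: G_obj_def)
  obtain \<phi> where \<phi>: "frame A {..2::nat} \<phi>" "X = \<phi> ` Pow {..2}" using has_height_frame[OF X] by auto
  have I: "{..2::nat} = {0, 1, 2}" by auto
  let ?L = "{x_sub A (\<phi> {0}), x_sub A (\<phi> {1}), x_sub A (\<phi> {2})}"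
  have compls: "{0, 1, 2} - {0} = {1, 2::nat}" "{0, 1, 2} - {1} = {0, 2::nat}" "{0, 1, 2} - {2} = {0, 1::nat}" by auto
  have q: "x_sub A (\<phi> {1, 2}) = x_sub A (\<phi> {0})" "x_sub A (\<phi> {0, 2}) = x_sub A (\<phi> {1})"
    "x_sub A (\<phi> {0, 1}) = x_sub A (\<phi> {2})"
    using frame_x_sub_compl[OF \<phi>(1), of "{0}"] frame_x_sub_compl[OF \<phi>(1), of "{1}"]
      frame_x_sub_compl[OF \<phi>(1), of "{2}"] unfolding I compls by auto
  have "pts X \<subseteq> ?L"
    unfolding \<phi>(2) pts_frame[OF \<phi>(1)] unfolding I by (auto simp: Pow_insert q[simplified])
  moreover have XB: "X \<in> BSub A" using X by (simp add: has_height_def)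
  moreover have "l \<subseteq> pts X" using l(1,3) points_below_iff[OF XB] by (metis subsetD subsetI)
  ultimately have "l \<subseteq> ?L" by simp
  moreover have "card ?L \<le> 3" by (simp add: card_insert_if)
  ultimately have "l = ?L" using l(2) card_seteq[of ?L l] by simp
  moreover have "triple (\<phi> {0}) (\<phi> {1}) (\<phi> {2})"
    by (subst triple_frame_iff[OF \<phi>(1)]) (auto simp: I)
  ultimately show "\<exists>a b c. triple a b c \<and> l = {x_sub A a, x_sub A b, x_sub A c}" by blast
next
  assume "\<exists>a b c. triple a b c \<and> l = {x_sub A a, x_sub A b, x_sub A c}"
  then obtain a b c where t: "triple a b c" and l: "l = {x_sub A a, x_sub A b, x_sub A c}" by blast
  obtain \<phi> where \<phi>: "frame A {..<3::nat} \<phi>" and abc: "\<phi> {0} = a" "\<phi> {1} = b" "\<phi> {2} = c"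
    using triple_frame[OF t] by metis
  have X: "has_height (BSub A) (\<phi> ` Pow {..<3}) 2" using frame_has_height[OF \<phi>] by simp
  have s: "subalgebra A (\<phi> ` Pow {..<3})" using BSub_subalgebra frame_image_in_BSub[OF \<phi>] by blast
  have "a \<in> \<phi> ` Pow {..<3}" "b \<in> \<phi> ` Pow {..<3}" "c \<in> \<phi> ` Pow {..<3}" using abc by force+
  then have "\<forall>p\<in>l. p \<subseteq> \<phi> ` Pow {..<3}" using x_sub_subset[OF s] l by blast
  moreover have "card l = 3" using triple_x_sub_distinct[OF t] l by simp
  moreover have "l \<subseteq> points (G_obj A)" using triple_points[OF t] l by simp
  ultimately show "l \<in> lines (G_obj A)" using X unfolding G_obj_def by auto
qed

end

text \<open>The three summands of a line inside a plane are sums of the four atoms of the plane. Two of the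
  summands are single atoms, and the third is the sum of the remaining two atoms.\<close>

lemma nonempty_disjoint_card4:
  fixes U V W :: "nat set"
  assumes "U \<union> V \<union> W = {..<4}" "U \<inter> V = {}" "U \<inter> W = {}" "V \<inter> W = {}" "U \<noteq> {}" "V \<noteq> {}" "W \<noteq> {}"
  obtains k m where "k < 4" "m < 4" "k \<noteq> m" "U = {k} \<and> V = {m} \<or> U = {k} \<and> W = {m} \<or> V = {k} \<and> W = {m}"
proof -
  have fin: "finite U" "finite V" "finite W" using assms(1) by (auto intro: finite_subset[of _ "{..<4}"])
  have "card (U \<union> V \<union> W) = card U + card V + card W"
    using assms(2-4) fin by (subst card_Un_disjoint; auto simp: card_Un_disjoint)
  then have sum: "card U + card V + card W = 4" using assms(1) by simp
  have "card U \<noteq> 0" "card V \<noteq> 0" "card W \<noteq> 0" using assms(5-7) fin by auto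
  with sum consider "card U = 1" "card V = 1" | "card U = 1" "card W = 1" | "card V = 1" "card W = 1" by linarith
  then show ?thesis
  proof cases
    case 1
    then obtain k m where "U = {k}" "V = {m}" by (auto simp: card_1_singleton_iff)
    then show ?thesis using that[of k m] assms by blast
  next
    case 2
    then obtain k m where "U = {k}" "W = {m}" by (auto simp: card_1_singleton_iff)
    then show ?thesis using that[of k m] assms by blast
  next
    case 3
    then obtain k m where "V = {k}" "W = {m}" by (auto simp: card_1_singleton_iff)
    then show ?thesis using that[of k m] assms by blast
  qed
qed

context orthoalgebra
begin

context
  fixes \<phi> :: "nat set \<Rightarrow> 'a" and q
  assumes \<phi>: "frame A {..<4} \<phi>"
  defines "q \<equiv> \<lambda>U. x_sub A (\<phi> U)"
begin

lemma frame4_lessThan: "{..<4::nat} = {0, 1, 2, 3}"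
  by auto

lemma frame4_q_compl:
  "q {1, 2, 3} = q {0}" "q {0, 2, 3} = q {1}" "q {0, 1, 3} = q {2}" "q {0, 1, 2} = q {3}"
  "q {2, 3} = q {0, 1}" "q {1, 3} = q {0, 2}" "q {1, 2} = q {0, 3}"
proof -
  have *: "q V = q U" if "U \<subseteq> {0, 1, 2, 3}" "V = {0, 1, 2, 3} - U" for U V
    using frame_x_sub_compl[OF \<phi>, of U] that by (simp add: q_def frame4_lessThan)
  show "q {1, 2, 3} = q {0}" "q {0, 2, 3} = q {1}" "q {0, 1, 3} = q {2}" "q {0, 1, 2} = q {3}"
    "q {2, 3} = q {0, 1}" "q {1, 3} = q {0, 2}" "q {1, 2} = q {0, 3}"
    by (rule *; auto)+
qed

text \<open>Two sets give the same point only if they are equal or complementary, and then they separate the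
  same pairs of indices. The seven subsets below separate \<open>0\<close> from different sets of indices.\<close>

lemma frame4_distinct: "distinct [q {0}, q {1}, q {2}, q {3}, q {0, 1}, q {0, 2}, q {0, 3}]"
proof -
  let ?xs = "[{0}, {1}, {2}, {3}, {0, 1}, {0, 2}, {0, 3}] :: nat set list"
  define sep where "sep U = ((0::nat) \<in> U \<longleftrightarrow> 1 \<in> U, 0 \<in> U \<longleftrightarrow> 2 \<in> U, 0 \<in> U \<longleftrightarrow> 3 \<in> U)" for U
  have sep: "sep U = sep V" if UV: "U \<in> set ?xs" "V \<in> set ?xs" "q U = q V" for U V
  proof -
    have "U \<subseteq> {..<4}" "V \<subseteq> {..<4}" "U \<noteq> {}" using UV by auto
    moreover have "\<not> {1, 2, 3} \<subseteq> U" using UV(1) by auto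
    then have "U \<noteq> {..<4}" by auto
    ultimately have "V = U \<or> V = {..<4} - U"
      using frame_x_sub_eq_iff[OF \<phi>, of U V] UV(3) by (simp add: q_def)
    then show ?thesis by (auto simp: sep_def)
  qed
  have "distinct (map sep ?xs)" by (simp add: sep_def)
  then have "distinct ?xs" "inj_on sep (set ?xs)" unfolding distinct_map by blast+
  moreover from this(2) have "inj_on q (set ?xs)" using sep unfolding inj_on_def by blast
  ultimately have "distinct (map q ?xs)" unfolding distinct_map by blast
  then show ?thesis by simp
qed

lemma frame4_pts: "pts (\<phi> ` Pow {..<4}) = {q {0}, q {1}, q {2}, q {3}, q {0, 1}, q {0, 2}, q {0, 3}}"
proof
  show "pts (\<phi> ` Pow {..<4}) \<subseteq> {q {0}, q {1}, q {2}, q {3}, q {0, 1}, q {0, 2}, q {0, 3}}"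
    unfolding pts_frame[OF \<phi>] q_def[symmetric] unfolding frame4_lessThan
    using frame4_q_compl by (auto simp: Pow_insert)
  have "q U \<in> pts (\<phi> ` Pow {..<4})" if "U \<subseteq> {..<4}" "U \<noteq> {}" "U \<noteq> {..<4}" for U
    unfolding pts_frame[OF \<phi>] q_def using that by blast
  note * = this
  have **: "q U \<in> pts (\<phi> ` Pow {..<4})" if "U \<subseteq> {..<4}" "i \<in> U" "j < 4" "j \<notin> U" for U i j
    by (rule *) (use that in auto)
  show "{q {0}, q {1}, q {2}, q {3}, q {0, 1}, q {0, 2}, q {0, 3}} \<subseteq> pts (\<phi> ` Pow {..<4})"
    using **[of "{0}" 0 1] **[of "{1}" 1 0] **[of "{2}" 2 0] **[of "{3}" 3 0] **[of "{0, 1}" 0 2]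
      **[of "{0, 2}" 0 1] **[of "{0, 3}" 0 1] by simp
qed

lemma frame4_line:
  assumes "k < 4" "m < 4" "k \<noteq> m" shows "{q {k}, q {m}, q {k, m}} \<in> lines (G_obj A)"
proof -
  have "{k, m} \<noteq> {..<4}"
  proof
    assume "{k, m} = {..<4}"
    then have "card {k, m} = 4" by simp
    then show False using assms by simp
  qed
  then have "triple (\<phi> {k}) (\<phi> {m}) (\<phi> ({..<4} - {k, m}))"
    using assms by (subst triple_frame_iff[OF \<phi>]) auto
  moreover have "q ({..<4} - {k, m}) = q {k, m}"
    using frame_x_sub_compl[OF \<phi>, of "{k, m}"] assms by (simp add: q_def)
  ultimately show ?thesis unfolding lines_G_obj q_def by metis
qed

lemma frame4_line_cases:
  assumes l: "l \<in> lines (G_obj A)" "l \<subseteq> pts (\<phi> ` Pow {..<4})"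
  obtains k m where "k < 4" "m < 4" "k \<noteq> m" "l = {q {k}, q {m}, q {k, m}}"
proof -
  obtain a b c where t: "triple a b c" and l': "l = {x_sub A a, x_sub A b, x_sub A c}"
    using l by (auto simp: lines_G_obj)
  obtain U where U: "U \<subseteq> {..<4}" "a = \<phi> U" using mem_frame_of_x_sub[OF \<phi>, of a] l l' triple_carrier[OF t] by auto
  obtain V where V: "V \<subseteq> {..<4}" "b = \<phi> V" using mem_frame_of_x_sub[OF \<phi>, of b] l l' triple_carrier[OF t] by auto
  obtain W where W: "W \<subseteq> {..<4}" "c = \<phi> W" using mem_frame_of_x_sub[OF \<phi>, of c] l l' triple_carrier[OF t] by auto
  have p: "U \<noteq> {}" "V \<noteq> {}" "W \<noteq> {}" "U \<inter> V = {}" "W = {..<4} - (U \<union> V)"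
    using t U V W triple_frame_iff[OF \<phi>] by auto
  have p': "U \<union> V \<union> W = {..<4}" "U \<inter> W = {}" "V \<inter> W = {}" using p U V by auto
  have l'': "l = {q U, q V, q W}" using l' U V W by (simp add: q_def)
  have qc: "q ({..<4} - S) = q S" if "S \<subseteq> {..<4}" for S
    using frame_x_sub_compl[OF \<phi> that] by (simp add: q_def)
  obtain k m where km: "k < 4" "m < 4" "k \<noteq> m"
    "U = {k} \<and> V = {m} \<or> U = {k} \<and> W = {m} \<or> V = {k} \<and> W = {m}"
    using nonempty_disjoint_card4[OF p'(1) p(4) p'(2,3) p(1-3)] by blast
  then have "{k, m} \<subseteq> {..<4}" by auto
  from qc[OF this] have kq: "q ({..<4} - {k, m}) = q {k, m}" .
  from km(4) have "l = {q {k}, q {m}, q {k, m}}"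
  proof (elim disjE conjE)
    assume "U = {k}" "V = {m}"
    moreover from this have "W = {..<4} - {k, m}" using p(5) by auto
    ultimately show ?thesis using l'' kq by simp
  next
    assume "U = {k}" "W = {m}"
    moreover from this have "V = {..<4} - {k, m}" using p' p(4) by auto
    ultimately show ?thesis using l'' kq by auto
  next
    assume "V = {k}" "W = {m}"
    moreover from this have "U = {..<4} - {k, m}" using p' p(4) by auto
    ultimately show ?thesis using l'' kq by auto
  qed
  then show ?thesis using that km by blast
qed

text \<open>The four atoms give the corner points, and the three ways to divide them into two pairs give the
  edge points.\<close>

lemma frame4_labelling:
  "labelling (G_obj A) (pts (\<phi> ` Pow {..<4})) (q {0}) (q {1}) (q {2}) (q {3}) (q {0, 1}) (q {0, 2}) (q {0, 3})"
proof -
  let ?t = "pts (\<phi> ` Pow {..<4})"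
  let ?L = "{{q {0}, q {1}, q {0, 1}}, {q {2}, q {3}, q {0, 1}}, {q {0}, q {2}, q {0, 2}}, {q {1}, q {3}, q {0, 2}},
     {q {0}, q {3}, q {0, 3}}, {q {1}, q {2}, q {0, 3}}}"
  have cases: "l \<in> ?L" if l: "l \<in> lines (G_obj A)" "l \<subseteq> ?t" for l
  proof -
    obtain k m where km: "k < 4" "m < 4" "k \<noteq> m" "l = {q {k}, q {m}, q {k, m}}"
      using frame4_line_cases[OF l] by blast
    have "k \<in> {0, 1, 2, 3}" "m \<in> {0, 1, 2, 3}" using km by auto
    then show ?thesis
      using km(3,4) by (elim insertE emptyE) (simp_all add: frame4_q_compl[unfolded One_nat_def] insert_commute)
  qed
  have "{l \<in> lines (G_obj A). l \<subseteq> ?t} \<subseteq> ?L"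
  proof
    fix l assume "l \<in> {l \<in> lines (G_obj A). l \<subseteq> ?t}"
    then have "l \<in> lines (G_obj A)" "l \<subseteq> ?t" by (simp_all only: mem_Collect_eq)
    then show "l \<in> ?L" by (rule cases)
  qed
  moreover have "?L \<subseteq> {l \<in> lines (G_obj A). l \<subseteq> ?t}"
  proof -
    have "q {k, m} = e \<Longrightarrow> k < 4 \<Longrightarrow> m < 4 \<Longrightarrow> k \<noteq> m \<Longrightarrow> {q {k}, q {m}, e} \<in> lines (G_obj A)" for k m e
      using frame4_line[of k m] by blast
    note ln = this[OF refl, of 0 1] this[OF frame4_q_compl(5)] this[OF refl, of 0 2] this[OF frame4_q_compl(6)]
      this[OF refl, of 0 3] this[OF frame4_q_compl(7)]
    have "?L \<subseteq> lines (G_obj A)" using ln by simp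
    moreover have "\<forall>l\<in>?L. l \<subseteq> ?t" unfolding frame4_pts by simp
    moreover have "M \<subseteq> {l \<in> X. l \<subseteq> t}" if "M \<subseteq> X" "\<forall>l\<in>M. l \<subseteq> t" for M X and t :: "'a set set"
      using that by blast
    ultimately show ?thesis by presburger
  qed
  ultimately have "{l \<in> lines (G_obj A). l \<subseteq> ?t} = ?L" by (rule equalityI)
  then show ?thesis unfolding labelling_def using frame4_distinct frame4_pts by (intro conjI)
qed

end

lemma planes_G_obj: "t \<in> planes (G_obj A) \<longleftrightarrow> (\<exists>\<phi>. frame A {..<4::nat} \<phi> \<and> t = pts (\<phi> ` Pow {..<4}))" (is "_ \<longleftrightarrow> ?R")
proof
  have I: "{..3::nat} = {..<4}" by auto
  have card: "card (pts (\<phi> ` Pow {..<4})) = 7" if \<phi>: "frame A {..<4::nat} \<phi>" for \<phi>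
    using distinct_card[OF frame4_distinct[OF \<phi>]] unfolding frame4_pts[OF \<phi>] by simp
  {
    assume "t \<in> planes (G_obj A)"
    then obtain X where t: "t \<subseteq> points (G_obj A)" "card t = 7" "\<forall>p\<in>t. p \<subseteq> X" and X: "has_height (BSub A) X 3"
      by (auto simp: G_obj_def)
    have XB: "X \<in> BSub A" using X by (simp add: has_height_def)
    obtain \<phi> where \<phi>: "frame A {..<4::nat} \<phi>" "X = \<phi> ` Pow {..<4}" using has_height_frame[OF X] I by auto
    have "t \<subseteq> pts X" using t(1,3) points_below_iff[OF XB] by (metis subsetD subsetI)
    moreover have "finite (pts X)" using card[OF \<phi>(1)] \<phi>(2) card.infinite by fastforce
    ultimately have "t = pts X" using card[OF \<phi>(1)] t(2) \<phi>(2) card_subset_eq by metis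
    then show ?R using \<phi> by blast
  next
    assume ?R
    then obtain \<phi> where \<phi>: "frame A {..<4::nat} \<phi>" and t: "t = pts (\<phi> ` Pow {..<4})" by blast
    have X: "has_height (BSub A) (\<phi> ` Pow {..<4}) 3" using frame_has_height[OF \<phi>] by simp
    have "t \<subseteq> points (G_obj A)" "\<forall>p\<in>t. p \<subseteq> \<phi> ` Pow {..<4}"
      using points_below_iff[OF frame_image_in_BSub[OF \<phi>]] t by blast+
    then show "t \<in> planes (G_obj A)" using card[OF \<phi>] t X unfolding G_obj_def by auto
  }
qed

lemma hypergraph_G_obj: "hypergraph (G_obj A)"
  unfolding hypergraph_def
proof (intro conjI ballI)
  fix t assume t: "t \<in> planes (G_obj A)"
  then show "\<exists>c1 c2 c3 c4 e1 e2 e3. labelling (G_obj A) t c1 c2 c3 c4 e1 e2 e3"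
    using planes_G_obj frame4_labelling by metis
qed (auto simp: G_obj_def)

end

section \<open>Corners and edges of planes\<close>

text \<open>Transpositions of corners carry any corner, and any edge point, to the first place. So only the
  lines through one point of each kind have to be counted.\<close>

lemma labelling_swap:
  assumes "labelling H t c1 c2 c3 c4 e1 e2 e3"
  shows "labelling H t c2 c1 c3 c4 e1 e3 e2" "labelling H t c1 c3 c2 c4 e2 e1 e3" "labelling H t c1 c2 c4 c3 e1 e3 e2"
proof -
  have d: "distinct [c1, c2, c3, c4, e1, e2, e3]" and t: "t = {c1, c2, c3, c4, e1, e2, e3}" and L: "{l \<in> lines H. l \<subseteq> t} =
       {{c1, c2, e1}, {c3, c4, e1}, {c1, c3, e2}, {c2, c4, e2}, {c1, c4, e3}, {c2, c3, e3}}"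
    using assms by (auto simp: labelling_def)
  show "labelling H t c2 c1 c3 c4 e1 e3 e2"
    unfolding labelling_def L by (intro conjI; (simp only: t insert_commute; fail | use d in auto))
  show "labelling H t c1 c3 c2 c4 e2 e1 e3"
    unfolding labelling_def L by (intro conjI; (simp only: t insert_commute; fail | use d in auto))
  show "labelling H t c1 c2 c4 c3 e1 e3 e2"
    unfolding labelling_def L by (intro conjI; (simp only: t insert_commute; fail | use d in auto))
qed

lemma labelling_card_first:
  assumes "labelling H t c1 c2 c3 c4 e1 e2 e3"
  shows "card {l \<in> lines H. l \<subseteq> t \<and> c1 \<in> l} = 3" "card {l \<in> lines H. l \<subseteq> t \<and> e1 \<in> l} = 2"
proof -
  have d: "distinct [c1, c2, c3, c4, e1, e2, e3]" and L: "{l \<in> lines H. l \<subseteq> t} =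
       {{c1, c2, e1}, {c3, c4, e1}, {c1, c3, e2}, {c2, c4, e2}, {c1, c4, e3}, {c2, c3, e3}}"
    using assms by (auto simp: labelling_def)
  have *: "{l \<in> lines H. l \<subseteq> t \<and> p \<in> l} = {l \<in> {l \<in> lines H. l \<subseteq> t}. p \<in> l}" for p by auto
  have "{l \<in> lines H. l \<subseteq> t \<and> c1 \<in> l} = {{c1, c2, e1}, {c1, c3, e2}, {c1, c4, e3}}"
    unfolding * L using d by auto
  moreover have "c2 \<in> {c1, c2, e1} - {c1, c3, e2}" "c2 \<in> {c1, c2, e1} - {c1, c4, e3}" "c3 \<in> {c1, c3, e2} - {c1, c4, e3}"
    using d by auto
  then have "{c1, c2, e1} \<noteq> {c1, c3, e2}" "{c1, c2, e1} \<noteq> {c1, c4, e3}" "{c1, c3, e2} \<noteq> {c1, c4, e3}"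
    by (metis Diff_cancel empty_iff)+
  moreover have "card {X, Y, Z} = 3" if "X \<noteq> Y" "X \<noteq> Z" "Y \<noteq> Z" for X Y Z :: "'a set"
    using that by simp
  ultimately show "card {l \<in> lines H. l \<subseteq> t \<and> c1 \<in> l} = 3" by presburger
  have "{l \<in> lines H. l \<subseteq> t \<and> e1 \<in> l} = {{c1, c2, e1}, {c3, c4, e1}}"
    unfolding * L using d by auto
  moreover have "c1 \<in> {c1, c2, e1} - {c3, c4, e1}" using d by auto
  then have "{c1, c2, e1} \<noteq> {c3, c4, e1}" by (metis Diff_cancel empty_iff)
  ultimately show "card {l \<in> lines H. l \<subseteq> t \<and> e1 \<in> l} = 2" by simp
qed

text \<open>The number of lines of the plane through a point tells corners from edges, so the distinction
  does not depend on the labelling.\<close>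

lemma labelling_card:
  assumes "labelling H t c1 c2 c3 c4 e1 e2 e3"
  shows "p \<in> {c1, c2, c3, c4} \<Longrightarrow> card {l \<in> lines H. l \<subseteq> t \<and> p \<in> l} = 3"
    and "p \<in> {e1, e2, e3} \<Longrightarrow> card {l \<in> lines H. l \<subseteq> t \<and> p \<in> l} = 2"
  using labelling_card_first[OF assms] labelling_card_first[OF labelling_swap(1)[OF assms]]
    labelling_card_first[OF labelling_swap(1)[OF labelling_swap(2)[OF assms]]]
    labelling_card_first[OF labelling_swap(1)[OF labelling_swap(2)[OF labelling_swap(3)[OF assms]]]]
    labelling_card_first[OF labelling_swap(2)[OF assms]]
    labelling_card_first[OF labelling_swap(2)[OF labelling_swap(3)[OF assms]]]
  by blast+

lemma labelling_edge_point_iff: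
  assumes "labelling H t c1 c2 c3 c4 e1 e2 e3"
  shows "edge_point H t p \<longleftrightarrow> p \<in> {e1, e2, e3}"
proof
  assume "edge_point H t p"
  then obtain d1 d2 d3 d4 f1 f2 f3 where l: "labelling H t d1 d2 d3 d4 f1 f2 f3" and p: "p \<in> {f1, f2, f3}"
    unfolding edge_point_def by blast
  have "p \<notin> {c1, c2, c3, c4}"
    using labelling_card(2)[OF l p] labelling_card(1)[OF assms, of p] by auto
  moreover have "t = {c1, c2, c3, c4, e1, e2, e3}" "p \<in> t"
    using assms l p by (auto simp: labelling_def)
  ultimately show "p \<in> {e1, e2, e3}" by blast
next
  assume "p \<in> {e1, e2, e3}"
  with assms show "edge_point H t p" unfolding edge_point_def by metis
qed

lemma labelling_transport:
  assumes iso: "maps_plane_iso H K \<alpha> t t'" and lab: "labelling H t c1 c2 c3 c4 e1 e2 e3"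
  defines "f \<equiv> the \<circ> \<alpha>"
  shows "labelling K t' (f c1) (f c2) (f c3) (f c4) (f e1) (f e2) (f e3)"
proof -
  have f: "inj_on f t" "f ` t = t'" and ln: "\<And>l. l \<subseteq> t \<Longrightarrow> l \<in> lines H \<longleftrightarrow> f ` l \<in> lines K"
    using iso by (auto simp: maps_plane_iso_def bij_betw_def f_def)
  have d: "distinct [c1, c2, c3, c4, e1, e2, e3]" and t: "t = {c1, c2, c3, c4, e1, e2, e3}" and L: "{l \<in> lines H. l \<subseteq> t} =
       {{c1, c2, e1}, {c3, c4, e1}, {c1, c3, e2}, {c2, c4, e2}, {c1, c4, e3}, {c2, c3, e3}}"
    using lab by (auto simp: labelling_def)
  have "{l \<in> lines K. l \<subseteq> t'} = (`) f ` {l \<in> lines H. l \<subseteq> t}"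
  proof (intro set_eqI iffI)
    fix l assume l: "l \<in> {l \<in> lines K. l \<subseteq> t'}"
    then obtain l0 where "l0 \<subseteq> t" "l = f ` l0" using f(2) by (metis (no_types, lifting) mem_Collect_eq subset_imageE)
    then show "l \<in> (`) f ` {l \<in> lines H. l \<subseteq> t}" using ln l by blast
  next
    fix l assume "l \<in> (`) f ` {l \<in> lines H. l \<subseteq> t}"
    then show "l \<in> {l \<in> lines K. l \<subseteq> t'}" using ln f(2) by auto
  qed
  moreover have "distinct (map f [c1, c2, c3, c4, e1, e2, e3])"
    using d f(1) t by (subst distinct_map) (simp add: insert_commute)
  ultimately show ?thesis unfolding labelling_def using f(2) L t by auto
qed

lemma maps_plane_iso_labelling:
  assumes H: "labelling H t c1 c2 c3 c4 e1 e2 e3" and dom: "t \<subseteq> dom \<alpha>"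
  defines "f \<equiv> the \<circ> \<alpha>"
  assumes K: "labelling K t' (f c1) (f c2) (f c3) (f c4) (f e1) (f e2) (f e3)"
  shows "maps_plane_iso H K \<alpha> t t'"
proof -
  have t: "t = {c1, c2, c3, c4, e1, e2, e3}" and L: "{l \<in> lines H. l \<subseteq> t} =
       {{c1, c2, e1}, {c3, c4, e1}, {c1, c3, e2}, {c2, c4, e2}, {c1, c4, e3}, {c2, c3, e3}}"
    using H by (auto simp: labelling_def)
  have t': "t' = f ` t" and L': "{l \<in> lines K. l \<subseteq> t'} = (`) f `
       {{c1, c2, e1}, {c3, c4, e1}, {c1, c3, e2}, {c2, c4, e2}, {c1, c4, e3}, {c2, c3, e3}}"
    using K t by (auto simp: labelling_def)
  have "card t' = 7" "finite t" "card t \<le> 7"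
    using K distinct_card[of "[f c1, f c2, f c3, f c4, f e1, f e2, f e3]"] t H
      distinct_card[of "[c1, c2, c3, c4, e1, e2, e3]"] by (auto simp: labelling_def)
  then have inj: "inj_on f t" using t' by (metis card_image_le eq_card_imp_inj_on le_antisym)
  have "l \<in> lines H \<longleftrightarrow> f ` l \<in> lines K" if "l \<subseteq> t" for l
  proof
    assume "l \<in> lines H"
    then have "l \<in> {l \<in> lines H. l \<subseteq> t}" using that by simp
    then have "f ` l \<in> {l \<in> lines K. l \<subseteq> t'}" unfolding L L' by (rule imageI)
    then show "f ` l \<in> lines K" by simp
  next
    assume "f ` l \<in> lines K"
    then have "f ` l \<in> {l \<in> lines K. l \<subseteq> t'}" using that t' by auto
    then obtain l0 where "l0 \<in> {l \<in> lines H. l \<subseteq> t}" "f ` l = f ` l0" unfolding L L' by (rule imageE)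
    then show "l \<in> lines H" using inj_on_image_eq_iff[OF inj that] by auto
  qed
  then show ?thesis unfolding maps_plane_iso_def using dom inj t' by (simp add: bij_betw_def f_def)
qed

lemma edge_point_iso:
  assumes iso: "maps_plane_iso H K \<alpha> t t'" and H: "hypergraph H" "t \<in> planes H" and p: "p \<in> t"
  shows "edge_point H t p \<longleftrightarrow> edge_point K t' (the (\<alpha> p))"
proof -
  obtain c1 c2 c3 c4 e1 e2 e3 where lab: "labelling H t c1 c2 c3 c4 e1 e2 e3"
    using H(1)[unfolded hypergraph_def, THEN conjunct2] H(2) by metis
  let ?f = "the \<circ> \<alpha>"
  have inj: "inj_on ?f t" using iso by (simp add: maps_plane_iso_def bij_betw_def)
  have "{e1, e2, e3} \<subseteq> t" using lab by (auto simp: labelling_def)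
  then have "p \<in> {e1, e2, e3} \<longleftrightarrow> ?f p \<in> ?f ` {e1, e2, e3}"
    using inj_on_image_mem_iff[OF inj p] by blast
  then show ?thesis
    using labelling_edge_point_iff[OF lab, of p] labelling_edge_point_iff[OF labelling_transport[OF iso lab], of "the (\<alpha> p)"]
    by simp
qed

section \<open>Directions of lines at a common point\<close>

context orthoalgebra
begin

lemma line_through:
  assumes "l \<in> lines (G_obj A)" "p \<in> l"
  obtains a b c where "triple a b c" "p = x_sub A a" "l = {x_sub A a, x_sub A b, x_sub A c}"
proof -
  obtain a b c where t: "triple a b c" and l: "l = {x_sub A a, x_sub A b, x_sub A c}"
    using assms(1) lines_G_obj by auto
  consider "p = x_sub A a" | "p = x_sub A b" | "p = x_sub A c" using assms(2) l by auto
  then show ?thesis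
  proof cases
    case 1 then show ?thesis using that t l by blast
  next
    case 2
    have "l = {x_sub A b, x_sub A c, x_sub A a}" using l by auto
    with 2 show ?thesis using that triple_rotate[OF t] by blast
  next
    case 3
    have "l = {x_sub A c, x_sub A a, x_sub A b}" using l by auto
    with 3 show ?thesis using that triple_rotate[OF triple_rotate[OF t]] by blast
  qed
qed

lemma line_ordered:
  assumes "{P, Q, R} \<in> lines (G_obj A)" "distinct [P, Q, R]"
  obtains a b c where "triple a b c" "P = x_sub A a" "Q = x_sub A b" "R = x_sub A c"
proof -
  obtain a b c where t: "triple a b c" and P: "P = x_sub A a" and l: "{P, Q, R} = {x_sub A a, x_sub A b, x_sub A c}"
    using line_through[OF assms(1), of P] by blast
  have "{Q, R} = {P, Q, R} - {P}" using assms(2) by auto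
  also have "\<dots> = {x_sub A a, x_sub A b, x_sub A c} - {x_sub A a}" by (subst l) (simp only: P)
  also have "\<dots> = {x_sub A b, x_sub A c}" using triple_x_sub_distinct[OF t] by auto
  finally consider "Q = x_sub A b" "R = x_sub A c" | "Q = x_sub A c" "R = x_sub A b"
    by (auto simp: doubleton_eq_iff)
  then show ?thesis
  proof cases
    case 1 then show ?thesis using that t P by blast
  next
    case 2
    have "triple a c b" using triple_swap[OF triple_rotate[OF triple_rotate[OF t]]] .
    then show ?thesis using that 2 P by blast
  qed
qed

lemma frame_subset_subalgebra:
  assumes \<phi>: "frame A I \<phi>" and I: "finite I" and X: "subalgebra A X" "\<And>i. i \<in> I \<Longrightarrow> \<phi> {i} \<in> X"
  shows "\<phi> ` Pow I \<subseteq> X"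
proof -
  have "\<phi> U \<in> X" if "finite U" "U \<subseteq> I" for U
    using that
  proof (induction U)
    case empty
    then show ?case using frame_empty[OF \<phi>] X(1) by (simp add: subalgebra_def)
  next
    case (insert i U)
    then have "oplus A (\<phi> {i}) (\<phi> U) = Some (\<phi> (insert i U))"
      using frame_oplus[OF \<phi>, of "{i}" U] by simp
    moreover have "\<phi> {i} \<in> X" "\<phi> U \<in> X" using insert X(2) by auto
    ultimately show ?case using X(1) unfolding subalgebra_def by blast
  qed
  then show ?thesis using I finite_subset by blast
qed

text \<open>If \<open>u\<close> is a summand on one line and \<open>u'\<close> on the other, then \<open>u\<close> splits further, and the four
  remaining summands of the two lines together make up the unit. They are the atoms of the only
  plane containing both lines.\<close>

lemma opposite_lines_plane:
  assumes t: "triple u v w" "triple (compl A u) p r"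
  obtains t where "t \<in> planes (G_obj A)" "{x_sub A u, x_sub A v, x_sub A w} \<subseteq> t"
    "{x_sub A u, x_sub A p, x_sub A r} \<subseteq> t" "edge_point (G_obj A) t (x_sub A u)"
    "{x_sub A u, x_sub A v, x_sub A w} \<inter> {x_sub A u, x_sub A p, x_sub A r} = {x_sub A u}"
    "\<And>t'. \<lbrakk>t' \<in> planes (G_obj A); {x_sub A u, x_sub A v, x_sub A w} \<subseteq> t';
       {x_sub A u, x_sub A p, x_sub A r} \<subseteq> t'\<rbrakk> \<Longrightarrow> t' = t"
proof -
  note cr = triple_carrier[OF t(1)] triple_carrier[OF t(2)]
  have vw: "oplus A v w = Some (compl A u)" using triple_rotate[OF t(1)] by (simp add: triple_def)
  have pr: "oplus A p r = Some u"
    using triple_rotate[OF t(2)] compl_compl[of u] cr by (simp add: triple_def)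
  have ru: "oplus A r (compl A u) = Some (compl A p)"
    using triple_rotate[OF triple_rotate[OF t(2)]] by (simp add: triple_def)
  have "psum A [p, r, v, w] = Some (one A)" using vw ru oplus_compl[of p] oplus_zero[of w] cr by simp
  moreover have "zero A \<notin> set [p, r, v, w]" using t by (auto simp: triple_def)
  ultimately obtain \<phi> where \<phi>': "frame A {..<length [p, r, v, w]} \<phi>"
    and s: "\<And>i. i < length [p, r, v, w] \<Longrightarrow> \<phi> {i} = [p, r, v, w] ! i"
    using list_frame by blast
  have "length [p, r, v, w] = 4" by simp
  then have \<phi>: "frame A {..<4} \<phi>" using \<phi>' by metis
  have sing: "\<phi> {0} = p" "\<phi> {1} = r" "\<phi> {2} = v" "\<phi> {3} = w"
    using s[of 0] s[of 1] s[of 2] s[of 3] by simp_all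
  have u: "\<phi> {0, 1} = u"
  proof -
    have "oplus A (\<phi> {0}) (\<phi> {1}) = Some (\<phi> {0, 1})" using frame_oplus[OF \<phi>, of "{0}" "{1}"] by (simp add: insert_commute)
    then show ?thesis using pr sing by simp
  qed
  let ?t = "pts (\<phi> ` Pow {..<4})"
  have pl: "?t \<in> planes (G_obj A)" using planes_G_obj \<phi> by blast
  have tt: "?t = {x_sub A p, x_sub A r, x_sub A v, x_sub A w, x_sub A u, x_sub A (\<phi> {0, 2}), x_sub A (\<phi> {0, 3})}"
    using frame4_pts[OF \<phi>] unfolding sing u .
  have d: "distinct [x_sub A p, x_sub A r, x_sub A v, x_sub A w, x_sub A u, x_sub A (\<phi> {0, 2}), x_sub A (\<phi> {0, 3})]"
    using frame4_distinct[OF \<phi>] unfolding sing u .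
  have edge: "edge_point (G_obj A) ?t (x_sub A u)"
    using labelling_edge_point_iff[OF frame4_labelling[OF \<phi>]] u by simp
  have unique: "t' = ?t" if t': "t' \<in> planes (G_obj A)" "{x_sub A u, x_sub A v, x_sub A w} \<subseteq> t'"
       "{x_sub A u, x_sub A p, x_sub A r} \<subseteq> t'" for t'
  proof -
    obtain \<psi> where \<psi>: "frame A {..<4::nat} \<psi>" "t' = pts (\<psi> ` Pow {..<4})" using iffD1[OF planes_G_obj t'(1)] by blast
    have mem: "a \<in> \<psi> ` Pow {..<4}" if "x_sub A a \<in> t'" "a \<in> carrier A" for a
      using mem_frame_of_x_sub[OF \<psi>(1), of a] that \<psi>(2) by blast
    have "p \<in> \<psi> ` Pow {..<4}" "r \<in> \<psi> ` Pow {..<4}" "v \<in> \<psi> ` Pow {..<4}" "w \<in> \<psi> ` Pow {..<4}"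
      using mem t' cr by blast+
    then have "\<phi> {i} \<in> \<psi> ` Pow {..<4}" if "i \<in> {0, 1, 2, 3}" for i
      using that sing by (elim insertE emptyE) simp_all
    moreover have "{..<4::nat} = {0, 1, 2, 3}" by auto
    ultimately have "\<phi> ` Pow {..<4} \<subseteq> \<psi> ` Pow {..<4}"
      by (intro frame_subset_subalgebra[OF \<phi>] BSub_subalgebra frame_image_in_BSub[OF \<psi>(1)]) auto
    moreover have "card (\<phi> ` Pow {..<4}) = card (\<psi> ` Pow {..<4})"
      using card_frame_image[OF \<phi>] card_frame_image[OF \<psi>(1)] by simp
    ultimately have "\<phi> ` Pow {..<4} = \<psi> ` Pow {..<4}" by (intro card_subset_eq) auto
    then show ?thesis using \<psi>(2) by simp
  qed
  show ?thesis
  proof (rule that[OF pl])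
    show "{x_sub A u, x_sub A v, x_sub A w} \<subseteq> ?t" "{x_sub A u, x_sub A p, x_sub A r} \<subseteq> ?t" unfolding tt by simp_all
    show "{x_sub A u, x_sub A v, x_sub A w} \<inter> {x_sub A u, x_sub A p, x_sub A r} = {x_sub A u}" using d by auto
  qed (rule edge, rule unique)
qed

text \<open>If \<open>x\<^sub>a\<close> is an edge point, then \<open>a\<close> is the sum of two atoms of the plane, and the other two points of
  a line arise from splitting the remaining two atoms, which is possible in only one way. So distinct
  lines of a plane that meet in an edge point have opposite directions there.\<close>

lemma same_direction_lines_eq:
  assumes t: "triple a b c" "triple a d e" and pl: "t \<in> planes (G_obj A)"
    and sub: "{x_sub A a, x_sub A b, x_sub A c} \<subseteq> t" "{x_sub A a, x_sub A d, x_sub A e} \<subseteq> t"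
    and edge: "edge_point (G_obj A) t (x_sub A a)"
  shows "{x_sub A b, x_sub A c} = {x_sub A d, x_sub A e}"
proof -
  note cr = triple_carrier[OF t(1)] triple_carrier[OF t(2)]
  obtain \<phi> where \<phi>: "frame A {..<4::nat} \<phi>" and tt: "t = pts (\<phi> ` Pow {..<4})" using pl planes_G_obj by blast
  have mem: "\<exists>U. U \<subseteq> {..<4} \<and> z = \<phi> U" if "x_sub A z \<in> t" "z \<in> carrier A" for z
    by (rule mem_frame_of_x_sub[OF \<phi> that(1)[unfolded tt] that(2)]) blast
  obtain U where U: "U \<subseteq> {..<4}" "a = \<phi> U" using mem[of a] sub cr by auto
  obtain V where V: "V \<subseteq> {..<4}" "b = \<phi> V" using mem[of b] sub cr by auto
  obtain W where W: "W \<subseteq> {..<4}" "c = \<phi> W" using mem[of c] sub cr by auto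
  obtain V' where V': "V' \<subseteq> {..<4}" "d = \<phi> V'" using mem[of d] sub cr by auto
  obtain W' where W': "W' \<subseteq> {..<4}" "e = \<phi> W'" using mem[of e] sub cr by auto
  have 1: "U \<noteq> {}" "V \<noteq> {}" "W \<noteq> {}" "U \<inter> V = {}" "W = {..<4} - (U \<union> V)"
    using t(1) triple_frame_iff[OF \<phi> U(1) V(1) W(1)] U V W by auto
  have 2: "V' \<noteq> {}" "W' \<noteq> {}" "U \<inter> V' = {}" "W' = {..<4} - (U \<union> V')"
    using t(2) triple_frame_iff[OF \<phi> U(1) V'(1) W'(1)] U V' W' by auto
  have "U \<noteq> {..<4}" using 1 V by blast
  have "x_sub A (\<phi> U) \<in> {x_sub A (\<phi> {0, 1}), x_sub A (\<phi> {0, 2}), x_sub A (\<phi> {0, 3})}"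
    using labelling_edge_point_iff[OF frame4_labelling[OF \<phi>]] edge tt U by simp
  then have "\<exists>k\<in>{1, 2, 3::nat}. x_sub A (\<phi> U) = x_sub A (\<phi> {0, k})" by simp
  then obtain k where k: "k \<in> {1, 2, 3::nat}" "x_sub A (\<phi> U) = x_sub A (\<phi> {0, k})" by (rule bexE)
  have "{0, k} \<subseteq> {..<4}" using k(1) by auto
  then have "{0, k} = U \<or> {0, k} = {..<4} - U"
    using frame_x_sub_eq_iff[OF \<phi> U(1) _ \<open>U \<noteq> {}\<close> \<open>U \<noteq> {..<4}\<close>] k(2) by blast
  then have "card ({..<4} - U) = 2"
  proof
    assume "{0, k} = U"
    then have "card U = 2" using k(1) by auto
    then show ?thesis using U(1) by (simp add: card_Diff_subset finite_subset)
  next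
    assume "{0, k} = {..<4} - U"
    then show ?thesis using k(1) by (metis card_2_iff insertE emptyE zero_neq_numeral zero_neq_one)
  qed
  then obtain i j where ij: "{..<4} - U = {i, j}" "i \<noteq> j" by (auto simp: card_2_iff)
  have split: "S = {i} \<and> S' = {j} \<or> S = {j} \<and> S' = {i}"
    if "S \<noteq> {}" "S' \<noteq> {}" "S \<union> S' = {i, j}" "S \<inter> S' = {}" for S S' :: "nat set"
  proof -
    have sub: "S \<in> Pow {i, j}" "S' \<in> Pow {i, j}" using that(3) by blast+
    moreover have "Pow {i, j} = {{}, {i}, {j}, {i, j}}" by (auto simp: Pow_insert)
    ultimately have "S \<in> {{}, {i}, {j}, {i, j}}" "S' \<in> {{}, {i}, {j}, {i, j}}" by simp_all
    then show ?thesis using that(1,2,4) ij(2) by (elim insertE emptyE) (simp_all add: that(3))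
  qed
  have "V \<union> W = {i, j}" "V \<inter> W = {}" unfolding ij(1)[symmetric] 1(5) using 1(4) V(1) by blast+
  then have VW: "V = {i} \<and> W = {j} \<or> V = {j} \<and> W = {i}" by (intro split 1)
  have "V' \<union> W' = {i, j}" "V' \<inter> W' = {}" unfolding ij(1)[symmetric] 2(4) using 2(3) V'(1) by blast+
  then have "V' = {i} \<and> W' = {j} \<or> V' = {j} \<and> W' = {i}" by (intro split 2)
  with VW show ?thesis unfolding V(2) W(2) V'(2) W'(2) by auto
qed

section \<open>Proper orthoalgebras\<close>

lemma card_x_sub_le: "finite (x_sub A a)" "card (x_sub A a) \<le> 4"
  by (simp_all add: x_sub_def card_insert_if)

lemma proper_ex_nontrivial:
  assumes "proper A" shows "\<exists>a\<in>carrier A. a \<noteq> zero A \<and> a \<noteq> one A"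
proof (rule ccontr)
  assume "\<not> ?thesis"
  then have car: "carrier A \<subseteq> {zero A, one A}" by blast
  have B: "{zero A, one A} \<in> BSub A"
  proof (cases "zero A = one A")
    case True
    have "frame A {} (\<lambda>U::nat set. zero A)"
      using True zero_closed oplus_zero by (intro frameI) auto
    then show ?thesis using frame_image_in_BSub True by fastforce
  qed (rule bounds_in_BSub)
  have "T = {zero A, one A}" if "T \<in> BSub A" for T
  proof -
    have "T \<subseteq> carrier A" using BSub_subalgebra[OF that] by (simp add: subalgebra_def)
    then have "T \<subseteq> {zero A, one A}" using car by (rule subset_trans)
    moreover have "{zero A, one A} \<subseteq> T" using zero_in_BSub[OF that] by simp
    ultimately show ?thesis by (rule equalityI)
  qed
  then have "block A {zero A, one A}" using B unfolding block_def by blast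
  moreover have "card {zero A, one A} \<le> 4" by (simp add: card_insert_if)
  ultimately show False using assms unfolding proper_def by blast
qed

text \<open>A Boolean subalgebra larger than \<open>{0, a, a', 1}\<close> contains an element that splits \<open>a\<close> or \<open>a'\<close>.\<close>

lemma proper_triple:
  assumes "proper A" and a: "a \<in> carrier A" "a \<noteq> zero A" "a \<noteq> one A"
  obtains b c where "triple a b c \<or> triple (compl A a) b c"
proof -
  have xB: "x_sub A a \<in> BSub A" by (rule x_sub_in_BSub[OF a])
  have "\<not> block A (x_sub A a)" using assms(1) card_x_sub_le[of a] unfolding proper_def by blast
  then obtain T where T: "T \<in> BSub A" "x_sub A a \<subseteq> T" "T \<noteq> x_sub A a" using xB unfolding block_def by blast
  then obtain b where b: "b \<in> T" "b \<notin> x_sub A a" by blast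
  obtain meet join where BA: "boolean_algebra_on T meet join (restrict (compl A) T) (zero A) (one A)"
    and op: "\<And>a b. \<lbrakk>a \<in> T; b \<in> T\<rbrakk> \<Longrightarrow> oplus A a b = (if meet a b = zero A then Some (join a b) else None)"
    using BSub_boolean[OF T(1)] by metis
  interpret BA: boolean_algebra_on T meet join "restrict (compl A) T" "zero A" "one A" by (rule BA)
  have TA: "T \<subseteq> carrier A" using BSub_subalgebra[OF T(1)] by (simp add: subalgebra_def)
  have split: "oplus A (meet x y) (meet x (compl A y)) = Some x" "meet x (compl A y) \<in> T"
    if xy: "x \<in> T" "y \<in> T" for x y
  proof -
    have y': "compl A y \<in> T" using BA.neg_closed xy by simp
    have "meet y (compl A y) = zero A" "join y (compl A y) = one A"
      using BA.meet_neg[of y] BA.join_neg[of y] xy by simp_all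
    then have "meet (meet x y) (meet x (compl A y)) = zero A" "join (meet x y) (meet x (compl A y)) = x"
      using xy y' by (simp_all add: BA.meet_assoc BA.meet_left_commute[of y x] BA.meet_bt BA.meet_closed
          BA.meet_join_distrib[symmetric] BA.meet_tp)
    then show "oplus A (meet x y) (meet x (compl A y)) = Some x" using op xy y' by (simp add: BA.meet_closed)
    show "meet x (compl A y) \<in> T" using xy y' by (simp add: BA.meet_closed)
  qed
  have key: "\<exists>c d. triple (compl A x) c d" if x: "x \<in> T" "x \<noteq> one A" "meet x b \<noteq> zero A" "meet x b \<noteq> x" for x
  proof -
    note s = split[OF x(1) b(1)]
    have "meet x (compl A b) \<noteq> zero A"
      using s(1) x oplus_zero[of "meet x b"] BA.meet_closed[OF x(1) b(1)] TA by auto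
    then have "triple (meet x b) (meet x (compl A b)) (compl A x)"
      using s(1) x TA compl_in compl_eq_zero compl_compl by (auto simp: triple_def)
    then show ?thesis using triple_rotate by blast
  qed
  have aT: "a \<in> T" "compl A a \<in> T" using T(2) by (auto simp: x_sub_def)
  have caa: "compl A (compl A a) = a" "compl A a \<noteq> one A" using compl_compl compl_eq_one a by auto
  show ?thesis
  proof (cases "meet a b \<noteq> zero A \<and> meet a b \<noteq> a")
    case True then show ?thesis using key[of a] aT a that by blast
  next
    case F1: False
    show ?thesis
    proof (cases "meet (compl A a) b \<noteq> zero A \<and> meet (compl A a) b \<noteq> compl A a")
      case True then show ?thesis using key[of "compl A a"] aT caa that by auto
    next
      case False
      have "oplus A (meet b a) (meet b (compl A a)) = Some b" using split[OF b(1) aT(1)] by blast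
      then have s: "oplus A (meet a b) (meet (compl A a) b) = Some b"
        using BA.meet_commute aT b(1) by metis
      have "oplus A (zero A) (zero A) = Some (zero A)" "oplus A a (zero A) = Some a"
        "oplus A (zero A) (compl A a) = Some (compl A a)" "oplus A a (compl A a) = Some (one A)"
        using oplus_zero a zero_closed compl_in oplus_comm oplus_compl by metis+
      then have "b \<in> x_sub A a" using s F1 False by (auto simp: x_sub_def)
      then show ?thesis using b by blast
    qed
  qed
qed

text \<open>A small block is \<open>{0, e, e', 1}\<close> for some \<open>e\<close>, because it cannot be contained in \<open>{0, 1}\<close>. A line
  through this point then gives a Boolean subalgebra with eight elements above the block.\<close>

lemma proper_if_points_on_lines:
  assumes ne: "points (G_obj A) \<noteq> {}" and on: "\<And>p. p \<in> points (G_obj A) \<Longrightarrow> \<exists>l\<in>lines (G_obj A). p \<in> l"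
  shows "proper A"
  unfolding proper_def
proof
  assume "\<exists>S. block A S \<and> finite S \<and> card S \<le> 4"
  then obtain S where S: "block A S" "finite S" "card S \<le> 4" by blast
  have SB: "S \<in> BSub A" and max: "\<And>T. T \<in> BSub A \<Longrightarrow> S \<subseteq> T \<Longrightarrow> T = S" using S(1) by (auto simp: block_def)
  obtain a where a: "a \<in> carrier A" "a \<noteq> zero A" "a \<noteq> one A" using ne by (auto simp: points_G_obj)
  have "\<not> S \<subseteq> {zero A, one A}"
  proof
    assume s: "S \<subseteq> {zero A, one A}"
    then have "S \<subseteq> x_sub A a" by (auto simp: x_sub_def)
    then have "x_sub A a = S" using max x_sub_in_BSub[OF a] by blast
    then show False using s a mem_of_x_sub by blast
  qed
  then obtain e where e: "e \<in> S" "e \<noteq> zero A" "e \<noteq> one A" by blast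
  then have eA: "e \<in> carrier A" using BSub_subalgebra[OF SB] by (auto simp: subalgebra_def)
  have "card (x_sub A e) = 4"
    using e eA compl_neq[OF eA] compl_eq_zero[OF eA] compl_eq_one[OF eA] nontrivial_carrier[of e]
    by (simp add: x_sub_def card_insert_if) metis
  moreover have "x_sub A e \<subseteq> S" using x_sub_subset BSub_subalgebra SB e by blast
  ultimately have Se: "S = x_sub A e" using S(2,3) card_seteq[of S "x_sub A e"] by simp
  then have "S \<in> points (G_obj A)" using x_sub_in_points e eA by simp
  then obtain l where l: "l \<in> lines (G_obj A)" "S \<in> l" using on by blast
  then obtain X where X: "has_height (BSub A) X 2" "S \<subseteq> X" by (auto simp: G_obj_def)
  then have "X = S" using max by (simp add: has_height_def)
  obtain \<phi> where \<phi>: "frame A {..2::nat} \<phi>" "X = \<phi> ` Pow {..2}" using has_height_frame[OF X(1)] by auto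
  have "card X = 8" using card_frame_image[OF \<phi>(1)] \<phi>(2) by simp
  then show False using \<open>X = S\<close> S(3) by simp
qed

end

section \<open>Embeddings of orthoalgebras induce morphisms of hypergraphs\<close>

text \<open>The morphisms of \<^const>\<open>OHi\<close>, for hypergraphs that need not be orthohypergraphs.\<close>

definition total_inj_hom :: "'p hgraph \<Rightarrow> 'q hgraph \<Rightarrow> ('p \<rightharpoonup> 'q) set" where
  "total_inj_hom H K = {\<alpha> \<in> ohgraph_hom H K. dom \<alpha> = points H \<and> inj_on \<alpha> (points H)}"

lemma inj_on_the:
  assumes "inj_on \<alpha> D" "D \<subseteq> dom \<alpha>" shows "inj_on (the \<circ> \<alpha>) D"
proof (rule inj_onI)
  fix x y assume xy: "x \<in> D" "y \<in> D" "(the \<circ> \<alpha>) x = (the \<circ> \<alpha>) y"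
  then obtain u v where "\<alpha> x = Some u" "\<alpha> y = Some v" using assms(2) by blast
  then show "x = y" using xy inj_onD[OF assms(1), of x y] by simp
qed

locale orthoalgebra_pair = A: orthoalgebra A + C: orthoalgebra C
  for A :: "'a oalg" and C :: "'a oalg"

locale orthoalgebra_embedding = orthoalgebra_pair A C
  for A :: "'a oalg" and C :: "'a oalg" +
  fixes f
  assumes hom: "f \<in> oalg_hom A C" and inj: "inj_on f (carrier A)"
begin

lemma f_carrier: "a \<in> carrier A \<Longrightarrow> f a \<in> carrier C"
  using hom by (auto simp: oalg_hom_def)

lemma f_compl: "a \<in> carrier A \<Longrightarrow> f (compl A a) = compl C (f a)"
  using hom by (simp add: oalg_hom_def)

lemma f_oplus: "oplus A a b = Some c \<Longrightarrow> oplus C (f a) (f b) = Some (f c)"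
  using hom A.oplus_closed by (auto simp: oalg_hom_def)

lemma f_one: "f (one A) = one C"
proof -
  have "oplus C (f (zero A)) (f (compl A (zero A))) = Some (f (one A))"
    using f_oplus A.oplus_compl A.zero_closed by blast
  then show ?thesis using f_compl[OF A.zero_closed] C.oplus_compl[OF f_carrier[OF A.zero_closed]] by simp
qed

lemma f_zero: "f (zero A) = zero C"
  using f_compl[OF A.one_closed] f_one A.compl_one C.compl_one by simp

lemma f_eq_zero_iff: "a \<in> carrier A \<Longrightarrow> f a = zero C \<longleftrightarrow> a = zero A"
  using inj f_zero A.zero_closed by (metis inj_onD)

lemma f_eq_one_iff: "a \<in> carrier A \<Longrightarrow> f a = one C \<longleftrightarrow> a = one A"
  using inj f_one A.one_closed by (metis inj_onD)

lemma f_triple: "A.triple a b c \<Longrightarrow> C.triple (f a) (f b) (f c)"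
  using f_oplus[of a b] A.triple_carrier[of a b c] f_eq_zero_iff f_compl f_carrier
  by (auto simp: A.triple_def C.triple_def)

lemma f_frame:
  assumes \<phi>: "frame A I \<phi>" shows "frame C I (f \<circ> \<phi>)"
  unfolding frame_def
proof (intro conjI allI impI)
  show "(f \<circ> \<phi>) ` Pow I \<subseteq> carrier C" using A.frame_carrier[OF \<phi>] f_carrier by auto
  show "inj_on (f \<circ> \<phi>) (Pow I)"
    using \<phi> inj by (intro comp_inj_on) (auto simp: frame_def intro: inj_on_subset)
  show "(f \<circ> \<phi>) I = one C" using A.frame_top[OF \<phi>] f_one by simp
  show "oplus C ((f \<circ> \<phi>) U) ((f \<circ> \<phi>) V) = Some ((f \<circ> \<phi>) (U \<union> V))" if "U \<subseteq> I \<and> V \<subseteq> I \<and> U \<inter> V = {}" for U V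
    using f_oplus A.frame_oplus[OF \<phi>] that by simp
qed

lemma f_x_sub_cong:
  assumes "a \<in> carrier A" "a \<noteq> zero A" "a \<noteq> one A" "b \<in> carrier A" "x_sub A a = x_sub A b"
  shows "x_sub C (f a) = x_sub C (f b)"
  using assms A.x_sub_eq_iff[of a b] f_compl C.x_sub_compl f_carrier by auto

lemma G_map_x_sub:
  assumes a: "a \<in> carrier A" "a \<noteq> zero A" "a \<noteq> one A"
  shows "G_map A C f (x_sub A a) = Some (x_sub C (f a))"
proof -
  define b where "b = (SOME b. b \<in> carrier A - {zero A, one A} \<and> x_sub A a = x_sub A b)"
  have "b \<in> carrier A - {zero A, one A} \<and> x_sub A a = x_sub A b"
    unfolding b_def by (rule someI[of _ a]) (use a in auto)
  then have b: "b \<in> carrier A" "b \<noteq> zero A" "b \<noteq> one A" "x_sub A a = x_sub A b" by auto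
  have "G_map A C f (x_sub A a) = Some (x_sub C (f b))"
    unfolding G_map_def b_def[symmetric] Let_def
    using A.x_sub_in_points[OF a] b(1-3) f_eq_zero_iff[OF b(1)] f_eq_one_iff[OF b(1)] by simp
  then show ?thesis using f_x_sub_cong[OF a b(1,4)] by simp
qed

lemma G_map_None: "p \<notin> points (G_obj A) \<Longrightarrow> G_map A C f p = None"
  by (simp add: G_map_def)

lemma G_map_dom: "dom (G_map A C f) = points (G_obj A)"
proof
  show "points (G_obj A) \<subseteq> dom (G_map A C f)" using G_map_x_sub by (auto simp: A.points_G_obj)
  show "dom (G_map A C f) \<subseteq> points (G_obj A)"
  proof
    fix p assume "p \<in> dom (G_map A C f)"
    then show "p \<in> points (G_obj A)" using G_map_None[of p] by (metis domIff)
  qed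
qed

lemma G_map_inj: "inj_on (G_map A C f) (points (G_obj A))"
proof (rule inj_onI)
  fix p r assume "p \<in> points (G_obj A)" "r \<in> points (G_obj A)" and eq: "G_map A C f p = G_map A C f r"
  then obtain a b where a: "a \<in> carrier A" "a \<noteq> zero A" "a \<noteq> one A" "p = x_sub A a"
    and b: "b \<in> carrier A" "b \<noteq> zero A" "b \<noteq> one A" "r = x_sub A b" by (auto simp: A.points_G_obj)
  have "x_sub C (f a) = x_sub C (f b)" using eq G_map_x_sub a b by simp
  then have "f b = f a \<or> f b = f (compl A a)"
    using C.x_sub_eq_iff[of "f a" "f b"] f_eq_zero_iff f_eq_one_iff f_carrier f_compl a b by simp
  then have "b = a \<or> b = compl A a" using inj a(1) b(1) A.compl_in by (metis inj_onD)
  then show "p = r" using a b A.x_sub_compl by auto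
qed

lemma G_map_line:
  assumes "A.triple a b c"
  shows "(the \<circ> G_map A C f) ` {x_sub A a, x_sub A b, x_sub A c} = {x_sub C (f a), x_sub C (f b), x_sub C (f c)}"
  using A.triple_nontrivial[OF assms] A.triple_carrier[OF assms] G_map_x_sub by simp

lemma G_map_A1: "A1 (G_obj A) (G_obj C) (G_map A C f)"
  unfolding A1_def
proof (intro ballI disjI2 conjI)
  fix l assume l: "l \<in> lines (G_obj A)"
  then obtain a b c where t: "A.triple a b c" and l': "l = {x_sub A a, x_sub A b, x_sub A c}"
    using A.lines_G_obj by auto
  have sub: "l \<subseteq> points (G_obj A)" using A.triple_points[OF t] l' by simp
  then show dom: "l \<subseteq> dom (G_map A C f)" using G_map_dom by simp
  have "inj_on (the \<circ> G_map A C f) l"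
    using inj_on_the[of "G_map A C f" l] G_map_inj sub dom inj_on_subset by blast
  moreover have "(the \<circ> G_map A C f) ` l \<in> lines (G_obj C)"
    unfolding l' G_map_line[OF t] C.lines_G_obj using f_triple[OF t] by blast
  ultimately show "\<exists>l'\<in>lines (G_obj C). bij_betw (the \<circ> G_map A C f) l l'"
    by (auto simp: bij_betw_def)
qed

lemma G_map_plane:
  assumes "t \<in> planes (G_obj A)"
  shows "\<exists>t'\<in>planes (G_obj C). maps_plane_iso (G_obj A) (G_obj C) (G_map A C f) t t'"
proof -
  obtain \<phi> where \<phi>: "frame A {..<4::nat} \<phi>" and t: "t = A.pts (\<phi> ` Pow {..<4})"
    using assms A.planes_G_obj by blast
  let ?t' = "C.pts ((f \<circ> \<phi>) ` Pow {..<4})"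
  have val: "(the \<circ> G_map A C f) (x_sub A (\<phi> U)) = x_sub C ((f \<circ> \<phi>) U)" if "U \<subseteq> {..<4}" "i \<in> U" "j < 4" "j \<notin> U" for U i j
  proof -
    have "U \<noteq> {}" "U \<noteq> {..<4}" using that by auto
    then show ?thesis
      using G_map_x_sub[of "\<phi> U"] A.frame_carrier[OF \<phi> that(1)] A.frame_eq_zero_iff[OF \<phi> that(1)]
        A.frame_eq_one_iff[OF \<phi> that(1)] by simp
  qed
  note vals = val[of "{0}" 0 1] val[of "{1}" 1 0] val[of "{2}" 2 0] val[of "{3}" 3 0] val[of "{0, 1}" 0 2]
      val[of "{0, 2}" 0 1] val[of "{0, 3}" 0 1]
  have "t \<subseteq> points (G_obj A)" using assms A.hypergraph_G_obj by (simp add: hypergraph_def)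
  then have dom: "A.pts (\<phi> ` Pow {..<4}) \<subseteq> dom (G_map A C f)" using G_map_dom t by simp
  have "maps_plane_iso (G_obj A) (G_obj C) (G_map A C f) t ?t'"
    unfolding t
    by (rule maps_plane_iso_labelling[OF A.frame4_labelling[OF \<phi>] dom])
      (use C.frame4_labelling[OF f_frame[OF \<phi>]] vals in simp)
  then show ?thesis using C.planes_G_obj f_frame[OF \<phi>] by blast
qed

lemma G_map_A2: "A2 (G_obj A) (G_obj C) (G_map A C f)"
  unfolding A2_def using G_map_plane by blast

text \<open>Lines whose images lie in a common plane and meet there in an edge point have images of opposite
  direction, so they have opposite directions themselves and span a plane.\<close>

lemma G_map_A3: "A3 (G_obj A) (G_obj C) (G_map A C f)"
  unfolding A3_def
proof (intro ballI allI impI, elim conjE)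
  let ?g = "the \<circ> G_map A C f"
  fix l m p t' l' m' q
  assume l: "l \<in> lines (G_obj A)" and m: "m \<in> lines (G_obj A)" and t': "t' \<in> planes (G_obj C)"
    and lm: "l \<inter> m = {p}" and l': "?g ` l = l'" and m': "?g ` m = m'" and ne: "l' \<noteq> m'"
    and sub: "l' \<subseteq> t'" "m' \<subseteq> t'" and q: "G_map A C f p = Some q" and edge: "edge_point (G_obj C) t' q"
  obtain a b c where t: "A.triple a b c" and p: "p = x_sub A a" and la: "l = {x_sub A a, x_sub A b, x_sub A c}"
    using A.line_through[OF l, of p] lm by blast
  obtain d g h where t2: "A.triple d g h" and p2: "p = x_sub A d" and md: "m = {x_sub A d, x_sub A g, x_sub A h}"
    using A.line_through[OF m, of p] lm by blast
  note nt = A.triple_nontrivial[OF t] and cr = A.triple_carrier[OF t] A.triple_carrier[OF t2]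
  have qa: "q = x_sub C (f a)" using q p G_map_x_sub[of a] nt cr by simp
  have la': "l' = {x_sub C (f a), x_sub C (f b), x_sub C (f c)}" using l' la G_map_line[OF t] by simp
  have md': "m' = {x_sub C (f a), x_sub C (f g), x_sub C (f h)}"
    using m' md G_map_line[OF t2] f_x_sub_cong[of a d] nt cr p p2 by simp
  have "d = a \<or> d = compl A a" using A.x_sub_eq_iff[of a d] p p2 nt cr by auto
  then show "\<exists>t\<in>planes (G_obj A). l \<subseteq> t \<and> m \<subseteq> t \<and> maps_plane_iso (G_obj A) (G_obj C) (G_map A C f) t t'"
  proof
    assume "d = a"
    then have "C.triple (f a) (f g) (f h)" using f_triple[OF t2] by simp
    then have "{x_sub C (f b), x_sub C (f c)} = {x_sub C (f g), x_sub C (f h)}"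
      using C.same_direction_lines_eq[OF f_triple[OF t] _ t'] sub edge unfolding la' md' qa by blast
    then have "l' = m'" unfolding la' md' by simp
    then show ?thesis using ne by blast
  next
    assume d: "d = compl A a"
    then have opp: "A.triple (compl A a) g h" "C.triple (compl C (f a)) (f g) (f h)"
      using t2 f_triple[OF t2] f_compl cr by simp_all
    have ma: "m = {x_sub A a, x_sub A g, x_sub A h}" using md p p2 by simp
    obtain t where t: "t \<in> planes (G_obj A)" "l \<subseteq> t" "m \<subseteq> t"
      using A.opposite_lines_plane[OF t opp(1)] unfolding la ma by metis
    obtain t'' where t'': "t'' \<in> planes (G_obj C)" "maps_plane_iso (G_obj A) (G_obj C) (G_map A C f) t t''"
      using G_map_plane[OF t(1)] by blast
    then have "l' \<subseteq> t''" "m' \<subseteq> t''"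
      using l' m' t by (auto simp: maps_plane_iso_def bij_betw_def)
    then have "t'' = t'"
      using C.opposite_lines_plane[OF f_triple[OF \<open>A.triple a b c\<close>] opp(2)] t'' t' sub unfolding la' md' by metis
    then show ?thesis using t t'' by blast
  qed
qed

lemma G_map_total_inj_hom: "G_map A C f \<in> total_inj_hom (G_obj A) (G_obj C)"
proof -
  have "ran (G_map A C f) \<subseteq> points (G_obj C)"
  proof
    fix q assume "q \<in> ran (G_map A C f)"
    then obtain p where p: "G_map A C f p = Some q" by (auto simp: ran_def)
    then have "p \<in> points (G_obj A)" using G_map_dom by blast
    then obtain a where "a \<in> carrier A" "a \<noteq> zero A" "a \<noteq> one A" "p = x_sub A a" by (auto simp: A.points_G_obj)
    then show "q \<in> points (G_obj C)"
      using p G_map_x_sub f_carrier f_eq_zero_iff f_eq_one_iff by (auto intro!: C.x_sub_in_points)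
  qed
  then show ?thesis
    unfolding total_inj_hom_def ohgraph_hom_def
    using G_map_A1 G_map_A2 G_map_A3 G_map_dom G_map_inj by simp
qed

end

text \<open>By the rigidity of lines, \<open>f\<close> and \<open>g\<close> agree on every \<open>a\<close> that is a summand of the unit on some line,
  and in a proper orthoalgebra this is the case for every nontrivial element or its complement.\<close>

lemma G_map_faithful:
  assumes f: "orthoalgebra_embedding A C f" and g: "orthoalgebra_embedding A C g"
    and eq: "G_map A C f = G_map A C g" and proper: "proper A"
  shows "f = g"
proof -
  interpret f: orthoalgebra_embedding A C f by (rule f)
  interpret g: orthoalgebra_embedding A C g by (rule g)
  have x: "x_sub C (f a) = x_sub C (g a)" if "a \<in> carrier A" "a \<noteq> zero A" "a \<noteq> one A" for a
    using f.G_map_x_sub[OF that] g.G_map_x_sub[OF that] eq by simp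
  have tri: "f a = g a" if t: "f.A.triple a b c" for a b c
    using f.C.triple_rigid[OF f.f_triple[OF t] g.f_triple[OF t]] x
      f.A.triple_nontrivial[OF t] f.A.triple_carrier[OF t] by blast
  have "f a = g a" if a: "a \<in> carrier A" for a
  proof (cases "a = zero A \<or> a = one A")
    case True then show ?thesis using f.f_zero g.f_zero f.f_one g.f_one by auto
  next
    case False
    then obtain b c where "f.A.triple a b c \<or> f.A.triple (compl A a) b c"
      using f.A.proper_triple[OF proper a] by blast
    then have "f a = g a \<or> f (compl A a) = g (compl A a)" using tri by blast
    then show ?thesis using f.f_compl g.f_compl f.f_carrier g.f_carrier a f.C.compl_compl by metis
  qed
  moreover have "f \<in> extensional (carrier A)" "g \<in> extensional (carrier A)"
    using f.hom g.hom by (auto simp: oalg_hom_def PiE_def)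
  ultimately show ?thesis using extensionalityI by blast
qed

section \<open>Injective morphisms of orthohypergraphs\<close>

lemma hypergraph_line: "hypergraph H \<Longrightarrow> l \<in> lines H \<Longrightarrow> l \<subseteq> points H \<and> card l = 3"
  by (simp add: hypergraph_def)

lemma hypergraph_plane: "hypergraph H \<Longrightarrow> t \<in> planes H \<Longrightarrow> t \<subseteq> points H"
  by (simp add: hypergraph_def)

lemma hypergraph_plane_nonempty: assumes "hypergraph H" "t \<in> planes H" shows "t \<noteq> {}"
proof -
  obtain c1 c2 c3 c4 e1 e2 e3 where "labelling H t c1 c2 c3 c4 e1 e2 e3"
    using assms(1)[unfolded hypergraph_def, THEN conjunct2] assms(2) by metis
  then show ?thesis by (auto simp: labelling_def)
qed

text \<open>Lines and planes are nonempty and consist of points, at all of which an injective morphism is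
  defined. So only the last alternatives of (A1) and (A2) remain.\<close>

lemma total_inj_homD:
  assumes \<alpha>: "\<alpha> \<in> total_inj_hom H K" and H: "hypergraph H"
  shows "dom \<alpha> = points H" "ran \<alpha> \<subseteq> points K" "inj_on \<alpha> (points H)" "inj_on (the \<circ> \<alpha>) (points H)"
    "\<And>l. l \<in> lines H \<Longrightarrow> (the \<circ> \<alpha>) ` l \<in> lines K"
    "\<And>t. t \<in> planes H \<Longrightarrow> \<exists>t'\<in>planes K. maps_plane_iso H K \<alpha> t t'"
    "A3 H K \<alpha>"
proof -
  show dom: "dom \<alpha> = points H" and "ran \<alpha> \<subseteq> points K" and inj: "inj_on \<alpha> (points H)" and "A3 H K \<alpha>"
    using \<alpha> by (simp_all add: total_inj_hom_def ohgraph_hom_def)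
  show "inj_on (the \<circ> \<alpha>) (points H)" by (rule inj_on_the[OF inj]) (simp add: dom)
  have some: "\<alpha> p \<noteq> None" if "p \<in> points H" for p using dom that by blast
  show "(the \<circ> \<alpha>) ` l \<in> lines K" if l: "l \<in> lines H" for l
  proof -
    have sub: "l \<subseteq> points H" "l \<noteq> {}" using hypergraph_line[OF H l] by auto
    have "A1 H K \<alpha>" using \<alpha> by (simp add: total_inj_hom_def ohgraph_hom_def)
    then have "(\<forall>p\<in>l. \<alpha> p = None) \<or> (\<exists>p\<in>l. \<alpha> p = None \<and> (\<exists>q. \<forall>r\<in>l - {p}. \<alpha> r = Some q)) \<or>
     (l \<subseteq> dom \<alpha> \<and> (\<exists>l'\<in>lines K. bij_betw (the \<circ> \<alpha>) l l'))" using l unfolding A1_def by blast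
    then show ?thesis
    proof (elim disjE)
      assume "l \<subseteq> dom \<alpha> \<and> (\<exists>l'\<in>lines K. bij_betw (the \<circ> \<alpha>) l l')"
      then show ?thesis by (auto simp: bij_betw_def)
    qed (use sub some in blast)+
  qed
  show "\<exists>t'\<in>planes K. maps_plane_iso H K \<alpha> t t'" if t: "t \<in> planes H" for t
  proof -
    have sub: "t \<subseteq> points H" "t \<noteq> {}" using hypergraph_plane[OF H t] hypergraph_plane_nonempty[OF H t] by auto
    have no: "p \<notin> t" if "\<alpha> p = None" for p using that some sub by blast
    have lab: "c1 \<in> t" if "labelling H t c1 c2 c3 c4 e1 e2 e3" for c1 c2 c3 c4 e1 e2 e3
      using that by (simp add: labelling_def)
    have "A2 H K \<alpha>" using \<alpha> by (simp add: total_inj_hom_def ohgraph_hom_def)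
    from bspec[OF this[unfolded A2_def] t] show ?thesis
    proof (elim disjE exE conjE)
      assume "\<forall>p\<in>t. \<alpha> p = None" then show ?thesis using sub no by blast
    next
      fix c1 c2 c3 c4 e1 e2 e3 assume "labelling H t c1 c2 c3 c4 e1 e2 e3" "\<alpha> c1 = None"
      then show ?thesis using lab no by blast
    next
      fix c1 c2 c3 c4 e1 e2 e3 assume "labelling H t c1 c2 c3 c4 e1 e2 e3" "\<alpha> c1 = None"
      then show ?thesis using lab no by blast
    qed
  qed
qed

lemma total_inj_homI:
  assumes "hypergraph H" "dom \<alpha> = points H" "ran \<alpha> \<subseteq> points K" "inj_on \<alpha> (points H)"
    "\<And>l. l \<in> lines H \<Longrightarrow> (the \<circ> \<alpha>) ` l \<in> lines K"
    "\<And>t. t \<in> planes H \<Longrightarrow> \<exists>t'\<in>planes K. maps_plane_iso H K \<alpha> t t'"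
    "A3 H K \<alpha>"
  shows "\<alpha> \<in> total_inj_hom H K"
proof -
  have "A1 H K \<alpha>"
    unfolding A1_def
  proof (intro ballI disjI2 conjI)
    fix l assume l: "l \<in> lines H"
    then show sub: "l \<subseteq> dom \<alpha>" using hypergraph_line[OF assms(1)] assms(2) by simp
    have "inj_on (the \<circ> \<alpha>) l"
      using inj_on_the[OF inj_on_subset[OF assms(4)] sub] sub assms(2) by simp
    then show "\<exists>l'\<in>lines K. bij_betw (the \<circ> \<alpha>) l l'" using assms(5)[OF l] by (auto simp: bij_betw_def)
  qed
  moreover have "A2 H K \<alpha>" unfolding A2_def using assms(6) by blast
  ultimately show ?thesis using assms by (simp add: total_inj_hom_def ohgraph_hom_def)
qed

lemma A3D:
  assumes "A3 H K \<alpha>" "l \<in> lines H" "m \<in> lines H" "l \<inter> m = {p}" "l \<subseteq> dom \<alpha>" "m \<subseteq> dom \<alpha>"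
    "(the \<circ> \<alpha>) ` l \<in> lines K" "(the \<circ> \<alpha>) ` m \<in> lines K" "(the \<circ> \<alpha>) ` l \<noteq> (the \<circ> \<alpha>) ` m"
    "t' \<in> planes K" "(the \<circ> \<alpha>) ` l \<subseteq> t'" "(the \<circ> \<alpha>) ` m \<subseteq> t'" "(the \<circ> \<alpha>) ` l \<inter> (the \<circ> \<alpha>) ` m = {q}"
    "\<alpha> p = Some q" "edge_point K t' q"
  obtains t where "t \<in> planes H" "l \<subseteq> t" "m \<subseteq> t" "maps_plane_iso H K \<alpha> t t'"
  using assms(1)[unfolded A3_def, rule_format, OF assms(2,3,10,7,8), of p q] assms(4-6,9,11-15) by blast

lemma maps_plane_iso_comp:
  assumes 1: "maps_plane_iso H K \<alpha> t t'" and 2: "maps_plane_iso K M \<beta> t' t''"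
  shows "maps_plane_iso H M (\<beta> \<circ>\<^sub>m \<alpha>) t t''"
proof -
  have dom: "t \<subseteq> dom \<alpha>" "t' \<subseteq> dom \<beta>" and bij: "bij_betw (the \<circ> \<alpha>) t t'" "bij_betw (the \<circ> \<beta>) t' t''"
    using 1 2 by (auto simp: maps_plane_iso_def)
  have eq: "(the \<circ> (\<beta> \<circ>\<^sub>m \<alpha>)) p = (the \<circ> \<beta>) ((the \<circ> \<alpha>) p)" if "p \<in> t" for p
    using that dom(1) by (auto simp: map_comp_def)
  have "p \<in> dom (\<beta> \<circ>\<^sub>m \<alpha>)" if p: "p \<in> t" for p
  proof -
    obtain q where q: "\<alpha> p = Some q" using dom(1) p by blast
    then have "q \<in> t'" using bij(1) p by (force simp: bij_betw_def)
    then show ?thesis using q dom(2) by (auto simp: map_comp_def)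
  qed
  moreover have "bij_betw (the \<circ> (\<beta> \<circ>\<^sub>m \<alpha>)) t t''"
    using bij_betw_trans[OF bij] eq by (simp add: bij_betw_cong[of t "the \<circ> (\<beta> \<circ>\<^sub>m \<alpha>)" "(the \<circ> \<beta>) \<circ> (the \<circ> \<alpha>)"])
  moreover have "l \<in> lines H \<longleftrightarrow> (the \<circ> (\<beta> \<circ>\<^sub>m \<alpha>)) ` l \<in> lines M" if l: "l \<subseteq> t" for l
  proof -
    have "(the \<circ> (\<beta> \<circ>\<^sub>m \<alpha>)) ` l = (the \<circ> \<beta>) ` (the \<circ> \<alpha>) ` l"
      unfolding image_image by (rule image_cong) (use eq l in auto)
    moreover have "(the \<circ> \<alpha>) ` l \<subseteq> t'" using bij(1) l by (auto simp: bij_betw_def)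
    ultimately show ?thesis using 1 2 l by (simp add: maps_plane_iso_def)
  qed
  ultimately show ?thesis unfolding maps_plane_iso_def by blast
qed

text \<open>For (A3), a plane containing the images of two lines in the last hypergraph is pulled back to the
  middle one, where the intersection point is again an edge point, and then to the first one.\<close>

lemma total_inj_hom_comp:
  assumes \<alpha>: "\<alpha> \<in> total_inj_hom H K" and \<beta>: "\<beta> \<in> total_inj_hom K M" and H: "hypergraph H" and K: "hypergraph K"
  shows "\<beta> \<circ>\<^sub>m \<alpha> \<in> total_inj_hom H M"
proof -
  note a = total_inj_homD[OF \<alpha> H] and b = total_inj_homD[OF \<beta> K]
  have val: "\<exists>q. \<alpha> p = Some q \<and> q \<in> points K" if p: "p \<in> points H" for p
  proof -
    obtain q where "\<alpha> p = Some q" using p a(1) by (metis domD)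
    then show ?thesis using a(2) by (auto simp: ran_def)
  qed
  have eq: "(the \<circ> (\<beta> \<circ>\<^sub>m \<alpha>)) p = (the \<circ> \<beta>) ((the \<circ> \<alpha>) p)" if "p \<in> points H" for p
    using val[OF that] by auto
  have img: "(the \<circ> (\<beta> \<circ>\<^sub>m \<alpha>)) ` l = (the \<circ> \<beta>) ` (the \<circ> \<alpha>) ` l" if "l \<subseteq> points H" for l
    unfolding image_image by (rule image_cong) (use eq that in auto)
  show ?thesis
  proof (rule total_inj_homI[OF H])
    show "dom (\<beta> \<circ>\<^sub>m \<alpha>) = points H"
    proof (intro set_eqI iffI)
      fix p assume "p \<in> points H"
      then obtain q where q: "\<alpha> p = Some q" "q \<in> points K" using val by blast
      then obtain r where "\<beta> q = Some r" using b(1) by (metis domD)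
      then show "p \<in> dom (\<beta> \<circ>\<^sub>m \<alpha>)" using q by (simp add: dom_def)
    next
      fix p assume "p \<in> dom (\<beta> \<circ>\<^sub>m \<alpha>)"
      then have "p \<in> dom \<alpha>" by (auto simp: map_comp_def split: option.splits)
      then show "p \<in> points H" using a(1) by simp
    qed
    show "ran (\<beta> \<circ>\<^sub>m \<alpha>) \<subseteq> points M"
      using b(2) by (auto simp: ran_def map_comp_def split: option.splits)
    show "inj_on (\<beta> \<circ>\<^sub>m \<alpha>) (points H)"
    proof (rule inj_onI)
      fix p r assume p: "p \<in> points H" "r \<in> points H" "(\<beta> \<circ>\<^sub>m \<alpha>) p = (\<beta> \<circ>\<^sub>m \<alpha>) r"
      obtain q s where q: "\<alpha> p = Some q" "q \<in> points K" "\<alpha> r = Some s" "s \<in> points K" using val p by blast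
      then have "\<beta> q = \<beta> s" using p(3) by simp
      then have "q = s" using b(3) q by (auto dest: inj_onD)
      then show "p = r" using a(3) p q inj_onD[of \<alpha> "points H" p r] by simp
    qed
    show "(the \<circ> (\<beta> \<circ>\<^sub>m \<alpha>)) ` l \<in> lines M" if "l \<in> lines H" for l
      using a(5) b(5) img hypergraph_line[OF H] that by simp
    show "\<exists>t'\<in>planes M. maps_plane_iso H M (\<beta> \<circ>\<^sub>m \<alpha>) t t'" if "t \<in> planes H" for t
      using a(6)[OF that] b(6) maps_plane_iso_comp by blast
    show "A3 H M (\<beta> \<circ>\<^sub>m \<alpha>)"
      unfolding A3_def
    proof (intro ballI allI impI, elim conjE)
      fix l m p t' l' m' q
      assume l: "l \<in> lines H" and m: "m \<in> lines H" and t': "t' \<in> planes M"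
        and lm: "l \<inter> m = {p}" and l': "(the \<circ> (\<beta> \<circ>\<^sub>m \<alpha>)) ` l = l'" and m': "(the \<circ> (\<beta> \<circ>\<^sub>m \<alpha>)) ` m = m'" and ne: "l' \<noteq> m'"
        and sub: "l' \<subseteq> t'" "m' \<subseteq> t'" and int: "l' \<inter> m' = {q}" and q: "(\<beta> \<circ>\<^sub>m \<alpha>) p = Some q" and edge: "edge_point M t' q"
      let ?f = "the \<circ> \<alpha>" and ?g = "the \<circ> \<beta>"
      have lp: "l \<subseteq> points H" "m \<subseteq> points H" using hypergraph_line[OF H] l m by auto
      have fl: "?f ` l \<in> lines K" "?f ` m \<in> lines K" using a(5) l m by auto
      then have flp: "?f ` l \<subseteq> points K" "?f ` m \<subseteq> points K" using hypergraph_line[OF K] by auto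
      have gl: "l' = ?g ` ?f ` l" "m' = ?g ` ?f ` m" using l' m' img lp by auto
      have p: "p \<in> points H" using lm lp by blast
      obtain s where s: "\<alpha> p = Some s" "s \<in> points K" using val[OF p] by blast
      have fint: "?f ` l \<inter> ?f ` m = {s}"
        using inj_on_image_Int[OF a(4) lp] lm s(1) by simp
      have \<beta>s: "\<beta> s = Some q" using q s by simp
      obtain t1 where t1: "t1 \<in> planes K" "?f ` l \<subseteq> t1" "?f ` m \<subseteq> t1" "maps_plane_iso K M \<beta> t1 t'"
      proof (rule A3D[OF b(7) fl fint _ _ _ _ _ t'])
        show "?f ` l \<subseteq> dom \<beta>" "?f ` m \<subseteq> dom \<beta>" using flp b(1) by simp_all
        show "?g ` ?f ` l \<in> lines M" "?g ` ?f ` m \<in> lines M" using b(5) fl by blast+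
      qed (use gl ne sub int \<beta>s edge in auto)
      have "s \<in> t1" using fint t1(2) by blast
      then have e1: "edge_point K t1 s" using edge_point_iso[OF t1(4) K t1(1)] edge \<beta>s by simp
      obtain t where t: "t \<in> planes H" "l \<subseteq> t" "m \<subseteq> t" "maps_plane_iso H K \<alpha> t t1"
      proof (rule A3D[OF a(7) l m lm _ _ fl _ t1(1-3) fint s(1) e1])
        show "l \<subseteq> dom \<alpha>" "m \<subseteq> dom \<alpha>" using lp a(1) by simp_all
        show "?f ` l \<noteq> ?f ` m" using ne gl by metis
      qed
      then show "\<exists>t\<in>planes H. l \<subseteq> t \<and> m \<subseteq> t \<and> maps_plane_iso H M (\<beta> \<circ>\<^sub>m \<alpha>) t t'"
        using maps_plane_iso_comp[OF _ t1(4)] by blast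
    qed
  qed
qed

lemma bij_total_inj_hom:
  assumes H: "hypergraph H" and K: "hypergraph K" and bij: "bij_betw \<phi> (points H) (points K)"
    and ln: "(\<lambda>l. \<phi> ` l) ` lines H = lines K" and pl: "(\<lambda>t. \<phi> ` t) ` planes H = planes K"
  shows "(\<lambda>p. if p \<in> points H then Some (\<phi> p) else None) \<in> total_inj_hom H K" (is "?\<alpha> \<in> _")
proof -
  have inj: "inj_on \<phi> (points H)" and surj: "\<phi> ` points H = points K" using bij by (auto simp: bij_betw_def)
  have dom: "dom ?\<alpha> = points H" by (auto simp: dom_def)
  have img: "(the \<circ> ?\<alpha>) ` l = \<phi> ` l" if "l \<subseteq> points H" for l
    by (rule image_cong) (use that in auto)
  have iso: "maps_plane_iso H K ?\<alpha> t (\<phi> ` t)" if t: "t \<in> planes H" for t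
  proof -
    have tp: "t \<subseteq> points H" using hypergraph_plane[OF H t] .
    have "inj_on (the \<circ> ?\<alpha>) t" using inj_on_subset[OF inj tp] tp by (auto simp: inj_on_def)
    moreover have "l \<in> lines H \<longleftrightarrow> (the \<circ> ?\<alpha>) ` l \<in> lines K" if l: "l \<subseteq> t" for l
    proof -
      have lp: "l \<subseteq> points H" using l tp by blast
      have "l \<in> lines H" if kl: "\<phi> ` l \<in> lines K"
      proof -
        have "\<phi> ` l \<in> (\<lambda>l. \<phi> ` l) ` lines H" using kl ln by simp
        then obtain l0 where l0: "l0 \<in> lines H" "\<phi> ` l = \<phi> ` l0" by auto
        then have "l = l0" using inj_on_image_eq_iff[OF inj lp] hypergraph_line[OF H] by blast
        then show ?thesis using l0 by simp
      qed
      then show ?thesis using img[OF lp] ln by auto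
    qed
    ultimately show ?thesis
      unfolding maps_plane_iso_def bij_betw_def using img[OF tp] tp dom by simp
  qed
  show ?thesis
  proof (rule total_inj_homI[OF H dom])
    show "ran ?\<alpha> \<subseteq> points K" using surj by (auto simp: ran_def)
    show "inj_on ?\<alpha> (points H)" using inj by (auto simp: inj_on_def)
    show "(the \<circ> ?\<alpha>) ` l \<in> lines K" if "l \<in> lines H" for l using img hypergraph_line[OF H that] ln that by auto
    show "\<exists>t'\<in>planes K. maps_plane_iso H K ?\<alpha> t t'" if "t \<in> planes H" for t using iso that pl by blast
    show "A3 H K ?\<alpha>"
      unfolding A3_def
    proof (intro ballI allI impI, elim conjE)
      fix l m p t' l' m' q
      assume l: "l \<in> lines H" and m: "m \<in> lines H" and t': "t' \<in> planes K"
        and l': "(the \<circ> ?\<alpha>) ` l = l'" and m': "(the \<circ> ?\<alpha>) ` m = m'" and sub: "l' \<subseteq> t'" "m' \<subseteq> t'"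
      have lp: "l \<subseteq> points H" "m \<subseteq> points H" using hypergraph_line[OF H] l m by auto
      obtain t where t: "t \<in> planes H" "t' = \<phi> ` t" using t' pl by blast
      have "\<phi> ` l \<subseteq> \<phi> ` t" "\<phi> ` m \<subseteq> \<phi> ` t" using img lp l' m' sub t by auto
      moreover have "n \<subseteq> t" if "n \<subseteq> points H" "\<phi> ` n \<subseteq> \<phi> ` t" for n
        using inj_on_image_mem_iff[OF inj _ hypergraph_plane[OF H t(1)]] that by blast
      ultimately have "l \<subseteq> t" "m \<subseteq> t" using lp by blast+
      then show "\<exists>t\<in>planes H. l \<subseteq> t \<and> m \<subseteq> t \<and> maps_plane_iso H K ?\<alpha> t t'" using t iso by blast
    qed
  qed
qed

section \<open>Every injective morphism of hypergraphs comes from an embedding\<close>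

locale hypergraph_embedding = orthoalgebra_pair A C
  for A C :: "'a oalg" +
  fixes \<alpha> :: "'a set \<rightharpoonup> 'a set"
  assumes \<alpha>: "\<alpha> \<in> total_inj_hom (G_obj A) (G_obj C)" and proper: "proper A"
begin

lemmas \<alpha>D = total_inj_homD[OF \<alpha> A.hypergraph_G_obj]

lemma \<alpha>_point:
  assumes a: "a \<in> carrier A" "a \<noteq> zero A" "a \<noteq> one A"
  obtains p where "\<alpha> (x_sub A a) = Some p" "p \<in> points (G_obj C)"
proof -
  obtain p where p: "\<alpha> (x_sub A a) = Some p" using A.x_sub_in_points[OF a] \<alpha>D(1) by (metis domD)
  then have "p \<in> ran \<alpha>" by (rule ranI)
  then show ?thesis using that p \<alpha>D(2) by blast
qed

lemma \<alpha>_triple: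
  assumes t: "A.triple a b c"
  obtains u v w where "C.triple u v w" "\<alpha> (x_sub A a) = Some (x_sub C u)"
    "\<alpha> (x_sub A b) = Some (x_sub C v)" "\<alpha> (x_sub A c) = Some (x_sub C w)"
proof -
  note nt = A.triple_nontrivial[OF t] and cr = A.triple_carrier[OF t]
  obtain P where P: "\<alpha> (x_sub A a) = Some P" using \<alpha>_point[of a] nt cr by metis
  obtain Q where Q: "\<alpha> (x_sub A b) = Some Q" using \<alpha>_point[of b] nt cr by metis
  obtain R where R: "\<alpha> (x_sub A c) = Some R" using \<alpha>_point[of c] nt cr by metis
  have "{x_sub A a, x_sub A b, x_sub A c} \<in> lines (G_obj A)" using A.lines_G_obj t by blast
  from \<alpha>D(5)[OF this] have line: "{P, Q, R} \<in> lines (G_obj C)" using P Q R by simp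
  have neq: "X \<noteq> Y" if "\<alpha> x = Some X" "\<alpha> y = Some Y" "x \<in> points (G_obj A)" "y \<in> points (G_obj A)" "x \<noteq> y" for x y X Y
    using inj_onD[OF \<alpha>D(3), of x y] that by auto
  have "distinct [P, Q, R]"
    using neq[OF P Q] neq[OF P R] neq[OF Q R] A.triple_points[OF t] A.triple_x_sub_distinct[OF t] by simp
  from C.line_ordered[OF line this] show ?thesis using that P Q R by metis
qed

text \<open>A line on which \<open>a\<close> is a summand of the unit proposes \<open>u\<close> as the value at \<open>a\<close>.\<close>

definition summand_lift :: "'a \<Rightarrow> 'a \<Rightarrow> bool" where
  "summand_lift a u \<longleftrightarrow> (\<exists>b c v w. A.triple a b c \<and> C.triple u v w \<and> \<alpha> (x_sub A a) = Some (x_sub C u) \<and>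
     \<alpha> (x_sub A b) = Some (x_sub C v) \<and> \<alpha> (x_sub A c) = Some (x_sub C w))"

lemma summand_lift_nontrivial: "summand_lift a u \<Longrightarrow> a \<in> carrier A \<and> u \<in> carrier C \<and> u \<noteq> zero C \<and> u \<noteq> one C"
  using A.triple_carrier C.triple_carrier C.triple_nontrivial unfolding summand_lift_def by metis

lemma summand_lift_x_sub: "summand_lift a u \<Longrightarrow> \<alpha> (x_sub A a) = Some (x_sub C u)"
  unfolding summand_lift_def by blast

text \<open>Lines of the same direction at \<open>x\<^sub>a\<close> have images of the same direction by (A3): otherwise the
  images would span a plane that comes from a plane in which the two lines have opposite directions.\<close>

lemma summand_lift_unique:
  assumes l: "summand_lift a u" "summand_lift a u'" shows "u' = u"
proof (rule ccontr)
  assume ne: "u' \<noteq> u"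
  obtain b c v w where 1: "A.triple a b c" "C.triple u v w" "\<alpha> (x_sub A a) = Some (x_sub C u)"
     "\<alpha> (x_sub A b) = Some (x_sub C v)" "\<alpha> (x_sub A c) = Some (x_sub C w)"
    using l(1) unfolding summand_lift_def by blast
  obtain d e p r where 2: "A.triple a d e" "C.triple u' p r" "\<alpha> (x_sub A a) = Some (x_sub C u')"
     "\<alpha> (x_sub A d) = Some (x_sub C p)" "\<alpha> (x_sub A e) = Some (x_sub C r)"
    using l(2) unfolding summand_lift_def by blast
  have xu: "x_sub C u' = x_sub C u" using 1(3) 2(3) by simp
  then have "u' = compl C u"
    using C.x_sub_eq_iff[of u u'] summand_lift_nontrivial[OF l(1)] summand_lift_nontrivial[OF l(2)] ne by simp
  then have opp: "C.triple (compl C u) p r" using 2(2) by simp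
  let ?l = "{x_sub A a, x_sub A b, x_sub A c}" and ?m = "{x_sub A a, x_sub A d, x_sub A e}"
  let ?l' = "{x_sub C u, x_sub C v, x_sub C w}" and ?m' = "{x_sub C u, x_sub C p, x_sub C r}"
  obtain t' where t': "t' \<in> planes (G_obj C)" "?l' \<subseteq> t'" "?m' \<subseteq> t'" "edge_point (G_obj C) t' (x_sub C u)"
      "?l' \<inter> ?m' = {x_sub C u}"
    using C.opposite_lines_plane[OF 1(2) opp] by metis
  have il: "(the \<circ> \<alpha>) ` ?l = ?l'" "(the \<circ> \<alpha>) ` ?m = ?m'" using 1 2 xu by simp_all
  have line: "?l \<in> lines (G_obj A)" "?m \<in> lines (G_obj A)" using A.lines_G_obj 1(1) 2(1) by blast+
  have lp: "?l \<subseteq> points (G_obj A)" "?m \<subseteq> points (G_obj A)"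
    using A.triple_points[OF 1(1)] A.triple_points[OF 2(1)] by simp_all
  have "(the \<circ> \<alpha>) ` (?l \<inter> ?m) = (the \<circ> \<alpha>) ` ?l \<inter> (the \<circ> \<alpha>) ` ?m"
    by (rule inj_on_image_Int[OF \<alpha>D(4) lp])
  also have "\<dots> = {x_sub C u}" unfolding il by (rule t'(5))
  finally have "(the \<circ> \<alpha>) ` (?l \<inter> ?m) = (the \<circ> \<alpha>) ` {x_sub A a}" using 1(3) by simp
  then have int: "?l \<inter> ?m = {x_sub A a}"
    by (rule iffD1[OF inj_on_image_eq_iff[OF \<alpha>D(4)], rotated 2]) (use lp in auto)
  have neq: "?l' \<noteq> ?m'"
  proof
    assume "?l' = ?m'"
    then have "?l' = {x_sub C u}" using t'(5) by (metis Int_absorb)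
    then have "x_sub C v \<in> {x_sub C u}" by (metis insertI1 insertI2)
    then have "x_sub C v = x_sub C u" by simp
    then show False using C.triple_x_sub_distinct[OF 1(2)] by simp
  qed
  obtain t where t: "t \<in> planes (G_obj A)" "?l \<subseteq> t" "?m \<subseteq> t" "maps_plane_iso (G_obj A) (G_obj C) \<alpha> t t'"
  proof (rule A3D[OF \<alpha>D(7) line int _ _ _ _ _ t'(1) _ _ _ 1(3) t'(4)])
    show "?l \<subseteq> dom \<alpha>" "?m \<subseteq> dom \<alpha>" unfolding \<alpha>D(1) using lp by blast+
    show "(the \<circ> \<alpha>) ` ?l \<in> lines (G_obj C)" "(the \<circ> \<alpha>) ` ?m \<in> lines (G_obj C)" using \<alpha>D(5) line by blast+
    show "(the \<circ> \<alpha>) ` ?l \<noteq> (the \<circ> \<alpha>) ` ?m" unfolding il by (rule neq)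
    show "(the \<circ> \<alpha>) ` ?l \<subseteq> t'" "(the \<circ> \<alpha>) ` ?m \<subseteq> t'" unfolding il by (rule t')+
    show "(the \<circ> \<alpha>) ` ?l \<inter> (the \<circ> \<alpha>) ` ?m = {x_sub C u}" unfolding il by (rule t')
  qed
  have "x_sub A a \<in> t" using t(2) by blast
  then have "edge_point (G_obj A) t (x_sub A a)"
    using edge_point_iso[OF t(4) A.hypergraph_G_obj t(1)] t'(4) 1(3) by simp
  from A.same_direction_lines_eq[OF 1(1) 2(1) t(1-3) this]
  have "?l = ?m" by simp
  then show False using il neq by simp
qed

text \<open>Lines of opposite direction at \<open>x\<^sub>a\<close> span a plane, so their images have opposite directions
  by (A2).\<close>

lemma summand_lift_opposite:
  assumes l: "summand_lift a u" "summand_lift (compl A a) u'" shows "u' = compl C u"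
proof (rule ccontr)
  assume ne: "u' \<noteq> compl C u"
  obtain b c v w where 1: "A.triple a b c" "C.triple u v w" "\<alpha> (x_sub A a) = Some (x_sub C u)"
     "\<alpha> (x_sub A b) = Some (x_sub C v)" "\<alpha> (x_sub A c) = Some (x_sub C w)"
    using l(1) unfolding summand_lift_def by blast
  obtain d e p r where 2: "A.triple (compl A a) d e" "C.triple u' p r" "\<alpha> (x_sub A (compl A a)) = Some (x_sub C u')"
     "\<alpha> (x_sub A d) = Some (x_sub C p)" "\<alpha> (x_sub A e) = Some (x_sub C r)"
    using l(2) unfolding summand_lift_def by blast
  have "a \<in> carrier A" using summand_lift_nontrivial[OF l(1)] by blast
  then have "x_sub C u' = x_sub C u" using 1(3) 2(3) A.x_sub_compl by simp
  then have "u' = u"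
    using C.x_sub_eq_iff[of u u'] summand_lift_nontrivial[OF l(1)] summand_lift_nontrivial[OF l(2)] ne by simp
  then have 2: "A.triple (compl A a) d e" "C.triple u p r"
     "\<alpha> (x_sub A d) = Some (x_sub C p)" "\<alpha> (x_sub A e) = Some (x_sub C r)" using 2 by simp_all
  let ?l = "{x_sub A a, x_sub A b, x_sub A c}" and ?m = "{x_sub A a, x_sub A d, x_sub A e}"
  let ?l' = "{x_sub C u, x_sub C v, x_sub C w}" and ?m' = "{x_sub C u, x_sub C p, x_sub C r}"
  obtain t where t: "t \<in> planes (G_obj A)" "?l \<subseteq> t" "?m \<subseteq> t" "edge_point (G_obj A) t (x_sub A a)"
      "?l \<inter> ?m = {x_sub A a}"
    using A.opposite_lines_plane[OF 1(1) 2(1)] by metis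
  obtain t' where t': "t' \<in> planes (G_obj C)" "maps_plane_iso (G_obj A) (G_obj C) \<alpha> t t'" using \<alpha>D(6)[OF t(1)] by blast
  have il: "(the \<circ> \<alpha>) ` ?l = ?l'" "(the \<circ> \<alpha>) ` ?m = ?m'" using 1 2 by simp_all
  have "(the \<circ> \<alpha>) ` t = t'" using t'(2) by (simp add: maps_plane_iso_def bij_betw_def)
  then have sub: "?l' \<subseteq> t'" "?m' \<subseteq> t'" using t(2,3) il by (metis image_mono)+
  have "x_sub A a \<in> t" using t(2) by blast
  then have "edge_point (G_obj C) t' (x_sub C u)"
    using edge_point_iso[OF t'(2) A.hypergraph_G_obj t(1)] t(4) 1(3) by simp
  from C.same_direction_lines_eq[OF 1(2) 2(2) t'(1) sub this]
  have "?l' = ?m'" by simp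
  then have eq: "(the \<circ> \<alpha>) ` ?l = (the \<circ> \<alpha>) ` ?m" using il by simp
  have lp: "?l \<subseteq> points (G_obj A)" "?m \<subseteq> points (G_obj A)"
    by (rule subset_trans[OF t(2) hypergraph_plane[OF A.hypergraph_G_obj t(1)]],
        rule subset_trans[OF t(3) hypergraph_plane[OF A.hypergraph_G_obj t(1)]])
  have "?l = ?m" by (rule iffD1[OF inj_on_image_eq_iff[OF \<alpha>D(4) lp] eq])
  then have "?l = {x_sub A a}" using t(5) by (metis Int_absorb)
  then have "x_sub A b \<in> {x_sub A a}" by (metis insertI1 insertI2)
  then have "x_sub A b = x_sub A a" by simp
  then show False using A.triple_x_sub_distinct[OF 1(1)] by simp
qed

text \<open>By closing up under complements, every nontrivial \<open>a\<close> of a proper orthoalgebra gets a value, as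
  \<open>a\<close> or its complement is a summand of the unit on some line.\<close>

definition lifts_to :: "'a \<Rightarrow> 'a \<Rightarrow> bool" where
  "lifts_to a u \<longleftrightarrow> a \<in> carrier A \<and> u \<in> carrier C \<and> (summand_lift a u \<or> summand_lift (compl A a) (compl C u))"

lemma lifts_to_unique: assumes "lifts_to a u" "lifts_to a u'" shows "u' = u"
proof -
  have c: "a \<in> carrier A" "u \<in> carrier C" "u' \<in> carrier C" using assms by (auto simp: lifts_to_def)
  consider "summand_lift a u" "summand_lift a u'" | "summand_lift a u" "summand_lift (compl A a) (compl C u')"
    | "summand_lift (compl A a) (compl C u)" "summand_lift a u'" | "summand_lift (compl A a) (compl C u)" "summand_lift (compl A a) (compl C u')"
    using assms by (auto simp: lifts_to_def)
  then show ?thesis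
  proof cases
    case 1 then show ?thesis by (rule summand_lift_unique)
  next
    case 2 then have "compl C u' = compl C u" by (rule summand_lift_opposite)
    then show ?thesis using C.compl_compl c by metis
  next
    case 3 then have "compl C u = compl C u'" using summand_lift_opposite by blast
    then show ?thesis using C.compl_compl c by metis
  next
    case 4 then have "compl C u' = compl C u" by (rule summand_lift_unique)
    then show ?thesis using C.compl_compl c by metis
  qed
qed

lemma lifts_to_compl: "lifts_to a u \<Longrightarrow> lifts_to (compl A a) (compl C u)"
  using A.compl_in C.compl_in A.compl_compl C.compl_compl by (auto simp: lifts_to_def)

lemma lifts_to_x_sub: assumes "lifts_to a u" shows "\<alpha> (x_sub A a) = Some (x_sub C u)" "u \<noteq> zero C" "u \<noteq> one C"
proof -
  have c: "a \<in> carrier A" "u \<in> carrier C" using assms by (auto simp: lifts_to_def)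
  have "\<alpha> (x_sub A a) = Some (x_sub C u) \<and> u \<noteq> zero C \<and> u \<noteq> one C"
  proof (cases "summand_lift a u")
    case True then show ?thesis using summand_lift_x_sub summand_lift_nontrivial by blast
  next
    case False
    then have l: "summand_lift (compl A a) (compl C u)" using assms by (simp add: lifts_to_def)
    then show ?thesis
      using summand_lift_x_sub[OF l] summand_lift_nontrivial[OF l] A.x_sub_compl C.x_sub_compl C.compl_one C.compl_zero c by auto
  qed
  then show "\<alpha> (x_sub A a) = Some (x_sub C u)" "u \<noteq> zero C" "u \<noteq> one C" by blast+
qed

lemma triple_summand_lift: assumes "A.triple a b c" obtains u where "summand_lift a u"
  using \<alpha>_triple[OF assms] assms unfolding summand_lift_def by metis

lemma lifts_to_exists:
  assumes a: "a \<in> carrier A" "a \<noteq> zero A" "a \<noteq> one A" shows "\<exists>u. lifts_to a u"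
proof -
  obtain b c where "A.triple a b c \<or> A.triple (compl A a) b c" using A.proper_triple[OF proper a] by blast
  then show ?thesis
  proof
    assume "A.triple a b c"
    then obtain u where "summand_lift a u" using triple_summand_lift by blast
    then show ?thesis using summand_lift_nontrivial by (auto simp: lifts_to_def)
  next
    assume "A.triple (compl A a) b c"
    then obtain u where "summand_lift (compl A a) u" using triple_summand_lift by blast
    then have "lifts_to (compl A a) u" using summand_lift_nontrivial by (auto simp: lifts_to_def)
    then show ?thesis using lifts_to_compl A.compl_compl[OF a(1)] by metis
  qed
qed

definition lifted :: "'a \<Rightarrow> 'a" where
  "lifted a = (if a \<notin> carrier A then undefined else if a = zero A then zero C else if a = one A then one C
     else THE u. lifts_to a u)"

lemma lifted_lifts_to:
  assumes a: "a \<in> carrier A" "a \<noteq> zero A" "a \<noteq> one A" shows "lifts_to a (lifted a)"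
proof -
  have "\<exists>!u. lifts_to a u" using lifts_to_exists[OF a] lifts_to_unique by blast
  from theI'[OF this] show ?thesis using a by (simp add: lifted_def)
qed

lemma lifted_eqI: assumes "lifts_to a u" "a \<noteq> zero A" "a \<noteq> one A" shows "lifted a = u"
  using lifts_to_unique[OF assms(1)] lifted_lifts_to[of a] assms by (simp add: lifts_to_def)

lemma zero_neq_one: "zero A \<noteq> one A" "zero C \<noteq> one C"
proof -
  obtain a where a: "a \<in> carrier A" "a \<noteq> zero A" "a \<noteq> one A" using A.proper_ex_nontrivial[OF proper] by blast
  then show "zero A \<noteq> one A" using A.nontrivial_carrier by blast
  obtain p where "p \<in> points (G_obj C)" using \<alpha>_point[OF a] by metis
  then obtain u where "u \<in> carrier C" "u \<noteq> zero C" by (auto simp: C.points_G_obj)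
  then show "zero C \<noteq> one C" using C.nontrivial_carrier by blast
qed

lemma lifted_zero: "lifted (zero A) = zero C" and lifted_one: "lifted (one A) = one C"
  using A.zero_closed A.one_closed zero_neq_one by (simp_all add: lifted_def)

lemma lifted_carrier: assumes "a \<in> carrier A" shows "lifted a \<in> carrier C"
  using lifted_lifts_to[OF assms] lifted_zero lifted_one C.zero_closed C.one_closed by (cases "a = zero A \<or> a = one A") (auto simp: lifts_to_def)

lemma lifted_compl: assumes a: "a \<in> carrier A" shows "lifted (compl A a) = compl C (lifted a)"
proof (cases "a = zero A \<or> a = one A")
  case True
  then show ?thesis using lifted_zero lifted_one A.compl_zero A.compl_one C.compl_zero C.compl_one by auto
next
  case False
  then have "lifts_to (compl A a) (compl C (lifted a))" using lifts_to_compl lifted_lifts_to a by blast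
  then show ?thesis using False A.compl_eq_zero[OF a] A.compl_eq_one[OF a] by (intro lifted_eqI) auto
qed

lemma lifted_triple: assumes t: "A.triple a b c" shows "C.triple (lifted a) (lifted b) (lifted c)"
proof -
  obtain u v w where u: "C.triple u v w" "\<alpha> (x_sub A a) = Some (x_sub C u)"
    "\<alpha> (x_sub A b) = Some (x_sub C v)" "\<alpha> (x_sub A c) = Some (x_sub C w)" using \<alpha>_triple[OF t] by metis
  have "summand_lift a u" "summand_lift b v" "summand_lift c w"
    using u t A.triple_rotate[OF t] C.triple_rotate[OF u(1)] A.triple_rotate[OF A.triple_rotate[OF t]]
      C.triple_rotate[OF C.triple_rotate[OF u(1)]] unfolding summand_lift_def by blast+
  then have "lifts_to a u" "lifts_to b v" "lifts_to c w" using summand_lift_nontrivial unfolding lifts_to_def by blast+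
  then have "lifted a = u" "lifted b = v" "lifted c = w" using lifted_eqI A.triple_nontrivial[OF t] by blast+
  then show ?thesis using u by simp
qed

lemma lifted_oplus:
  assumes s: "oplus A a b = Some c" shows "oplus C (lifted a) (lifted b) = Some (lifted c)"
proof -
  have cr: "a \<in> carrier A" "b \<in> carrier A" "c \<in> carrier A" using A.oplus_closed[OF s] by auto
  consider "a = zero A" | "b = zero A" | "c = one A" | "a \<noteq> zero A" "b \<noteq> zero A" "c \<noteq> one A" by blast
  then show ?thesis
  proof cases
    case 1
    then have "oplus A b a = Some c" "oplus A b a = Some b" using s A.oplus_comm[of a b] A.oplus_zero[OF cr(2)] by simp_all
    then show ?thesis using 1 lifted_zero C.oplus_zero[OF lifted_carrier[OF cr(2)]] C.oplus_comm by simp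
  next
    case 2
    then have "c = a" using s A.oplus_zero[OF cr(1)] by simp
    then show ?thesis using 2 lifted_zero C.oplus_zero[OF lifted_carrier[OF cr(1)]] by simp
  next
    case 3
    then have "b = compl A a" using s A.compl_eqI by simp
    then show ?thesis using 3 lifted_compl lifted_one C.oplus_compl lifted_carrier cr by simp
  next
    case 4
    then have "A.triple a b (compl A c)"
      using s cr A.compl_compl A.compl_in A.compl_eq_zero by (simp add: A.triple_def)
    from lifted_triple[OF this] have "oplus C (lifted a) (lifted b) = Some (compl C (lifted (compl A c)))"
      by (simp add: C.triple_def)
    then show ?thesis using lifted_compl cr C.compl_compl lifted_carrier by simp
  qed
qed

lemma lifted_inj: "inj_on lifted (carrier A)"
proof (rule inj_onI)
  have triv: "lifted a = zero C \<longleftrightarrow> a = zero A" "lifted a = one C \<longleftrightarrow> a = one A" if "a \<in> carrier A" for a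
    using that lifted_zero lifted_one zero_neq_one lifts_to_x_sub(2,3)[OF lifted_lifts_to[OF that]] by metis+
  fix a b assume a: "a \<in> carrier A" and b: "b \<in> carrier A" and eq: "lifted a = lifted b"
  show "a = b"
  proof (cases "a = zero A \<or> a = one A")
    case True then show ?thesis using triv[OF a] triv[OF b] eq by metis
  next
    case False
    then have nb: "b \<noteq> zero A" "b \<noteq> one A" using triv[OF a] triv[OF b] eq by metis+
    have "\<alpha> (x_sub A a) = \<alpha> (x_sub A b)"
      using lifts_to_x_sub(1)[OF lifted_lifts_to[of a]] lifts_to_x_sub(1)[OF lifted_lifts_to[of b]] a b False nb eq by simp
    then have "x_sub A a = x_sub A b"
      using inj_onD[OF \<alpha>D(3)] A.x_sub_in_points a b False nb by simp
    then have "b = a \<or> b = compl A a" using A.x_sub_eq_iff[of a b] a b False by simp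
    moreover have "lifted a \<noteq> lifted (compl A a)"
      using lifted_compl[OF a] C.compl_neq[OF lifted_carrier[OF a]] triv[OF a] False by metis
    ultimately show ?thesis using eq by auto
  qed
qed

lemma lifted_embedding: "orthoalgebra_embedding A C lifted"
proof
  have "lifted \<in> carrier A \<rightarrow>\<^sub>E carrier C"
    by (rule PiE_I) (rule lifted_carrier, assumption, simp add: lifted_def)
  then show "lifted \<in> oalg_hom A C"
    unfolding oalg_hom_def using lifted_compl lifted_oplus by blast
qed (rule lifted_inj)

lemma G_map_lifted: "G_map A C lifted = \<alpha>"
proof
  interpret e: orthoalgebra_embedding A C lifted by (rule lifted_embedding)
  fix p
  show "G_map A C lifted p = \<alpha> p"
  proof (cases "p \<in> points (G_obj A)")
    case True
    then obtain a where a: "a \<in> carrier A" "a \<noteq> zero A" "a \<noteq> one A" "p = x_sub A a" by (auto simp: A.points_G_obj)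
    then show ?thesis using e.G_map_x_sub lifts_to_x_sub(1)[OF lifted_lifts_to] by simp
  next
    case False
    then show ?thesis using e.G_map_None[of p] \<alpha>D(1) by (metis domIff)
  qed
qed

end

section \<open>The equivalence\<close>

lemma OAi_simps:
  "Obj OAi = {A. orthoalgebra A \<and> proper A}"
  "Hom OAi A C = {f \<in> oalg_hom A C. inj_on f (carrier A)}"
  "category.Id OAi A = restrict id (carrier A)"
  "Comp OAi A C D g f = compose (carrier A) g f"
  by (auto simp: OAi_def OA_def)

lemma OHi_simps:
  "Obj OHi = {H. orthohypergraph H \<and> points H \<noteq> {} \<and> (\<forall>p\<in>points H. \<exists>l\<in>lines H. p \<in> l)}"
  "Hom OHi H K = total_inj_hom H K"
  "category.Id OHi H = Some |` points H"
  "Comp OHi H K M \<beta> \<alpha> = \<beta> \<circ>\<^sub>m \<alpha>"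
  by (auto simp: OHi_def OH_def total_inj_hom_def)

lemma Hom_OAi_iff:
  assumes "A \<in> Obj OAi" "C \<in> Obj OAi"
  shows "f \<in> Hom OAi A C \<longleftrightarrow> orthoalgebra_embedding A C f"
  using assms
  by (simp add: OAi_simps orthoalgebra_embedding_def orthoalgebra_pair_def orthoalgebra_embedding_axioms_def)

lemma compose_oalg_hom:
  assumes f: "f \<in> oalg_hom A C" and g: "g \<in> oalg_hom C D" and A: "orthoalgebra A"
  shows "compose (carrier A) g f \<in> oalg_hom A D"
proof -
  interpret orthoalgebra A by (rule A)
  have fc: "f a \<in> carrier C" if "a \<in> carrier A" for a using f that by (auto simp: oalg_hom_def)
  have "compose (carrier A) g f \<in> carrier A \<rightarrow>\<^sub>E carrier D"
    using fc g by (intro PiE_I) (auto simp: compose_def oalg_hom_def)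
  moreover have "compose (carrier A) g f (compl A a) = compl D (compose (carrier A) g f a)" if "a \<in> carrier A" for a
    using that f g fc compl_in by (simp add: compose_def oalg_hom_def)
  moreover have "oplus D (compose (carrier A) g f a) (compose (carrier A) g f b) = Some (compose (carrier A) g f c)"
    if s: "oplus A a b = Some c" for a b c
  proof -
    have "a \<in> carrier A" "b \<in> carrier A" "c \<in> carrier A" using oplus_closed[OF s] by auto
    then show ?thesis using f g fc s by (simp add: compose_def oalg_hom_def)
  qed
  ultimately show ?thesis unfolding oalg_hom_def by blast
qed

lemma is_category_OAi: "is_category (OAi :: ('a oalg, 'a \<Rightarrow> 'a) category)"
proof
  fix A C D E :: "'a oalg" and f g h
  assume A: "A \<in> Obj OAi"
  then have oA: "orthoalgebra A" by (simp add: OAi_simps)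
  interpret orthoalgebra A by (rule oA)
  show "category.Id OAi A \<in> Hom OAi A A"
  proof -
    have "restrict id (carrier A) \<in> carrier A \<rightarrow>\<^sub>E carrier A" by (rule PiE_I) auto
    then show ?thesis
      using compl_in oplus_closed by (simp add: OAi_simps oalg_hom_def inj_on_def)
  qed
  assume C: "C \<in> Obj OAi" and f: "f \<in> Hom OAi A C"
  then have f': "f \<in> extensional (carrier A)" "\<And>a. a \<in> carrier A \<Longrightarrow> f a \<in> carrier C"
    by (auto simp: OAi_simps oalg_hom_def PiE_def)
  show "Comp OAi A A C f (category.Id OAi A) = f" "Comp OAi A C C (category.Id OAi C) f = f"
    using f' by (auto simp: OAi_simps compose_def extensional_def fun_eq_iff)
  assume D: "D \<in> Obj OAi" and g: "g \<in> Hom OAi C D"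
  show "Comp OAi A C D g f \<in> Hom OAi A D"
    using compose_oalg_hom[of f A C g D] f g oA f'(2) by (auto simp: OAi_simps inj_on_def compose_def)
  show "Comp OAi A D E h (Comp OAi A C D g f) = Comp OAi A C E (Comp OAi C D E h g) f"
    using f'(2) by (auto simp: OAi_simps compose_def fun_eq_iff)
qed

lemma orthohypergraph_hypergraph: "orthohypergraph H \<Longrightarrow> hypergraph H"
  by (simp add: orthohypergraph_def)

lemma restrict_Some_total_inj_hom: "hypergraph H \<Longrightarrow> Some |` points H \<in> total_inj_hom H H"
  using bij_total_inj_hom[of H H "\<lambda>p. p"] by (simp add: restrict_map_def bij_betw_def)

lemma is_category_OHi: "is_category (OHi :: ('a set hgraph, 'a set \<rightharpoonup> 'a set) category)"
proof
  fix H K M N :: "'a set hgraph" and \<alpha> \<beta> \<gamma>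
  assume H: "H \<in> Obj OHi"
  then have hH: "hypergraph H" by (simp add: OHi_simps orthohypergraph_hypergraph)
  show "category.Id OHi H \<in> Hom OHi H H" using restrict_Some_total_inj_hom[OF hH] by (simp add: OHi_simps)
  assume K: "K \<in> Obj OHi" and \<alpha>: "\<alpha> \<in> Hom OHi H K"
  then have hK: "hypergraph K" and \<alpha>': "\<alpha> \<in> total_inj_hom H K" by (simp_all add: OHi_simps orthohypergraph_hypergraph)
  note a = total_inj_homD(1,2)[OF \<alpha>' hH]
  show "Comp OHi H H K \<alpha> (category.Id OHi H) = \<alpha>"
    unfolding OHi_simps
  proof
    fix p show "(\<alpha> \<circ>\<^sub>m Some |` points H) p = \<alpha> p"
      using a(1) domIff[of p \<alpha>] by (cases "p \<in> points H") (simp_all add: map_comp_def restrict_map_def)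
  qed
  show "Comp OHi H K K (category.Id OHi K) \<alpha> = \<alpha>"
    unfolding OHi_simps
  proof
    fix p show "(Some |` points K \<circ>\<^sub>m \<alpha>) p = \<alpha> p"
      using a(2) by (cases "\<alpha> p") (auto simp: map_comp_def restrict_map_def ran_def)
  qed
  assume M: "M \<in> Obj OHi" and \<beta>: "\<beta> \<in> Hom OHi K M"
  show "Comp OHi H K M \<beta> \<alpha> \<in> Hom OHi H M"
    using total_inj_hom_comp[OF \<alpha>' _ hH hK] \<beta> by (simp add: OHi_simps)
  show "Comp OHi H M N \<gamma> (Comp OHi H K M \<beta> \<alpha>) = Comp OHi H K N (Comp OHi K M N \<gamma> \<beta>) \<alpha>"
    by (auto simp: OHi_simps map_comp_def fun_eq_iff split: option.split)
qed

lemma G_obj_in_OHi: assumes "A \<in> Obj OAi" shows "G_obj A \<in> Obj OHi"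
proof -
  have oA: "orthoalgebra A" and proper: "proper A" using assms by (simp_all add: OAi_simps)
  interpret orthoalgebra A by (rule oA)
  have "hypergraph_isomorphic (G_obj A) (G_obj A)"
    unfolding hypergraph_isomorphic_def by (intro exI[of _ id]) simp
  then have "orthohypergraph (G_obj A)" unfolding orthohypergraph_def using hypergraph_G_obj oA by blast
  moreover have "points (G_obj A) \<noteq> {}" using proper_ex_nontrivial[OF proper] x_sub_in_points by blast
  moreover have "\<exists>l\<in>lines (G_obj A). p \<in> l" if "p \<in> points (G_obj A)" for p
  proof -
    obtain a where a: "a \<in> carrier A" "a \<noteq> zero A" "a \<noteq> one A" "p = x_sub A a" using \<open>p \<in> points (G_obj A)\<close> by (auto simp: points_G_obj)
    obtain b c where "triple a b c \<or> triple (compl A a) b c" using proper_triple[OF proper a(1-3)] by blast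
    moreover have "p = x_sub A (compl A a)" using a x_sub_compl by simp
    ultimately obtain d where "triple d b c" "p = x_sub A d" using a(4) by metis
    then have "{x_sub A d, x_sub A b, x_sub A c} \<in> lines (G_obj A)" "p \<in> {x_sub A d, x_sub A b, x_sub A c}"
      using lines_G_obj by auto
    then show ?thesis by (rule bexI[rotated])
  qed
  ultimately show ?thesis by (simp add: OHi_simps)
qed

lemma is_functor_G: "is_functor (OAi :: ('a oalg, 'a \<Rightarrow> 'a) category) OHi G_obj G_map"
proof (rule is_functor.intro[OF is_category_OAi is_category_OHi], unfold_locales)
  fix A C D :: "'a oalg" and f g
  assume A: "A \<in> Obj OAi"
  then show "G_obj A \<in> Obj OHi" by (rule G_obj_in_OHi)
  show "G_map A A (category.Id OAi A) = category.Id OHi (G_obj A)"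
  proof
    have "category.Id OAi A \<in> Hom OAi A A" using is_category.Id_in_Hom[OF is_category_OAi A] .
    then interpret orthoalgebra_embedding A A "category.Id OAi A" using Hom_OAi_iff[OF A A] by blast
    fix p
    show "G_map A A (category.Id OAi A) p = category.Id OHi (G_obj A) p"
    proof (cases "p \<in> points (G_obj A)")
      case True
      then obtain a where a: "a \<in> carrier A" "a \<noteq> zero A" "a \<noteq> one A" "p = x_sub A a" by (auto simp: A.points_G_obj)
      have "category.Id OAi A a = a" using a(1) by (simp add: OAi_simps)
      then have "G_map A A (category.Id OAi A) p = Some p" using G_map_x_sub[OF a(1-3)] a(4) by simp
      then show ?thesis using True by (simp add: OHi_simps)
    next
      case False then show ?thesis using G_map_None[OF False] by (simp add: OHi_simps)
    qed
  qed
  assume C: "C \<in> Obj OAi" and f: "f \<in> Hom OAi A C"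
  interpret f: orthoalgebra_embedding A C f using Hom_OAi_iff[OF A C] f by blast
  show "G_map A C f \<in> Hom OHi (G_obj A) (G_obj C)" using f.G_map_total_inj_hom by (simp add: OHi_simps)
  assume D: "D \<in> Obj OAi" and g: "g \<in> Hom OAi C D"
  interpret g: orthoalgebra_embedding C D g using Hom_OAi_iff[OF C D] g by blast
  let ?h = "Comp OAi A C D g f"
  have "?h \<in> Hom OAi A D" using is_category.Comp_in_Hom[OF is_category_OAi A C D f g] .
  then interpret h: orthoalgebra_embedding A D ?h using Hom_OAi_iff[OF A D] by blast
  show "G_map A D ?h = Comp OHi (G_obj A) (G_obj C) (G_obj D) (G_map C D g) (G_map A C f)"
  proof
    fix p
    show "G_map A D ?h p = Comp OHi (G_obj A) (G_obj C) (G_obj D) (G_map C D g) (G_map A C f) p"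
    proof (cases "p \<in> points (G_obj A)")
      case True
      then obtain a where a: "a \<in> carrier A" "a \<noteq> zero A" "a \<noteq> one A" and p: "p = x_sub A a" by (auto simp: f.A.points_G_obj)
      have "?h a = g (f a)" using a(1) by (simp add: OAi_simps compose_def)
      then have "G_map A D ?h p = Some (x_sub D (g (f a)))" using h.G_map_x_sub[OF a] p by simp
      moreover have "G_map A C f p = Some (x_sub C (f a))" using f.G_map_x_sub[OF a] p by simp
      moreover have "G_map C D g (x_sub C (f a)) = Some (x_sub D (g (f a)))"
        using g.G_map_x_sub f.f_carrier f.f_eq_zero_iff f.f_eq_one_iff a by simp
      ultimately show ?thesis by (simp add: OHi_simps)
    next
      case False
      then show ?thesis using f.G_map_None[OF False] h.G_map_None[OF False] by (simp add: OHi_simps)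
    qed
  qed
qed

text \<open>An isomorphism of hypergraphs and its inverse are both morphisms, (A3) being clear since planes
  can be pulled back.\<close>

lemma hypergraph_isomorphic_is_iso:
  assumes H: "hypergraph H" and K: "hypergraph K" and iso: "hypergraph_isomorphic H K"
  shows "\<exists>e. is_iso OHi K H e"
proof -
  obtain \<phi> where bij: "bij_betw \<phi> (points H) (points K)" and ln: "(\<lambda>l. \<phi> ` l) ` lines H = lines K"
    and pl: "(\<lambda>t. \<phi> ` t) ` planes H = planes K" using iso unfolding hypergraph_isomorphic_def by metis
  define \<psi> where "\<psi> = inv_into (points H) \<phi>"
  have bij': "bij_betw \<psi> (points K) (points H)" unfolding \<psi>_def by (rule bij_betw_inv_into[OF bij])
  have inv: "\<psi> (\<phi> p) = p" if "p \<in> points H" for p using that bij by (simp add: \<psi>_def bij_betw_inv_into_left)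
  have inv': "\<phi> (\<psi> q) = q" if "q \<in> points K" for q using that bij by (simp add: \<psi>_def bij_betw_inv_into_right)
  have img: "\<psi> ` \<phi> ` S = S" if "S \<subseteq> points H" for S using inv that by (force simp: image_iff)
  have undo: "(\<lambda>l. \<psi> ` l) ` (\<lambda>l. \<phi> ` l) ` F = F" if "\<And>S. S \<in> F \<Longrightarrow> S \<subseteq> points H" for F
    using img that by (simp add: image_image)
  have ln': "(\<lambda>l. \<psi> ` l) ` lines K = lines H"
    unfolding ln[symmetric] by (rule undo) (use hypergraph_line[OF H] in blast)
  have pl': "(\<lambda>t. \<psi> ` t) ` planes K = planes H"
    unfolding pl[symmetric] by (rule undo) (use hypergraph_plane[OF H] in blast)
  let ?d = "\<lambda>p. if p \<in> points H then Some (\<phi> p) else None"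
  let ?e = "\<lambda>q. if q \<in> points K then Some (\<psi> q) else None"
  have "?e \<in> Hom OHi K H" using bij_total_inj_hom[OF K H bij' ln' pl'] by (simp add: OHi_simps)
  moreover have "?d \<in> Hom OHi H K" using bij_total_inj_hom[OF H K bij ln pl] by (simp add: OHi_simps)
  moreover have "Comp OHi K H K ?d ?e = category.Id OHi K" "Comp OHi H K H ?e ?d = category.Id OHi H"
    using inv inv' bij bij' by (auto simp: OHi_simps fun_eq_iff map_comp_def restrict_map_def bij_betw_def)
  ultimately show ?thesis unfolding is_iso_def by blast
qed

text \<open>The isomorphism transports the lines through the points of \<open>H\<close>, so every orthoalgebra that
  represents \<open>H\<close> is proper.\<close>

lemma G_ess_surj:
  assumes H: "(H :: 'a set hgraph) \<in> Obj OHi"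
  shows "\<exists>A\<in>Obj OAi. \<exists>e. is_iso OHi (G_obj A) H e"
proof -
  obtain A :: "'a oalg" where oA: "orthoalgebra A" and iso: "hypergraph_isomorphic H (G_obj A)" and hH: "hypergraph H"
    using H by (auto simp: OHi_simps orthohypergraph_def)
  interpret orthoalgebra A by (rule oA)
  obtain \<phi> where \<phi>: "bij_betw \<phi> (points H) (points (G_obj A))" "(\<lambda>l. \<phi> ` l) ` lines H = lines (G_obj A)"
    using iso unfolding hypergraph_isomorphic_def by metis
  have ne: "points H \<noteq> {}" and on: "\<And>p. p \<in> points H \<Longrightarrow> \<exists>l\<in>lines H. p \<in> l"
    using H by (auto simp: OHi_simps)
  have surj: "\<phi> ` points H = points (G_obj A)" using \<phi>(1) by (simp add: bij_betw_def)
  have "proper A"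
  proof (rule proper_if_points_on_lines)
    show "points (G_obj A) \<noteq> {}" using ne surj by blast
    fix q assume "q \<in> points (G_obj A)"
    then obtain p where p: "p \<in> points H" "q = \<phi> p" using surj by blast
    then obtain l where "l \<in> lines H" "p \<in> l" using on by blast
    then show "\<exists>l\<in>lines (G_obj A). q \<in> l" using \<phi>(2) p by blast
  qed
  then have "A \<in> Obj OAi" using oA by (simp add: OAi_simps)
  then show ?thesis using hypergraph_isomorphic_is_iso[OF hH hypergraph_G_obj iso] by blast
qed

theorem corollary7p22:
  "is_equivalence (OAi :: ('a oalg, 'a \<Rightarrow> 'a) category) OHi G_obj G_map"
proof (rule equivalence_if_full_faithful_ess_surj[OF is_functor_G])
  fix A C :: "'a oalg" and \<alpha>
  assume A: "A \<in> Obj OAi" and C: "C \<in> Obj OAi" and \<alpha>: "\<alpha> \<in> Hom OHi (G_obj A) (G_obj C)"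
  then interpret hypergraph_embedding A C \<alpha>
    by (simp add: hypergraph_embedding_def orthoalgebra_pair_def hypergraph_embedding_axioms_def OAi_simps OHi_simps)
  show "\<exists>f\<in>Hom OAi A C. G_map A C f = \<alpha>"
    using G_map_lifted lifted_embedding Hom_OAi_iff[OF A C] by blast
next
  fix A C :: "'a oalg" and f g
  assume A: "A \<in> Obj OAi" and C: "C \<in> Obj OAi" and f: "f \<in> Hom OAi A C" and g: "g \<in> Hom OAi A C"
    and eq: "G_map A C f = G_map A C g"
  have "proper A" using A by (simp add: OAi_simps)
  then show "f = g" using G_map_faithful eq f g Hom_OAi_iff[OF A C] by blast
qed (rule G_ess_surj)

end
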